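(* Let $q\ge1$ be an integer, let $\Omega\subset\mathbb{R}$ be a bounded open interval, and consider $$\lambda^*=\sup\lambda\quad\text{s.t.}\quad\inf_{u\in W_0^{1,2q}(\Omega)}\int_\Omega\left(|u_x|^{2q}-\lambda u^{2q}\right)dx\ge0.$$ Then, with $\mathcal{B}_{\rm pdr},\widehat{\mathcal{B}}_{\rm pdr},\mathcal{B}_\nu^{\rm sos},\widehat{\mathcal{B}}_\nu^{\rm sos}$ as defined in the context: 1. $\widehat{\mathcal{B}}_{\rm pdr}=\mathcal{B}_{\rm pdr}=\lambda^*$. In particular, there exist $F^k\in C(\overline\Omega)$ and $\lambda^k\in\mathbb{R}$ such that, with $\varphi^k=F^k(x)y^{2q}$, the sequence $\{(\lambda^k,\varphi^k,0)\}_{k\ge1}$ is maximizing for $\widehat{\mathcal{B}}_{\rm pdr}$, and $\{(\lambda^k,\varphi^k,0,0,\ldots,0)\}_{k\ge1}$ is maximizing for $\mathcal{B}_{\rm pdr}$. 2. Consider a semialgebraic definition of $\Omega$ (as specified in the context) for which $r^2-x^2\in\mathcal{Q}(\Omega)$ for some $r\in\mathbb{R}$. With $h=0$ and $\varphi(x,y)=F(x)y^{2q}$ for degree-$\nu$ polynomial $F(x)$, the SOS relaxations $\mathcal{B}_\nu^{\rm sos}$ and $\widehat{\mathcal{B}}_\nu^{\rm sos}$ converge to $\lambda^*$ as $\nu\to\infty$.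
   Context: $W_0^{1,2q}(\Omega)$ is the subspace of $W^{1,2q}(\Omega)$ (real-valued functions) of functions vanishing at the endpoints of $\Omega$. The boundary (the two endpoints) is written as a finite union $\partial\Omega=\bigcup_{i=1}^s\partial\Omega_i$, with outward unit normal $n_i(x)\in\{-1,1\}$ on $\partial\Omega_i$; integrals $\int_{\partial\Omega_i}\cdot\,dS$ are sums of point evaluations. Let $f(x,y,z,\lambda)=z^{2q}-\lambda y^{2q}$ for $y,z\in\mathbb{R}$. For $\varphi$ depending on $(x,y)$, let $\mathcal{D}\varphi(x,y,z)=\varphi_x(x,y)+\varphi_y(x,y)z$. $\Phi$ is the set of $\varphi\in C^1(\overline\Omega\times\mathbb{R};\mathbb{R})$ such that, for all $u\in W^{1,2q}(\Omega)$, $x\mapsto\varphi(x,u(x))$ is differentiable via the chain rule (so $\frac{d}{dx}\varphi(x,u(x))=\mathcal{D}\varphi(x,u,u_x)$) and $\int_\Omega\frac{d}{dx}\varphi(x,u(x))\,dx=\sum_i\int_{\partial\Omega_i}\varphi(x,u)\,n_i\,dS$. $\widehat\Phi$ is the set of continuously differentiable $\varphi:\Omega\times\mathbb{R}\to\mathbb{R}$ (not necessarily well defined on $\partial\Omega$) such that $\int_\Omega\frac{d}{dx}\varphi(x,u(x))\,dx=0$ for all $u\in W_0^{1,2q}(\Omega)$. Pointwise dual relaxations: $\mathcal{B}_{\rm pdr}=\sup\lambda$ over $(\lambda,\varphi,h,\ell_1,\ldots,\ell_s)$ with $\lambda\in\mathbb{R}$, $\varphi\in\Phi$, $h\in C(\overline\Omega)$,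 $\ell_i\in C(\partial\Omega_i)$, such that $f(\cdot,\lambda)+\mathcal{D}\varphi-h\ge0$ on $\Omega\times\mathbb{R}\times\mathbb{R}$, $-\varphi(x,0)n_i(x)-\ell_i(x)\ge0$ on $\partial\Omega_i$ for all $i$, and $\int_\Omega h\,dx+\sum_i\int_{\partial\Omega_i}\ell_i\,dS\ge0$. $\widehat{\mathcal{B}}_{\rm pdr}=\sup\lambda$ over $(\lambda,\varphi,h)$ with $\lambda\in\mathbb{R}$, $\varphi\in\widehat\Phi$, $h\in C(\overline\Omega)$, such that $f(\cdot,\lambda)+\mathcal{D}\varphi-h\ge0$ on $\Omega\times\mathbb{R}\times\mathbb{R}$ and $\int_\Omega h\,dx\ge0$. A maximizing sequence consists of feasible tuples whose objective values converge to the supremum. Semialgebraic setting (part 2): $\overline\Omega=\{x\in\mathbb{R}: g_1(x)\ge0,\ldots,g_s(x)\ge0\}$ with polynomials $g_i$, $\partial\Omega_i=\{x: g_i(x)=0,\ g_j(x)\ge0\text{ for }j\neq i\}$, and $g_i'\ne0$ on $\partial\Omega_i$, so $n_i=-g_i'/|g_i'|$. $\mathbb{R}[\cdot]_\nu$ denotes polynomials of degree at most $\nu$; $\Sigma[\cdot]$ denotes sums of squares of polynomials. $\mathcal{Q}(\Omega)=\{\sigma_0+\sum_ig_i\sigma_i:\sigma_k\in\Sigma[x]\}$; $\mathcal{Q}_\nu(\Gamma)$ is the set of polynomials of degree at most $\nu$ in $\{\sigma_0+\sum_ig_i\sigma_i:\sigma_k\in\Sigma[x,y,z]\}$; $\mathcal{Q}_\nu(\Lambda_i)$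 is the set of polynomials of degree at most $\nu$ in $\{\rho_1y+\rho_2g_i+\sigma_0+\sum_{j\ne i}g_j\sigma_j:\sigma_k\in\Sigma[x,y],\ \rho_1,\rho_2\in\mathbb{R}[x,y]\}$. SOS relaxations with the stated ansatz $h=0$, $\varphi(x,y)=F(x)y^{2q}$: $\mathcal{B}_\nu^{\rm sos}=\sup\lambda$ over $\lambda\in\mathbb{R}$, $F\in\mathbb{R}[x]_\nu$, $q_1,\ldots,q_s\in\mathbb{R}[x]_\nu$ (polynomials, not to be confused with the integer $q$) with $f(\cdot,\lambda)+\mathcal{D}\varphi\in\mathcal{Q}_\nu(\Gamma)$, $\varphi g_i'-q_i|g_i'|^2\in\mathcal{Q}_\nu(\Lambda_i)$ for all $i$, and $\sum_i\int_{\partial\Omega_i}q_i|g_i'|\,dS\ge0$. $\widehat{\mathcal{B}}_\nu^{\rm sos}=\sup\lambda$ over $\lambda\in\mathbb{R}$, $F\in\mathbb{R}[x]_\nu$ with $f(\cdot,\lambda)+\mathcal{D}\varphi\in\mathcal{Q}_\nu(\Gamma)$. The supremum over the empty set is $-\infty$.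
   Formalization: In part 1 the boundary pieces ∂Ω_i are assumed pairwise disjoint; if an endpoint lies in two pieces, the divergence identity in Φ counts it more than once and B_pdr is strictly less than λ*. *)

theory Defs
  imports "HOL-Analysis.Analysis"
begin

text \<open>Throughout, \<open>\<Omega>\<close> is the open interval with endpoints \<open>a < b\<close>.\<close>

subsection \<open>Sobolev spaces on an interval\<close>

definition in_Lp :: "nat \<Rightarrow> real \<Rightarrow> real \<Rightarrow> (real \<Rightarrow> real) \<Rightarrow> bool" where
  "in_Lp p a b u \<longleftrightarrow> set_borel_measurable lborel {a<..<b} u \<and>
     set_integrable lborel {a<..<b} (\<lambda>x. \<bar>u x\<bar> ^ p)"

definition loc_integrable :: "real \<Rightarrow> real \<Rightarrow> (real \<Rightarrow> real) \<Rightarrow> bool" where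
  "loc_integrable a b u \<longleftrightarrow> (\<forall>c d. a < c \<and> d < b \<longrightarrow> set_integrable lborel {c..d} u)"

text \<open>Test functions are the compactly supported \<open>C\<^sup>1\<close> functions, as in Brezis,
  \<^emph>\<open>Functional Analysis, Sobolev Spaces and Partial Differential Equations\<close>, Section 8.2.\<close>

definition test_function :: "real \<Rightarrow> real \<Rightarrow> (real \<Rightarrow> real) \<Rightarrow> bool" where
  "test_function a b \<psi> \<longleftrightarrow> \<psi> C1_differentiable_on UNIV \<and>
     (\<exists>c d. a < c \<and> d < b \<and> (\<forall>x. x \<notin> {c..d} \<longrightarrow> \<psi> x = 0))"

definition has_weak_deriv :: "real \<Rightarrow> real \<Rightarrow> (real \<Rightarrow> real) \<Rightarrow> (real \<Rightarrow> real) \<Rightarrow> bool" where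
  "has_weak_deriv a b u v \<longleftrightarrow> loc_integrable a b u \<and> loc_integrable a b v \<and>
     (\<forall>\<psi>. test_function a b \<psi> \<longrightarrow>
        (LINT x:{a<..<b}|lborel. u x * deriv \<psi> x) = - (LINT x:{a<..<b}|lborel. v x * \<psi> x))"

text \<open>A representative of the weak derivative; it is unique up to null sets, and it is only
  used below in ways that do not depend on the choice.\<close>

definition wderiv :: "real \<Rightarrow> real \<Rightarrow> (real \<Rightarrow> real) \<Rightarrow> real \<Rightarrow> real" where
  "wderiv a b u = (SOME v. has_weak_deriv a b u v)"

text \<open>An element of \<open>W\<^sup>1\<^sup>,\<^sup>p(\<Omega>)\<close> is identified with its representative that is continuous on the
  closed interval, which exists in dimension one. Boundary values and compositions
  \<open>\<phi>(x, u(x))\<close> refer to this representative.\<close>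

definition W1 :: "nat \<Rightarrow> real \<Rightarrow> real \<Rightarrow> (real \<Rightarrow> real) set" where
  "W1 p a b = {u. continuous_on {a..b} u \<and> in_Lp p a b u \<and>
     (\<exists>v. in_Lp p a b v \<and> has_weak_deriv a b u v)}"

definition W1_0 :: "nat \<Rightarrow> real \<Rightarrow> real \<Rightarrow> (real \<Rightarrow> real) set" where
  "W1_0 p a b = {u \<in> W1 p a b. u a = 0 \<and> u b = 0}"

subsection \<open>The variational problem\<close>

definition f_int :: "nat \<Rightarrow> real \<Rightarrow> real \<Rightarrow> real \<Rightarrow> real \<Rightarrow> real" where
  "f_int q x y z lam = z ^ (2 * q) - lam * y ^ (2 * q)"

definition lambda_star :: "nat \<Rightarrow> real \<Rightarrow> real \<Rightarrow> ereal" where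
  "lambda_star q a b = Sup {ereal lam | lam.
     (INF u \<in> W1_0 (2 * q) a b.
        ereal (LINT x:{a<..<b}|lborel. \<bar>wderiv a b u x\<bar> ^ (2 * q) - lam * u x ^ (2 * q))) \<ge> 0}"

subsection \<open>The function classes \<open>\<Phi>\<close> and \<open>\<Phi>\<close>-hat\<close>

definition total_D :: "(real \<Rightarrow> real \<Rightarrow> real) \<Rightarrow> real \<Rightarrow> real \<Rightarrow> real \<Rightarrow> real" where
  "total_D \<phi> x y z = deriv (\<lambda>t. \<phi> t y) x + deriv (\<lambda>t. \<phi> x t) y * z"

definition C1_interior :: "real \<Rightarrow> real \<Rightarrow> (real \<Rightarrow> real \<Rightarrow> real) \<Rightarrow> bool" where
  "C1_interior a b \<phi> \<longleftrightarrow> (\<exists>\<phi>x \<phi>y.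
     (\<forall>x\<in>{a<..<b}. \<forall>y. ((\<lambda>t. \<phi> t y) has_real_derivative \<phi>x x y) (at x) \<and>
                      ((\<lambda>t. \<phi> x t) has_real_derivative \<phi>y x y) (at y)) \<and>
     continuous_on ({a<..<b} \<times> UNIV) (\<lambda>(x, y). \<phi>x x y) \<and>
     continuous_on ({a<..<b} \<times> UNIV) (\<lambda>(x, y). \<phi>y x y))"

text \<open>\<open>C\<^sup>1\<close> up to the boundary: the function and its first partial derivatives in the interior
  extend continuously to the closed strip.\<close>

definition C1_closure :: "real \<Rightarrow> real \<Rightarrow> (real \<Rightarrow> real \<Rightarrow> real) \<Rightarrow> bool" where
  "C1_closure a b \<phi> \<longleftrightarrow> continuous_on ({a..b} \<times> UNIV) (\<lambda>(x, y). \<phi> x y) \<and> (\<exists>\<phi>x \<phi>y.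
     (\<forall>x\<in>{a<..<b}. \<forall>y. ((\<lambda>t. \<phi> t y) has_real_derivative \<phi>x x y) (at x) \<and>
                      ((\<lambda>t. \<phi> x t) has_real_derivative \<phi>y x y) (at y)) \<and>
     continuous_on ({a..b} \<times> UNIV) (\<lambda>(x, y). \<phi>x x y) \<and>
     continuous_on ({a..b} \<times> UNIV) (\<lambda>(x, y). \<phi>y x y))"

definition outward_normal :: "real \<Rightarrow> real \<Rightarrow> real \<Rightarrow> real" where
  "outward_normal a b x = (if x = a then - 1 else 1)"

text \<open>The pieces are disjoint, so that the sum over the pieces of the boundary integrals is the
  integral over the whole boundary, as the divergence theorem in \<open>\<Phi>\<close> presupposes.\<close>

definition boundary_pieces :: "real \<Rightarrow> real \<Rightarrow> nat \<Rightarrow> (nat \<Rightarrow> real set) \<Rightarrow> bool" where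
  "boundary_pieces a b s dO \<longleftrightarrow> (\<Union>i<s. dO i) = {a, b} \<and> disjoint_family_on dO {..<s}"

text \<open>The weak derivative of \<open>x \<mapsto> \<phi>(x, u(x))\<close> is given by the chain rule, and its Lebesgue
  integral over \<open>\<Omega>\<close> exists and has the value \<open>c\<close>.\<close>

definition chain_rule_integral ::
    "real \<Rightarrow> real \<Rightarrow> (real \<Rightarrow> real \<Rightarrow> real) \<Rightarrow> (real \<Rightarrow> real) \<Rightarrow> real \<Rightarrow> bool" where
  "chain_rule_integral a b \<phi> u c \<longleftrightarrow>
     has_weak_deriv a b (\<lambda>x. \<phi> x (u x)) (\<lambda>x. total_D \<phi> x (u x) (wderiv a b u x)) \<and>
     set_integrable lborel {a<..<b} (\<lambda>x. total_D \<phi> x (u x) (wderiv a b u x)) \<and>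
     (LINT x:{a<..<b}|lborel. total_D \<phi> x (u x) (wderiv a b u x)) = c"

definition Phi ::
    "nat \<Rightarrow> real \<Rightarrow> real \<Rightarrow> nat \<Rightarrow> (nat \<Rightarrow> real set) \<Rightarrow> (real \<Rightarrow> real \<Rightarrow> real) set" where
  "Phi q a b s dO = {\<phi>. C1_closure a b \<phi> \<and>
     (\<forall>u \<in> W1 (2 * q) a b. chain_rule_integral a b \<phi> u
        (\<Sum>i<s. \<Sum>x\<in>dO i. \<phi> x (u x) * outward_normal a b x))}"

definition Phi_hat :: "nat \<Rightarrow> real \<Rightarrow> real \<Rightarrow> (real \<Rightarrow> real \<Rightarrow> real) set" where
  "Phi_hat q a b = {\<phi>. C1_interior a b \<phi> \<and>
     (\<forall>u \<in> W1_0 (2 * q) a b. chain_rule_integral a b \<phi> u 0)}"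

subsection \<open>Pointwise dual relaxations\<close>

definition pdr_feasible ::
    "nat \<Rightarrow> real \<Rightarrow> real \<Rightarrow> nat \<Rightarrow> (nat \<Rightarrow> real set) \<Rightarrow>
     real \<Rightarrow> (real \<Rightarrow> real \<Rightarrow> real) \<Rightarrow> (real \<Rightarrow> real) \<Rightarrow> (nat \<Rightarrow> real \<Rightarrow> real) \<Rightarrow> bool" where
  "pdr_feasible q a b s dO lam \<phi> h l \<longleftrightarrow>
     \<phi> \<in> Phi q a b s dO \<and> continuous_on {a..b} h \<and> (\<forall>i<s. continuous_on (dO i) (l i)) \<and>
     (\<forall>x\<in>{a<..<b}. \<forall>y z. f_int q x y z lam + total_D \<phi> x y z - h x \<ge> 0) \<and>
     (\<forall>i<s. \<forall>x\<in>dO i. - \<phi> x 0 * outward_normal a b x - l i x \<ge> 0) \<and>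
     (LINT x:{a<..<b}|lborel. h x) + (\<Sum>i<s. \<Sum>x\<in>dO i. l i x) \<ge> 0"

definition B_pdr :: "nat \<Rightarrow> real \<Rightarrow> real \<Rightarrow> nat \<Rightarrow> (nat \<Rightarrow> real set) \<Rightarrow> ereal" where
  "B_pdr q a b s dO = Sup {ereal lam | lam. \<exists>\<phi> h l. pdr_feasible q a b s dO lam \<phi> h l}"

definition pdr_hat_feasible ::
    "nat \<Rightarrow> real \<Rightarrow> real \<Rightarrow> real \<Rightarrow> (real \<Rightarrow> real \<Rightarrow> real) \<Rightarrow> (real \<Rightarrow> real) \<Rightarrow> bool" where
  "pdr_hat_feasible q a b lam \<phi> h \<longleftrightarrow>
     \<phi> \<in> Phi_hat q a b \<and> continuous_on {a..b} h \<and>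
     (\<forall>x\<in>{a<..<b}. \<forall>y z. f_int q x y z lam + total_D \<phi> x y z - h x \<ge> 0) \<and>
     (LINT x:{a<..<b}|lborel. h x) \<ge> 0"

definition B_pdr_hat :: "nat \<Rightarrow> real \<Rightarrow> real \<Rightarrow> ereal" where
  "B_pdr_hat q a b = Sup {ereal lam | lam. \<exists>\<phi> h. pdr_hat_feasible q a b lam \<phi> h}"

subsection \<open>Polynomials, sums of squares and quadratic modules\<close>

text \<open>Polynomials in \<open>(x, y)\<close> and \<open>(x, y, z)\<close> are represented by polynomial functions on
  \<open>\<real>\<^sup>2\<close> and \<open>\<real>\<^sup>3\<close>; as the field is infinite, the two notions coincide.\<close>

definition polys2_deg :: "nat \<Rightarrow> (real \<times> real \<Rightarrow> real) set" where
  "polys2_deg \<nu> = {p. \<exists>c. p = (\<lambda>(x, y).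
     \<Sum>(i, j) \<in> {(i, j). i + j \<le> \<nu>}. c i j * x ^ i * y ^ j)}"

definition polys3_deg :: "nat \<Rightarrow> (real \<times> real \<times> real \<Rightarrow> real) set" where
  "polys3_deg \<nu> = {p. \<exists>c. p = (\<lambda>(x, y, z).
     \<Sum>(i, j, k) \<in> {(i, j, k). i + j + k \<le> \<nu>}. c i j k * x ^ i * y ^ j * z ^ k)}"

definition SOS :: "('a::real_normed_vector \<Rightarrow> real) set" where
  "SOS = {p. \<exists>(m::nat) r. (\<forall>j<m. real_polynomial_function (r j)) \<and>
     p = (\<lambda>v. \<Sum>j<m. (r j v)\<^sup>2)}"

definition quad_module ::
    "nat set \<Rightarrow> (nat \<Rightarrow> 'a::real_normed_vector \<Rightarrow> real) \<Rightarrow> ('a \<Rightarrow> real) set" where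
  "quad_module I G = {p. \<exists>\<sigma>0 \<sigma>. \<sigma>0 \<in> SOS \<and> (\<forall>i\<in>I. \<sigma> i \<in> SOS) \<and>
     p = (\<lambda>v. \<sigma>0 v + (\<Sum>i\<in>I. G i v * \<sigma> i v))}"

definition Q_Omega :: "nat \<Rightarrow> (nat \<Rightarrow> real poly) \<Rightarrow> (real \<Rightarrow> real) set" where
  "Q_Omega s g = quad_module {..<s} (\<lambda>i. poly (g i))"

definition Q_Gamma :: "nat \<Rightarrow> (nat \<Rightarrow> real poly) \<Rightarrow> nat \<Rightarrow> (real \<times> real \<times> real \<Rightarrow> real) set" where
  "Q_Gamma s g \<nu> = polys3_deg \<nu> \<inter> quad_module {..<s} (\<lambda>i (x, y, z). poly (g i) x)"

definition Q_Lambda :: "nat \<Rightarrow> (nat \<Rightarrow> real poly) \<Rightarrow> nat \<Rightarrow> nat \<Rightarrow> (real \<times> real \<Rightarrow> real) set" where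
  "Q_Lambda s g i \<nu> = polys2_deg \<nu> \<inter>
     {p. \<exists>\<rho>1 \<rho>2 m. real_polynomial_function \<rho>1 \<and> real_polynomial_function \<rho>2 \<and>
        m \<in> quad_module ({..<s} - {i}) (\<lambda>j (x, y). poly (g j) x) \<and>
        p = (\<lambda>(x, y). \<rho>1 (x, y) * y + \<rho>2 (x, y) * poly (g i) x + m (x, y))}"

subsection \<open>Semialgebraic description and SOS relaxations\<close>

definition bdry_piece :: "nat \<Rightarrow> (nat \<Rightarrow> real poly) \<Rightarrow> nat \<Rightarrow> real set" where
  "bdry_piece s g i = {x. poly (g i) x = 0 \<and> (\<forall>j<s. j \<noteq> i \<longrightarrow> poly (g j) x \<ge> 0)}"

definition semialgebraic_description ::
    "real \<Rightarrow> real \<Rightarrow> nat \<Rightarrow> (nat \<Rightarrow> real poly) \<Rightarrow> bool" where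
  "semialgebraic_description a b s g \<longleftrightarrow>
     {a..b} = {x. \<forall>i<s. poly (g i) x \<ge> 0} \<and>
     (\<forall>i<s. \<forall>x\<in>bdry_piece s g i. poly (pderiv (g i)) x \<noteq> 0)"

definition ansatz :: "nat \<Rightarrow> (real \<Rightarrow> real) \<Rightarrow> real \<Rightarrow> real \<Rightarrow> real" where
  "ansatz q F x y = F x * y ^ (2 * q)"

definition sos_hat_feasible ::
    "nat \<Rightarrow> nat \<Rightarrow> (nat \<Rightarrow> real poly) \<Rightarrow> nat \<Rightarrow> real \<Rightarrow> real poly \<Rightarrow> bool" where
  "sos_hat_feasible q s g \<nu> lam F \<longleftrightarrow> degree F \<le> \<nu> \<and>
     (\<lambda>(x, y, z). f_int q x y z lam + total_D (ansatz q (poly F)) x y z) \<in> Q_Gamma s g \<nu>"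

definition sos_feasible ::
    "nat \<Rightarrow> nat \<Rightarrow> (nat \<Rightarrow> real poly) \<Rightarrow> nat \<Rightarrow> real \<Rightarrow> real poly \<Rightarrow> (nat \<Rightarrow> real poly) \<Rightarrow> bool" where
  "sos_feasible q s g \<nu> lam F Q \<longleftrightarrow> degree F \<le> \<nu> \<and> (\<forall>i<s. degree (Q i) \<le> \<nu>) \<and>
     (\<lambda>(x, y, z). f_int q x y z lam + total_D (ansatz q (poly F)) x y z) \<in> Q_Gamma s g \<nu> \<and>
     (\<forall>i<s. (\<lambda>(x, y). ansatz q (poly F) x y * poly (pderiv (g i)) x
               - poly (Q i) x * \<bar>poly (pderiv (g i)) x\<bar>\<^sup>2) \<in> Q_Lambda s g i \<nu>) \<and>
     (\<Sum>i<s. \<Sum>x\<in>bdry_piece s g i. poly (Q i) x * \<bar>poly (pderiv (g i)) x\<bar>) \<ge> 0"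

definition B_sos :: "nat \<Rightarrow> nat \<Rightarrow> (nat \<Rightarrow> real poly) \<Rightarrow> nat \<Rightarrow> ereal" where
  "B_sos q s g \<nu> = Sup {ereal lam | lam. \<exists>F Q. sos_feasible q s g \<nu> lam F Q}"

definition B_sos_hat :: "nat \<Rightarrow> nat \<Rightarrow> (nat \<Rightarrow> real poly) \<Rightarrow> nat \<Rightarrow> ereal" where
  "B_sos_hat q s g \<nu> = Sup {ereal lam | lam. \<exists>F. sos_hat_feasible q s g \<nu> lam F}"

end

theory Submission
  imports Defs
begin

text \<open>
  Write \<open>p = 2q\<close>. For the ansatz \<open>\<phi>(x, y) = F(x) y\<^sup>p\<close> the pointwise constraint is homogeneous in
  \<open>(y, z)\<close>, and minimising over \<open>z\<close> (Young's inequality) turns it into the Riccati inequality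
  \<open>F' \<ge> lam + (p - 1) \<bar>F\<bar>\<^bsup>p/(p-1)\<^esup>\<close> on the interval. Separation of variables solves the corresponding equation, and a
  solution lives on all of \<open>[a, b]\<close> as soon as the time it takes to rise from some \<open>- M\<close> to \<open>M\<close> is at
  least \<open>b - a\<close> (\<open>riccati_solvable\<close>). Such \<open>lam\<close> are feasible for both relaxations with \<open>h = 0\<close>
  (\<open>riccati_solvable_feasible\<close>), and weak duality bounds every relaxation by \<open>lambda_star\<close>.

  The converse is the substitution \<open>u' / u = - F\<^bsup>1/(p-1)\<^esup>\<close>, the odd root being meant. If the rise time for \<open>lam\<close>
  is always smaller than \<open>b - a\<close>, then for any larger \<open>lam'\<close> the function \<open>u\<close> so obtained fits into
  \<open>[a, b]\<close> together with two linear pieces that lead to the boundary value zero, and its energy is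
  negative (\<open>negative_trial_function\<close>). So the solvable values have supremum \<open>lambda_star\<close>
  (\<open>lambda_star_riccati\<close>), and both pointwise relaxations are exact (\<open>relaxations_exact\<close>).

  That the ansatz belongs to the admissible classes is the chain rule for Sobolev functions on an interval.
  They are identified with the primitives of integrable functions by the lemma of du Bois-Reymond, and
  the chain rule follows from the product rule for primitives, which is Fubini's theorem.

  For the polynomial relaxations, \<open>F\<close> and the odd root of \<open>F\<close> are approximated by polynomials for a
  slightly smaller \<open>lam\<close>. Young's form is a sum of squares (\<open>SOS_amgm_even\<close>), and the slack absorbs the
  approximation errors up to a remainder \<open>R(x) y\<^sup>p\<close> with \<open>R > 0\<close> on \<open>[a, b]\<close>
  (\<open>certificate_identity\<close>, \<open>cert_remainder_positive\<close>). Putinar's theorem in one variable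
  (\<open>putinar_interval\<close>) completes the certificate.
\<close>

section \<open>Sums of squares and the arithmetic-geometric mean form\<close>

text \<open>With lists of polynomials, sums and products of sums of squares become concatenation and mapping.\<close>

lemma SOS_iff_list:
  "p \<in> SOS \<longleftrightarrow> (\<exists>rs. (\<forall>r\<in>set rs. real_polynomial_function r) \<and> p = (\<lambda>v. \<Sum>r\<leftarrow>rs. (r v)\<^sup>2))"
proof
  assume "p \<in> SOS"
  then obtain m and r :: "nat \<Rightarrow> 'a \<Rightarrow> real"
    where "\<forall>j<m. real_polynomial_function (r j)" "p = (\<lambda>v. \<Sum>j<m. (r j v)\<^sup>2)"
    unfolding SOS_def by blast
  then show "\<exists>rs. (\<forall>r\<in>set rs. real_polynomial_function r) \<and> p = (\<lambda>v. \<Sum>r\<leftarrow>rs. (r v)\<^sup>2)"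
    by (intro exI[of _ "map r [0..<m]"])
       (auto simp: interv_sum_list_conv_sum_set_nat comp_def atLeast0LessThan)
next
  assume "\<exists>rs. (\<forall>r\<in>set rs. real_polynomial_function r) \<and> p = (\<lambda>v. \<Sum>r\<leftarrow>rs. (r v)\<^sup>2)"
  then obtain rs where "\<forall>r\<in>set rs. real_polynomial_function r" "p = (\<lambda>v. \<Sum>r\<leftarrow>rs. (r v)\<^sup>2)"
    by blast
  then show "p \<in> SOS"
    unfolding SOS_def
    by (auto simp: sum_list_sum_nth atLeast0LessThan intro!: exI[of _ "length rs"] exI[of _ "(!) rs"])
qed

lemma SOS_square:
  assumes "real_polynomial_function r" shows "(\<lambda>v. (r v)\<^sup>2) \<in> SOS"
  unfolding SOS_iff_list using assms by (intro exI[of _ "[r]"]) auto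

lemma SOS_const:
  assumes "c \<ge> 0" shows "(\<lambda>v. c) \<in> SOS"
  using SOS_square[OF real_polynomial_function.intros(2), of "sqrt c"] assms by simp

lemma SOS_add:
  assumes "p \<in> SOS" "p' \<in> SOS" shows "(\<lambda>v. p v + p' v) \<in> SOS"
proof -
  obtain rs rs' where "\<forall>r\<in>set rs. real_polynomial_function r" "p = (\<lambda>v. \<Sum>r\<leftarrow>rs. (r v)\<^sup>2)"
    "\<forall>r\<in>set rs'. real_polynomial_function r" "p' = (\<lambda>v. \<Sum>r\<leftarrow>rs'. (r v)\<^sup>2)"
    using assms unfolding SOS_iff_list by blast
  then show ?thesis
    unfolding SOS_iff_list by (intro exI[of _ "rs @ rs'"]) auto
qed

lemma SOS_mult_square:
  assumes "p \<in> SOS" "real_polynomial_function s" shows "(\<lambda>v. (s v)\<^sup>2 * p v) \<in> SOS"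
proof -
  obtain rs where "\<forall>r\<in>set rs. real_polynomial_function r" "p = (\<lambda>v. \<Sum>r\<leftarrow>rs. (r v)\<^sup>2)"
    using assms unfolding SOS_iff_list by blast
  with assms(2) show ?thesis
    unfolding SOS_iff_list
    by (intro exI[of _ "map (\<lambda>r v. s v * r v) rs"])
       (auto simp: comp_def power_mult_distrib sum_list_const_mult)
qed

lemma SOS_mult:
  assumes "p \<in> SOS" "p' \<in> SOS" shows "(\<lambda>v. p v * p' v) \<in> SOS"
proof -
  obtain rs where "\<forall>r\<in>set rs. real_polynomial_function r" and p: "p = (\<lambda>v. \<Sum>r\<leftarrow>rs. (r v)\<^sup>2)"
    using assms unfolding SOS_iff_list by blast
  then have "(\<lambda>v. (\<Sum>r\<leftarrow>rs. (r v)\<^sup>2) * p' v) \<in> SOS"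
  proof (induction rs arbitrary: p)
    case Nil
    then show ?case using SOS_const[of 0] by simp
  next
    case (Cons r rs)
    have "(\<lambda>v. (r v)\<^sup>2 * p' v) \<in> SOS"
      using Cons.prems by (intro SOS_mult_square assms) auto
    moreover have "(\<lambda>v. (\<Sum>r\<leftarrow>rs. (r v)\<^sup>2) * p' v) \<in> SOS"
      using Cons by auto
    ultimately have "(\<lambda>v. (r v)\<^sup>2 * p' v + (\<Sum>r\<leftarrow>rs. (r v)\<^sup>2) * p' v) \<in> SOS"
      by (rule SOS_add)
    then show ?case
      by (simp add: distrib_right)
  qed
  then show ?thesis using p by simp
qed

lemma SOS_sum:
  assumes "finite A" "\<And>i. i \<in> A \<Longrightarrow> p i \<in> SOS"
  shows "(\<lambda>v. \<Sum>i\<in>A. p i v) \<in> SOS"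
  using assms
proof (induction A rule: finite_induct)
  case empty
  show ?case using SOS_const[of 0] by simp
next
  case (insert i A)
  then have "(\<lambda>v. p i v + (\<Sum>i\<in>A. p i v)) \<in> SOS" by (intro SOS_add) auto
  with insert show ?case by simp
qed

lemma SOS_even_power:
  assumes "real_polynomial_function r" shows "(\<lambda>v. r v ^ (2 * m)) \<in> SOS"
  using SOS_square[OF real_polynomial_function_power[OF assms, of m]]
  by (simp add: mult.commute[of 2] flip: power_mult)

lemma SOS_nonneg: "p \<in> SOS \<Longrightarrow> p v \<ge> 0"
  by (auto simp: SOS_def intro: sum_nonneg)

lemma SOS_compose:
  assumes "p \<in> SOS" "polynomial_function f" shows "(\<lambda>v. p (f v)) \<in> SOS"
proof -
  obtain rs where "\<forall>r\<in>set rs. real_polynomial_function r" "p = (\<lambda>v. \<Sum>r\<leftarrow>rs. (r v)\<^sup>2)"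
    using assms unfolding SOS_iff_list by blast
  moreover have "real_polynomial_function (\<lambda>v. r (f v))" if "real_polynomial_function r" for r
    using real_polynomial_function_compose[OF assms(2) that] by (simp add: comp_def)
  ultimately show ?thesis
    unfolding SOS_iff_list by (intro exI[of _ "map (\<lambda>r v. r (f v)) rs"]) (auto simp: comp_def)
qed

text \<open>The defect of the arithmetic-geometric mean inequality for \<open>m\<close> copies of \<open>Z\<^sup>m\<^sup>+\<^sup>1\<close> and one of \<open>Y\<^sup>m\<^sup>+\<^sup>1\<close>.\<close>

definition amgm :: "nat \<Rightarrow> real \<Rightarrow> real \<Rightarrow> real" where
  "amgm m Z Y = real m * Z ^ Suc m + Y ^ Suc m - real (Suc m) * Y * Z ^ m"

text \<open>The correction to \<open>Z * amgm m Z Y\<close> is \<open>(Z - Y) * (Z ^ Suc m - Y ^ Suc m)\<close>, and the second factor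
  is again divisible by \<open>Z - Y\<close>. All other coefficients being positive, squares in place of
  \<open>Z\<close> and \<open>Y\<close> give a sum of squares.\<close>

lemma amgm_Suc:
  "amgm (Suc m) Z Y = Z * amgm m Z Y + (Z - Y)\<^sup>2 * (\<Sum>i\<le>m. Z ^ i * Y ^ (m - i))"
proof -
  have *: "(Z - Y) * (\<Sum>i\<le>m. Z ^ i * Y ^ (m - i)) = Z ^ Suc m - Y ^ Suc m"
    using diff_power_eq_sum[of Z m Y] by (simp add: lessThan_Suc_atMost)
  have "(Z - Y)\<^sup>2 * (\<Sum>i\<le>m. Z ^ i * Y ^ (m - i)) = (Z - Y) * (Z ^ Suc m - Y ^ Suc m)"
    unfolding *[symmetric] by (simp add: power2_eq_square mult.assoc)
  then show ?thesis
    by (simp add: amgm_def algebra_simps)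
qed

lemma SOS_amgm_squares:
  assumes "real_polynomial_function z" "real_polynomial_function w"
  shows "(\<lambda>v. amgm m ((z v)\<^sup>2) ((w v)\<^sup>2)) \<in> SOS"
proof (induction m)
  case 0
  then show ?case using SOS_const[of 0] by (simp add: amgm_def)
next
  case (Suc m)
  have "(\<lambda>v. ((z v)\<^sup>2 - (w v)\<^sup>2)\<^sup>2 * (\<Sum>i\<le>m. z v ^ (2 * i) * w v ^ (2 * (m - i)))) \<in> SOS"
    by (intro SOS_mult SOS_sum SOS_square SOS_even_power real_polynomial_function_diff
          real_polynomial_function_power assms) auto
  then show ?case
    unfolding amgm_Suc using SOS_add[OF SOS_mult_square[OF Suc assms(1)]] by (simp flip: power_mult)
qed

text \<open>Multiplying the form for \<open>q\<close> by \<open>(q + 1) / q * w\<^sup>2\<close> produces the right mixed term for \<open>q + 1\<close>.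
  Only even powers are left over, and they make up \<open>amgm q (z\<^sup>2) (w\<^sup>2) / q\<close>.
  This form is Young's inequality, which gives the minimum of the integrand over the slope \<open>z\<close>.\<close>

lemma SOS_amgm_even:
  assumes "real_polynomial_function z" "real_polynomial_function w" "q \<ge> 1"
  shows "(\<lambda>v. z v ^ (2*q) + real (2*q-1) * w v ^ (2*q) - real (2*q) * w v ^ (2*q-1) * z v) \<in> SOS"
  using \<open>q \<ge> 1\<close>
proof (induction q rule: dec_induct)
  case base
  have "(\<lambda>v. (z v - w v)\<^sup>2) \<in> SOS"
    by (intro SOS_square real_polynomial_function_diff assms)
  then show ?case by (simp add: power2_diff algebra_simps power2_eq_square)
next
  case (step q)
  obtain m where q: "q = Suc m" using step by (cases q) auto
  let ?p = "\<lambda>v. z v ^ (2*q) + real (2*q-1) * w v ^ (2*q) - real (2*q) * w v ^ (2*q-1) * z v"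
  have "(\<lambda>v. (real (2*q+2) / real (2*q)) * ((w v)\<^sup>2 * ?p v) + (1 / real q) * amgm q ((z v)\<^sup>2) ((w v)\<^sup>2)) \<in> SOS"
    by (intro SOS_add SOS_mult[OF SOS_const] SOS_mult_square SOS_amgm_squares assms step.IH) auto
  moreover have "(real (2*q+2) / real (2*q)) * ((w v)\<^sup>2 * ?p v) + (1 / real q) * amgm q ((z v)\<^sup>2) ((w v)\<^sup>2)
     = z v ^ (2*Suc q) + real (2*Suc q-1) * w v ^ (2*Suc q) - real (2*Suc q) * w v ^ (2*Suc q-1) * z v" for v
  proof -
    have e: "2*m+2-1 = 2*m+1" "2*m+4-1 = 2*m+3" "2*q-1 = 2*m+1" "2*Suc q-1 = 2*m+3" "2*Suc q = 2*m+4" "2*q=2*m+2" by (auto simp: q)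
    define Z where "Z = (z v)^(2*m)" 
    define W where "W = (w v)^(2*m)" 
    define M where "M = real m"
    have "M \<ge> 0" by (simp add: M_def)
    have r: "z v ^ (2*m+k) = Z * z v ^ k" "w v ^ (2*m+k) = W * w v ^ k" for k
      by (auto simp: Z_def W_def power_add)
    have s: "((z v)\<^sup>2)^(Suc (Suc m)) = Z * z v ^ 4" "((w v)\<^sup>2)^(Suc (Suc m)) = W * w v ^ 4"
      "((z v)\<^sup>2)^(Suc m) = Z * z v ^ 2"
      by (simp_all add: Z_def W_def power_mult power4_eq_xxxx power2_eq_square)
    have t: "real (2*m+3) = 2*M+3" "real (2*m+4) = 2*M+4" "real (2*m+2) = 2*M+2" "real (2*m+1) = 2*M+1"
      "real (Suc m) = M+1" "real (Suc (Suc m)) = M+2" "real (2*m+2+2) = 2*M+4"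
      by (auto simp: M_def)
    have "(2*M+4) / (2*M+2) * ((w v)\<^sup>2 * (Z * z v ^ 2 + (2*M+1) * (W * w v ^ 2) - (2*M+2) * (W * w v ^ 1) * z v))
       + 1 / (M+1) * ((M+1) * (Z * z v ^ 4) + W * w v ^ 4 - (M+2) * (w v)\<^sup>2 * (Z * z v ^ 2))
      = Z * z v ^ 4 + (2*M+3) * (W * w v ^ 4) - (2*M+4) * (W * w v ^ 3) * z v"
    proof -
      have "(2*M+4) / (2*M+2) = (M+2)/(M+1)" using \<open>M \<ge> 0\<close> by (simp add: field_simps)
      moreover have "(M+2) * ((w v)\<^sup>2 * (Z * z v ^ 2 + (2*M+1) * (W * w v ^ 2) - (2*M+2) * (W * w v ^ 1) * z v))
       + ((M+1) * (Z * z v ^ 4) + W * w v ^ 4 - (M+2) * (w v)\<^sup>2 * (Z * z v ^ 2))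
      = (M+1) * (Z * z v ^ 4 + (2*M+3) * (W * w v ^ 4) - (2*M+4) * (W * w v ^ 3) * z v)"
        by algebra
      moreover have "x / (M+1) * A + 1 / (M+1) * B = C" if "x * A + B = (M+1) * C" for x A B C
      proof -
        have "x / (M+1) * A + 1 / (M+1) * B = (x * A + B) / (M+1)" by (simp add: add_divide_distrib)
        then show ?thesis using that \<open>M \<ge> 0\<close> by simp
      qed
      ultimately show ?thesis by presburger
    qed
    then show ?thesis
      by (simp only: e, simp only: r, simp only: amgm_def q, simp only: s t)
  qed
  ultimately show ?case by simp
qed

lemma amgm_even_nonneg:
  fixes z w :: real
  assumes "q \<ge> 1"
  shows "z ^ (2*q) + real (2*q-1) * w ^ (2*q) - real (2*q) * w ^ (2*q-1) * z \<ge> 0"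
proof -
  have "real_polynomial_function (fst :: real \<times> real \<Rightarrow> real)" "real_polynomial_function (snd :: real \<times> real \<Rightarrow> real)"
    by (auto intro: bounded_linear_fst bounded_linear_snd)
  from SOS_nonneg[OF SOS_amgm_even[OF this assms], of "(z, w)"] show ?thesis by simp
qed

section \<open>Quadratic modules and Putinar's theorem in one variable\<close>

lemma real_polynomial_function_poly: fixes p :: "real poly" shows "real_polynomial_function (poly p)"
  unfolding real_polynomial_function_iff_sum
  by (intro exI[of _ "coeff p"] exI[of _ "degree p"]) (auto simp: poly_altdef)

lemma quad_module_SOS:
  assumes "p \<in> SOS" "finite I" shows "p \<in> quad_module I G"
  unfolding quad_module_def mem_Collect_eq using assms SOS_const[of 0]
  by (intro exI[of _ p] exI[of _ "\<lambda>i v. 0"]) auto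

lemma quad_module_add:
  assumes "p \<in> quad_module I G" "p' \<in> quad_module I G"
  shows "(\<lambda>v. p v + p' v) \<in> quad_module I G"
proof -
  obtain s0 s where 1: "s0 \<in> SOS" "\<forall>i\<in>I. s i \<in> SOS" "p = (\<lambda>v. s0 v + (\<Sum>i\<in>I. G i v * s i v))"
    using assms(1) unfolding quad_module_def by blast
  obtain t0 t where 2: "t0 \<in> SOS" "\<forall>i\<in>I. t i \<in> SOS" "p' = (\<lambda>v. t0 v + (\<Sum>i\<in>I. G i v * t i v))"
    using assms(2) unfolding quad_module_def by blast
  show ?thesis
    unfolding quad_module_def mem_Collect_eq
  proof (intro exI conjI ballI)
    show "(\<lambda>v. s0 v + t0 v) \<in> SOS" using 1 2 by (intro SOS_add)
    show "(\<lambda>v. s i v + t i v) \<in> SOS" if "i \<in> I" for i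
      using 1 2 that by (intro SOS_add) auto
    show "(\<lambda>v. p v + p' v) = (\<lambda>v. s0 v + t0 v + (\<Sum>i\<in>I. G i v * (s i v + t i v)))"
      by (simp add: 1 2 distrib_left sum.distrib ac_simps)
  qed
qed

lemma quad_module_mult:
  assumes "p \<in> quad_module I G" "t \<in> SOS"
  shows "(\<lambda>v. p v * t v) \<in> quad_module I G"
proof -
  obtain s0 s where 1: "s0 \<in> SOS" "\<forall>i\<in>I. s i \<in> SOS" "p = (\<lambda>v. s0 v + (\<Sum>i\<in>I. G i v * s i v))"
    using assms(1) unfolding quad_module_def by blast
  show ?thesis
    unfolding quad_module_def mem_Collect_eq
  proof (intro exI conjI ballI)
    show "(\<lambda>v. s0 v * t v) \<in> SOS" using 1 assms by (intro SOS_mult)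
    show "(\<lambda>v. s i v * t v) \<in> SOS" if "i \<in> I" for i
      using 1 assms that by (intro SOS_mult) auto
    show "(\<lambda>v. p v * t v) = (\<lambda>v. s0 v * t v + (\<Sum>i\<in>I. G i v * (s i v * t v)))"
      by (simp add: 1 distrib_right sum_distrib_right mult.assoc)
  qed
qed

lemma quad_module_compose:
  assumes "p \<in> quad_module I G" "polynomial_function f"
  shows "(\<lambda>v. p (f v)) \<in> quad_module I (\<lambda>i v. G i (f v))"
proof -
  obtain s0 s where 1: "s0 \<in> SOS" "\<forall>i\<in>I. s i \<in> SOS" "p = (\<lambda>v. s0 v + (\<Sum>i\<in>I. G i v * s i v))"
    using assms(1) unfolding quad_module_def by blast
  show ?thesis
    unfolding quad_module_def mem_Collect_eq
  proof (intro exI conjI ballI)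
    show "(\<lambda>v. s0 (f v)) \<in> SOS" by (rule SOS_compose[OF 1(1) assms(2)])
    show "(\<lambda>v. s i (f v)) \<in> SOS" if "i \<in> I" for i
      by (rule SOS_compose[OF bspec[OF 1(2) that] assms(2)])
  qed (simp add: 1)
qed

lemma quad_module_nonneg:
  assumes "p \<in> quad_module I G" "\<And>i. i \<in> I \<Longrightarrow> G i v \<ge> 0"
  shows "p v \<ge> 0"
proof -
  obtain s0 s where 1: "s0 \<in> SOS" "\<forall>i\<in>I. s i \<in> SOS" "p = (\<lambda>v. s0 v + (\<Sum>i\<in>I. G i v * s i v))"
    using assms(1) unfolding quad_module_def by blast
  have "(\<Sum>i\<in>I. G i v * s i v) \<ge> 0"
    by (intro sum_nonneg mult_nonneg_nonneg assms(2) SOS_nonneg bspec[OF 1(2)])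
  then show ?thesis using SOS_nonneg[OF 1(1), of v] by (simp add: 1(3))
qed

text \<open>The quadratic module of \<open>r\<^sup>2 - x\<^sup>2\<close>. Having a single generator, it is closed under
  products, which an induction by splitting off factors relies on.\<close>

definition interval_cone :: "real \<Rightarrow> (real \<Rightarrow> real) set" where
  "interval_cone r = {p. \<exists>s0\<in>SOS. \<exists>s1\<in>SOS. p = (\<lambda>x. s0 x + (r\<^sup>2 - x\<^sup>2) * s1 x)}"

lemma interval_cone_add:
  assumes "p \<in> interval_cone r" "p' \<in> interval_cone r"
  shows "(\<lambda>x. p x + p' x) \<in> interval_cone r"
proof -
  obtain s0 s1 where "s0 \<in> SOS" "s1 \<in> SOS" "p = (\<lambda>x. s0 x + (r\<^sup>2 - x\<^sup>2) * s1 x)"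
    using assms(1) unfolding interval_cone_def by blast
  moreover obtain t0 t1 where "t0 \<in> SOS" "t1 \<in> SOS" "p' = (\<lambda>x. t0 x + (r\<^sup>2 - x\<^sup>2) * t1 x)"
    using assms(2) unfolding interval_cone_def by blast
  ultimately show ?thesis
    unfolding interval_cone_def mem_Collect_eq
    by (intro bexI[of _ "\<lambda>x. s0 x + t0 x"] bexI[of _ "\<lambda>x. s1 x + t1 x"] SOS_add)
       (auto simp: algebra_simps)
qed

lemma interval_cone_mult:
  assumes "p \<in> interval_cone r" "p' \<in> interval_cone r"
  shows "(\<lambda>x. p x * p' x) \<in> interval_cone r"
proof -
  obtain s0 s1 where 1: "s0 \<in> SOS" "s1 \<in> SOS" "p = (\<lambda>x. s0 x + (r\<^sup>2 - x\<^sup>2) * s1 x)"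
    using assms(1) unfolding interval_cone_def by blast
  obtain t0 t1 where 2: "t0 \<in> SOS" "t1 \<in> SOS" "p' = (\<lambda>x. t0 x + (r\<^sup>2 - x\<^sup>2) * t1 x)"
    using assms(2) unfolding interval_cone_def by blast
  have g: "real_polynomial_function (\<lambda>x::real. r\<^sup>2 - x\<^sup>2)"
    by (intro real_polynomial_function_diff real_polynomial_function_power) (auto intro: bounded_linear_ident)
  have "(\<lambda>x. p x * p' x) = (\<lambda>x. (s0 x * t0 x + (r\<^sup>2 - x\<^sup>2)\<^sup>2 * (s1 x * t1 x))
      + (r\<^sup>2 - x\<^sup>2) * (s0 x * t1 x + s1 x * t0 x))"
    unfolding 1 2 by (simp add: algebra_simps power2_eq_square)
  then show ?thesis
    unfolding interval_cone_def mem_Collect_eq using 1 2 g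
    by (intro bexI[of _ "\<lambda>x. s0 x * t0 x + (r\<^sup>2 - x\<^sup>2)\<^sup>2 * (s1 x * t1 x)"]
          bexI[of _ "\<lambda>x. s0 x * t1 x + s1 x * t0 x"] SOS_add SOS_mult SOS_square)
qed

lemma SOS_interval_cone: "p \<in> SOS \<Longrightarrow> p \<in> interval_cone r"
  unfolding interval_cone_def mem_Collect_eq
  by (rule bexI[of _ p], rule bexI[of _ "\<lambda>x. 0"]) (auto intro: SOS_const)

text \<open>For \<open>e = 1\<close> and \<open>e = - 1\<close>: \<open>2 r (r + e x) = (r + e x)\<^sup>2 + (r\<^sup>2 - x\<^sup>2)\<close>.\<close>

lemma linear_interval_cone:
  assumes "r > 0" "e\<^sup>2 = 1"
  shows "(\<lambda>x. r + e * x) \<in> interval_cone r"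
proof -
  have "real_polynomial_function (\<lambda>x::real. r + e * x)"
    by (intro real_polynomial_function.intros) (auto intro: bounded_linear_ident)
  then have 1: "(\<lambda>x. (1/(2*r)) * (r + e * x)\<^sup>2) \<in> SOS"
    using assms by (intro SOS_mult SOS_const SOS_square) auto
  have 2: "(\<lambda>x::real. 1/(2*r)) \<in> SOS" using assms by (intro SOS_const) auto
  have "r + e * x = (1/(2*r)) * (r + e * x)\<^sup>2 + (r\<^sup>2 - x\<^sup>2) * (1/(2*r))" for x
  proof -
    have "(r + e * x)\<^sup>2 + (r\<^sup>2 - x\<^sup>2) = 2 * r * (r + e * x)" using assms(2) by algebra
    then show ?thesis using assms(1) by (simp add: field_simps)
  qed
  then show ?thesis
    unfolding interval_cone_def mem_Collect_eq by (intro bexI[OF _ 1] bexI[OF _ 2] ext)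
qed

lemma poly_nonneg_from_right:
  fixes p :: "real poly"
  assumes "c < d" "\<And>x. c < x \<Longrightarrow> x \<le> d \<Longrightarrow> poly p x \<ge> 0" shows "poly p c \<ge> 0"
proof (rule tendsto_lowerbound)
  show "(poly p \<longlongrightarrow> poly p c) (at_right c)"
    by (intro tendsto_intros)
  show "\<forall>\<^sub>F x in at_right c. 0 \<le> poly p x"
    using assms by (auto simp: eventually_at_right_field intro!: exI[of _ d])
qed auto

lemma poly_nonneg_from_left:
  fixes p :: "real poly"
  assumes "d < c" "\<And>x. d \<le> x \<Longrightarrow> x < c \<Longrightarrow> poly p x \<ge> 0" shows "poly p c \<ge> 0"
proof (rule tendsto_lowerbound)
  show "(poly p \<longlongrightarrow> poly p c) (at_left c)"
    by (intro tendsto_intros)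
  show "\<forall>\<^sub>F x in at_left c. 0 \<le> poly p x"
    using assms by (auto simp: eventually_at_left_field intro!: exI[of _ d])
qed auto

text \<open>Subtracting the minimum over the interval creates a zero. A zero at an endpoint splits off
  \<open>r + x\<close> or \<open>r - x\<close>, a zero in the interior a square, because the first quotient changes sign there.
  The remaining factor is again nonnegative on the interval and has smaller degree.\<close>

lemma nonneg_on_interval_in_cone:
  fixes p :: "real poly"
  assumes r: "r > 0" and "\<And>x. x \<in> {-r..r} \<Longrightarrow> poly p x \<ge> 0"
  shows "poly p \<in> interval_cone r"
  using assms(2)
proof (induction "degree p" arbitrary: p rule: less_induct)
  case less
  show ?case
  proof (cases "degree p = 0")
    case True
    then obtain k where k: "p = [:k:]" by (metis degree_eq_zeroE)
    with less.prems[of 0] r have "k \<ge> 0" by auto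
    have "poly p = (\<lambda>x. k)" by (auto simp: k)
    then show ?thesis using SOS_interval_cone[OF SOS_const[OF \<open>k \<ge> 0\<close>]] by simp
  next
    case False
    have "\<exists>c\<in>{-r..r}. \<forall>x\<in>{-r..r}. poly p c \<le> poly p x"
      using r by (intro continuous_attains_inf continuous_intros) auto
    then obtain c where c: "c \<in> {-r..r}" and min: "\<And>x. x \<in> {-r..r} \<Longrightarrow> poly p c \<le> poly p x" by blast
    define m where "m = poly p c"
    have m: "m \<ge> 0" using less.prems c by (simp add: m_def)
    have "poly (p - [:m:]) c = 0" by (simp add: m_def)
    then obtain p1 where p1: "p - [:m:] = [:-c, 1:] * p1" unfolding poly_eq_0_iff_dvd by (rule dvdE)
    have "degree (p - [:m:]) = degree p"
      unfolding diff_conv_add_uminus using False by (intro degree_add_eq_left) simp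
    then have d1: "Suc (degree p1) = degree p"
    proof -
      have "p1 \<noteq> 0" using \<open>degree (p - [:m:]) = degree p\<close> False by (auto simp: p1)
      then have "degree ([:-c, 1:] * p1) = Suc (degree p1)" by (subst degree_mult_eq) auto
      then show ?thesis using \<open>degree (p - [:m:]) = degree p\<close> unfolding p1 by simp
    qed
    have e1: "poly p x = m + (x - c) * poly p1 x" for x
    proof -
      have "poly (p - [:m:]) x = poly ([:-c,1:] * p1) x" by (simp only: p1)
      then show ?thesis by (simp add: algebra_simps)
    qed
    have s1: "(x - c) * poly p1 x \<ge> 0" if "x \<in> {-r..r}" for x
      using min[OF that] e1[of x] by (simp add: m_def)
    have right: "poly p1 x \<ge> 0" if "c < x" "x \<le> r" for x
      using s1[of x] that c by (auto simp: zero_le_mult_iff)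
    have left: "poly p1 x \<le> 0" if "x < c" "-r \<le> x" for x
      using s1[of x] that c by (auto simp: zero_le_mult_iff)
    have const: "(\<lambda>x. m) \<in> interval_cone r" using m by (intro SOS_interval_cone SOS_const)
    consider "c = -r" | "c = r" | "-r < c" "c < r" using c by fastforce
    then show ?thesis
    proof cases
      case 1
      have "poly p1 c \<ge> 0" by (rule poly_nonneg_from_right[of c r]) (use right 1 r in auto)
      then have "poly p1 \<in> interval_cone r"
        using right 1 d1 by (intro less.hyps) (auto simp: less_eq_real_def)
      then have "(\<lambda>x. m + (r + 1 * x) * poly p1 x) \<in> interval_cone r"
        using interval_cone_add[OF const interval_cone_mult[OF linear_interval_cone[OF r, of 1]]] by simp
      moreover have "poly p = (\<lambda>x. m + (r + 1 * x) * poly p1 x)" by (auto simp: e1 1 add.commute)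
      ultimately show ?thesis by simp
    next
      case 2
      have "poly (-p1) c \<ge> 0" by (rule poly_nonneg_from_left[of "-r" c]) (use left 2 r in auto)
      then have "poly (-p1) \<in> interval_cone r"
        using left 2 d1 by (intro less.hyps) (auto simp: less_eq_real_def)
      then have "(\<lambda>x. m + (r + (-1) * x) * poly (-p1) x) \<in> interval_cone r"
        using interval_cone_add[OF const interval_cone_mult[OF linear_interval_cone[OF r, of "-1"]]]
        by (simp del: poly_minus)
      moreover have "poly p = (\<lambda>x. m + (r + (-1) * x) * poly (-p1) x)" by (auto simp: e1 2 algebra_simps)
      ultimately show ?thesis by simp
    next
      case 3
      have "poly p1 c \<ge> 0" by (rule poly_nonneg_from_right[of c r]) (use right 3 in auto)
      moreover have "poly (-p1) c \<ge> 0" by (rule poly_nonneg_from_left[of "-r" c]) (use left 3 in auto)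
      ultimately have "poly p1 c = 0" by simp
      then obtain p2 where p2: "p1 = [:-c, 1:] * p2" unfolding poly_eq_0_iff_dvd by (rule dvdE)
      have e2: "poly p1 x = (x - c) * poly p2 x" for x unfolding p2 by (simp add: algebra_simps)
      have "degree p2 \<le> degree p1"
        unfolding p2 by (cases "p2 = 0") (auto simp: degree_mult_eq simp del: mult_pCons_left)
      have ne: "poly p2 x \<ge> 0" if "x \<in> {-r..r}" "x \<noteq> c" for x
      proof -
        have "(x - c)\<^sup>2 * poly p2 x \<ge> 0"
          using s1[OF that(1)] by (simp add: e2 power2_eq_square mult.assoc)
        then show ?thesis using that(2) by (simp add: zero_le_mult_iff)
      qed
      have "poly p2 c \<ge> 0" by (rule poly_nonneg_from_right[of c r]) (use ne 3 in auto)
      then have p2c: "poly p2 \<in> interval_cone r"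
      proof (intro less.hyps)
        show "poly p2 x \<ge> 0" if "x \<in> {-r..r}" for x
          using ne[OF that] \<open>poly p2 c \<ge> 0\<close> by (cases "x = c") auto
      qed (use d1 \<open>degree p2 \<le> degree p1\<close> in simp)
      have lin: "real_polynomial_function (\<lambda>x. x - c)"
        by (intro real_polynomial_function_diff) (auto intro: bounded_linear_ident)
      have "(\<lambda>x. m + (x - c)\<^sup>2 * poly p2 x) \<in> interval_cone r"
        by (rule interval_cone_add[OF const interval_cone_mult[OF SOS_interval_cone[OF SOS_square[OF lin]] p2c]])
      moreover have "poly p = (\<lambda>x. m + (x - c)\<^sup>2 * poly p2 x)"
        by (auto simp: e1 e2 power2_eq_square mult.assoc)
      ultimately show ?thesis by simp
    qed
  qed
qed

text \<open>The function \<open>g * (1 - g / B) ^ n\<close> is at most \<open>B / n\<close> where \<open>g \<ge> 0\<close>, and by Bernoulli's inequality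
  it falls below \<open>- n * g\<^sup>2 / B\<close> where \<open>g < 0\<close>. For even \<open>n\<close> it is a square times \<open>g\<close>, so it can be
  added inside a quadratic module at almost no cost on the feasible set.\<close>

lemma penalty_bound:
  fixes g B :: real
  assumes "B > 0" "\<bar>g\<bar> \<le> B" "n \<ge> 1"
  shows "g * (1 - g / B) ^ n \<le> B / real n - (real n / B) * (min 0 g)\<^sup>2"
proof (cases "g \<ge> 0")
  case True
  define t where "t = g / B"
  have t: "0 \<le> t" "t \<le> 1" using True assms by (auto simp: t_def)
  have "(real n * t) * (1 - t) ^ n \<le> (1 + real n * t) * (1 - t) ^ n"
    using t by (intro mult_right_mono) auto
  also have "\<dots> \<le> (1 + t) ^ n * (1 - t) ^ n"
    using t by (intro mult_right_mono Bernoulli_inequality) auto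
  also have "\<dots> = (1 - t\<^sup>2) ^ n" by (simp flip: power_mult_distrib add: algebra_simps power2_eq_square)
  also have "\<dots> \<le> 1" using t by (intro power_le_one) (auto simp: power_le_one)
  finally have "t * (1 - t) ^ n \<le> 1 / real n" using assms by (simp add: field_simps)
  then have "B * (t * (1 - t) ^ n) \<le> B * (1 / real n)" using assms by (intro mult_left_mono) auto
  then show ?thesis using True assms by (simp add: t_def min_def)
next
  case False
  have "1 + real n * (- g / B) \<le> (1 + (- g / B)) ^ n"
    using False assms by (intro Bernoulli_inequality) (smt (verit) divide_nonneg_pos)
  then have "(-g) * (real n * (- g / B)) \<le> (-g) * (1 - g / B) ^ n"
    using False by (intro mult_left_mono) auto
  moreover have "B / real n \<ge> 0" using assms by simp
  ultimately show ?thesis using False by (simp add: min_def power2_eq_square algebra_simps)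
qed

text \<open>Putinar's theorem in one variable. Subtracting the penalties \<open>g i * (1 - g i / B) ^ n\<close> from \<open>R\<close>
  costs little where \<open>R\<close> is positive and gains arbitrarily much on the compact set where \<open>R\<close> is small,
  since some \<open>g i\<close> is negative there. The difference is nonnegative on an interval \<open>[-\<rho>, \<rho>]\<close> that
  contains the feasible set, and the Archimedean assumption takes its certificate into the module.\<close>

lemma putinar_interval:
  fixes R :: "real poly"
  assumes K: "{a..b} = {x. \<forall>i<s. poly (g i) x \<ge> 0}" and "a < b"
    and arch: "(\<lambda>x. r\<^sup>2 - x\<^sup>2) \<in> Q_Omega s g"
    and pos: "\<And>x. x \<in> {a..b} \<Longrightarrow> poly R x > 0"
  shows "poly R \<in> Q_Omega s g"
proof -
  have inK: "\<bar>x\<bar> \<le> \<bar>r\<bar>" if "x \<in> {a..b}" for x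
  proof -
    have "r\<^sup>2 - x\<^sup>2 \<ge> 0"
      using quad_module_nonneg[OF arch[unfolded Q_Omega_def], of x] that K by auto
    then show ?thesis by (simp add: abs_le_square_iff)
  qed
  define \<rho> where "\<rho> = \<bar>r\<bar>"
  have \<rho>: "\<rho> > 0" "\<rho>\<^sup>2 = r\<^sup>2" using inK[of a] inK[of b] \<open>a < b\<close> by (auto simp: \<rho>_def)
  have sub: "{a..b} \<subseteq> {-\<rho>..\<rho>}" using inK by (force simp: \<rho>_def)
  have bdd: "\<exists>B>0. \<forall>x\<in>{-\<rho>..\<rho>}. \<bar>poly p x\<bar> \<le> B" for p
  proof -
    have "bounded (poly p ` {-\<rho>..\<rho>})"
      by (intro compact_imp_bounded compact_continuous_image continuous_intros) auto
    then show ?thesis unfolding bounded_pos by auto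
  qed
  obtain M where M: "M > 0" "\<And>x. x \<in> {-\<rho>..\<rho>} \<Longrightarrow> \<bar>poly R x\<bar> \<le> M" using bdd by blast
  obtain B' where B': "\<And>i. B' i > 0" "\<And>i x. x \<in> {-\<rho>..\<rho>} \<Longrightarrow> \<bar>poly (g i) x\<bar> \<le> B' i"
    using bdd[of "g _"] by metis
  define B where "B = 1 + (\<Sum>i<s. B' i)"
  have "B > 0" unfolding B_def using B'(1) by (smt (verit) sum_nonneg less_imp_le)
  have B: "\<bar>poly (g i) x\<bar> \<le> B" if "i < s" "x \<in> {-\<rho>..\<rho>}" for i x
  proof -
    have "B' i \<le> (\<Sum>i<s. B' i)" using that B'(1) by (intro member_le_sum) (auto intro: less_imp_le)
    then show ?thesis using B'(2)[OF that(2), of i] by (simp add: B_def)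
  qed
  have "\<exists>c\<in>{a..b}. \<forall>x\<in>{a..b}. poly R c \<le> poly R x"
    using \<open>a < b\<close> by (intro continuous_attains_inf continuous_intros) auto
  then obtain \<delta> where \<delta>: "\<delta> > 0" "\<And>x. x \<in> {a..b} \<Longrightarrow> poly R x > \<delta>"
    using pos by (metis dense order_less_le_trans)
  define N where "N = {x \<in> {-\<rho>..\<rho>}. poly R x \<le> \<delta>}"
  \<comment> \<open>measures the violation of the constraints; it is positive on the compact set \<open>N\<close>\<close>
  define viol where "viol x = (\<Sum>i<s. (min 0 (poly (g i) x))\<^sup>2)" for x
  have "compact N"
  proof -
    have "N = {-\<rho>..\<rho>} \<inter> {x. poly R x \<le> \<delta>}" by (auto simp: N_def)
    moreover have "closed {x. poly R x \<le> \<delta>}" by (intro closed_Collect_le continuous_intros)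
    ultimately show ?thesis by (metis compact_Int_closed compact_Icc)
  qed
  have violpos: "viol x > 0" if "x \<in> N" for x
  proof -
    have "x \<notin> {a..b}" using \<delta> that by (force simp: N_def)
    then obtain i where "i < s" "poly (g i) x < 0" using K by (auto simp: not_le)
    then have "(min 0 (poly (g i) x))\<^sup>2 > 0" by auto
    also have "(min 0 (poly (g i) x))\<^sup>2 \<le> viol x"
      unfolding viol_def using \<open>i < s\<close> by (intro member_le_sum) auto
    finally show ?thesis .
  qed
  have "\<exists>\<eta>>0. \<forall>x\<in>N. \<eta> \<le> viol x"
  proof (cases "N = {}")
    case False
    then have "\<exists>c\<in>N. \<forall>x\<in>N. viol c \<le> viol x"
      using \<open>compact N\<close> by (intro continuous_attains_inf) (auto simp: viol_def intro!: continuous_intros)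
    then show ?thesis using violpos by blast
  qed (auto intro: exI[of _ 1])
  then obtain \<eta> where \<eta>: "\<eta> > 0" "\<And>x. x \<in> N \<Longrightarrow> \<eta> \<le> viol x" by blast
  obtain k :: nat where k: "real k > max 1 (max (real s * B / \<delta>) ((M + \<delta>) * B / \<eta>))"
    using reals_Archimedean2 by blast
  \<comment> \<open>even, so that the penalty factor is a square\<close>
  define n where "n = 2 * k"
  have n: "real n > real s * B / \<delta>" "real n > (M + \<delta>) * B / \<eta>" "n \<ge> 1" using k by (auto simp: n_def)
  define h where "h = R - (\<Sum>i<s. g i * (1 - smult (1/B) (g i)) ^ n)"
  have polyh: "poly h x = poly R x - (\<Sum>i<s. poly (g i) x * (1 - poly (g i) x / B) ^ n)" for x
    by (simp add: h_def poly_sum)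
  have small: "real s * B / real n \<le> \<delta>" using n \<delta>(1) by (simp add: field_simps)
  have "poly h x \<ge> 0" if x: "x \<in> {-\<rho>..\<rho>}" for x
  proof -
    have "(\<Sum>i<s. poly (g i) x * (1 - poly (g i) x / B) ^ n)
        \<le> (\<Sum>i<s. B / real n - (real n / B) * (min 0 (poly (g i) x))\<^sup>2)"
      using B x \<open>B > 0\<close> n by (intro sum_mono penalty_bound) auto
    also have "\<dots> = real s * B / real n - (real n / B) * viol x"
      by (simp add: viol_def sum_subtractf sum_distrib_left)
    finally have *: "poly h x \<ge> poly R x - \<delta> + (real n / B) * viol x"
      using small by (simp add: polyh)
    show ?thesis
    proof (cases "x \<in> N")
      case True
      have "M + \<delta> \<le> (real n / B) * \<eta>" using n \<eta>(1) \<open>B > 0\<close> by (simp add: field_simps)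
      also have "\<dots> \<le> (real n / B) * viol x" using \<eta>(2)[OF True] \<open>B > 0\<close> by (intro mult_left_mono) auto
      finally show ?thesis using * M(2)[OF x] by linarith
    next
      case False
      have "(real n / B) * viol x \<ge> 0" using \<open>B > 0\<close>
        unfolding viol_def by (intro mult_nonneg_nonneg sum_nonneg divide_nonneg_nonneg) auto
      then show ?thesis using * False x by (auto simp: N_def)
    qed
  qed
  then have "poly h \<in> interval_cone \<rho>" using \<rho> by (intro nonneg_on_interval_in_cone) auto
  then obtain s0 s1 where s01: "s0 \<in> SOS" "s1 \<in> SOS" "poly h = (\<lambda>x. s0 x + (r\<^sup>2 - x\<^sup>2) * s1 x)"
    unfolding interval_cone_def \<rho> by blast
  have "(\<lambda>x. s0 x + (r\<^sup>2 - x\<^sup>2) * s1 x) \<in> Q_Omega s g"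
    unfolding Q_Omega_def
    by (intro quad_module_add quad_module_mult quad_module_SOS s01 arch[unfolded Q_Omega_def]) auto
  moreover have "(\<lambda>x. 0 + (\<Sum>i<s. poly (g i) x * poly ((1 - smult (1/B) (g i)) ^ k) x ^ 2)) \<in> Q_Omega s g"
    unfolding Q_Omega_def quad_module_def mem_Collect_eq
    by (intro exI[of _ "\<lambda>x. 0"] exI[of _ "\<lambda>i x. poly ((1 - smult (1/B) (g i)) ^ k) x ^ 2"])
       (auto intro!: SOS_const SOS_square real_polynomial_function_poly simp del: poly_power)
  ultimately have "(\<lambda>x. (s0 x + (r\<^sup>2 - x\<^sup>2) * s1 x)
      + (0 + (\<Sum>i<s. poly (g i) x * poly ((1 - smult (1/B) (g i)) ^ k) x ^ 2))) \<in> Q_Omega s g"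
    unfolding Q_Omega_def by (rule quad_module_add)
  moreover have "poly R = (\<lambda>x. (s0 x + (r\<^sup>2 - x\<^sup>2) * s1 x)
      + (0 + (\<Sum>i<s. poly (g i) x * poly ((1 - smult (1/B) (g i)) ^ k) x ^ 2)))"
  proof
    fix x
    have "poly h x = s0 x + (r\<^sup>2 - x\<^sup>2) * s1 x" using s01 by metis
    then show "poly R x = (s0 x + (r\<^sup>2 - x\<^sup>2) * s1 x)
      + (0 + (\<Sum>i<s. poly (g i) x * poly ((1 - smult (1/B) (g i)) ^ k) x ^ 2))"
      unfolding polyh by (simp add: n_def power_mult mult.commute[of 2])
  qed
  ultimately show ?thesis by simp
qed

section \<open>Primitives of integrable functions\<close>

text \<open>Fubini's theorem on the two triangles \<open>s \<le> t\<close> and \<open>t < s\<close>; the diagonal is a null set, which makes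
  the two terms symmetric.\<close>

lemma integral_mult_triangles:
  fixes f g :: "real \<Rightarrow> real"
  assumes f: "integrable lborel f" and g: "integrable lborel g"
  shows "(LINT s|lborel. f s) * (LINT t|lborel. g t) =
     (LINT t|lborel. g t * (LINT s|lborel. (if s \<le> t then f s else 0))) +
     (LINT s|lborel. f s * (LINT t|lborel. (if t \<le> s then g t else 0)))"
proof -
  have [measurable]: "f \<in> borel_measurable borel" "g \<in> borel_measurable borel" using f g by auto
  have diagonal: "(LINT t|lborel. (if t < s then g t else 0)) = (LINT t|lborel. (if t \<le> s then g t else 0))" for s
  proof (rule integral_cong_AE)
    show "AE t in lborel. (if t < s then g t else 0) = (if t \<le> s then g t else 0)"
      using AE_lborel_singleton[of s] by eventually_elim auto
  qed auto
  let ?P = "lborel \<Otimes>\<^sub>M lborel :: (real \<times> real) measure"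
  have H: "integrable ?P (\<lambda>(s, t). f s * g t)"
    by (rule lborel_pair.Fubini_integrable) (use f g in \<open>auto simp: abs_mult\<close>)
  have H1: "integrable ?P (\<lambda>(s, t). if s \<le> t then f s * g t else 0)"
    by (rule Bochner_Integration.integrable_bound[OF H]) auto
  have H2: "integrable ?P (\<lambda>(s, t). if t < s then f s * g t else 0)"
    by (rule Bochner_Integration.integrable_bound[OF H]) auto
  have "(LINT s|lborel. f s) * (LINT t|lborel. g t) = (LINT s|lborel. LINT t|lborel. f s * g t)"
    by simp
  also have "\<dots> = integral\<^sup>L ?P (\<lambda>(s, t). f s * g t)"
    by (rule lborel_pair.integral_fst[OF H])
  also have "\<dots> = integral\<^sup>L ?P (\<lambda>p. (\<lambda>(s, t). if s \<le> t then f s * g t else 0) p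
      + (\<lambda>(s, t). if t < s then f s * g t else 0) p)"
    by (intro Bochner_Integration.integral_cong) auto
  also have "\<dots> = integral\<^sup>L ?P (\<lambda>(s, t). if s \<le> t then f s * g t else 0)
      + integral\<^sup>L ?P (\<lambda>(s, t). if t < s then f s * g t else 0)"
    by (rule Bochner_Integration.integral_add[OF H1 H2])
  also have "integral\<^sup>L ?P (\<lambda>(s, t). if s \<le> t then f s * g t else 0)
      = (LINT t|lborel. LINT s|lborel. (if s \<le> t then f s * g t else 0))"
    by (rule lborel_pair.integral_snd[OF H1, symmetric])
  also have "\<dots> = (LINT t|lborel. g t * (LINT s|lborel. (if s \<le> t then f s else 0)))"
    by (simp flip: integral_mult_right_zero add: if_distrib[of "\<lambda>x. _ * x"] mult.commute cong: if_cong)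
  also have "integral\<^sup>L ?P (\<lambda>(s, t). if t < s then f s * g t else 0)
      = (LINT s|lborel. LINT t|lborel. (if t < s then f s * g t else 0))"
    by (rule lborel_pair.integral_fst[OF H2, symmetric])
  also have "\<dots> = (LINT s|lborel. f s * (LINT t|lborel. (if t < s then g t else 0)))"
    by (simp flip: integral_mult_right_zero add: if_distrib[of "\<lambda>x. _ * x"] mult.commute cong: if_cong)
  also have "\<dots> = (LINT s|lborel. f s * (LINT t|lborel. (if t \<le> s then g t else 0)))"
    by (simp add: diagonal)
  finally show ?thesis .
qed

text \<open>Absolute continuity of \<open>u\<close> with density \<open>v\<close>, expressed by the fundamental theorem of calculus,
  so that no pointwise derivative of an integrable function has to be considered.\<close>

definition primitive_on :: "real \<Rightarrow> real \<Rightarrow> (real \<Rightarrow> real) \<Rightarrow> (real \<Rightarrow> real) \<Rightarrow> bool" where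
  "primitive_on a b u v \<longleftrightarrow> set_integrable lborel {a..b} v \<and>
     (\<forall>x\<in>{a..b}. u x - u a = (LINT t:{a..x}|lborel. v t))"

lemma set_integral_open_closed:
  fixes f :: "real \<Rightarrow> real"
  shows "(LINT x:{a<..<b}|lborel. f x) = (LINT x:{a..b}|lborel. f x)"
    and "set_integrable lborel {a<..<b} f \<longleftrightarrow> set_integrable lborel {a..b} f"
proof -
  show "(LINT x:{a<..<b}|lborel. f x) = (LINT x:{a..b}|lborel. f x)"
    by (rule set_integral_discrete_difference[where X="{a, b}"]) auto
  show "set_integrable lborel {a<..<b} f \<longleftrightarrow> set_integrable lborel {a..b} f"
    by (rule set_integrable_discrete_difference[where X="{a, b}"]) auto
qed

lemma set_integral_eq_HK:
  fixes f :: "real \<Rightarrow> real"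
  assumes "set_integrable lborel {a..b} f"
  shows "f integrable_on {a..b}" "(LINT x:{a..b}|lborel. f x) = integral {a..b} f"
  using set_borel_integral_eq_integral[OF assms] by auto

lemma set_integral_split:
  fixes f :: "real \<Rightarrow> real"
  assumes "set_integrable lborel {a..b} f" "a \<le> c" "c \<le> b"
  shows "(LINT x:{a..b}|lborel. f x) = (LINT x:{a..c}|lborel. f x) + (LINT x:{c..b}|lborel. f x)"
proof -
  have "set_integrable lborel {a..c} f" "set_integrable lborel {c..b} f"
    using assms by (auto intro: set_integrable_subset)
  then show ?thesis
    using assms set_integral_eq_HK Henstock_Kurzweil_Integration.integral_combine[of a c b f] by metis
qed

lemma primitive_on_integrable: "primitive_on a b u v \<Longrightarrow> set_integrable lborel {a..b} v"
  by (simp add: primitive_on_def)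

lemma primitive_on_eq:
  "primitive_on a b u v \<Longrightarrow> x \<in> {a..b} \<Longrightarrow> u x = u a + (LINT t:{a..x}|lborel. v t)"
  unfolding primitive_on_def by (drule conjunct2, drule (1) bspec) linarith

lemma primitive_onI:
  assumes "set_integrable lborel {a..b} v"
    "\<And>x. x \<in> {a..b} \<Longrightarrow> u x = u a + (LINT t:{a..x}|lborel. v t)"
  shows "primitive_on a b u v"
  unfolding primitive_on_def
proof (intro conjI ballI assms(1))
  fix x assume "x \<in> {a..b}"
  from assms(2)[OF this] show "u x - u a = (LINT t:{a..x}|lborel. v t)" by linarith
qed

lemma primitive_on_diff:
  assumes "primitive_on a b u v" "a \<le> x" "x \<le> y" "y \<le> b"
  shows "u y - u x = (LINT t:{x..y}|lborel. v t)"
proof -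
  have "set_integrable lborel {a..y} v"
    using assms primitive_on_integrable[OF assms(1)] by (auto intro: set_integrable_subset)
  from set_integral_split[OF this, of x] primitive_on_eq[OF assms(1), of x]
    primitive_on_eq[OF assms(1), of y] assms show ?thesis by simp
qed

lemma primitive_on_continuous:
  assumes "primitive_on a b u v" shows "continuous_on {a..b} u"
proof -
  have 1: "set_integrable lborel {a..b} v" using assms by (simp add: primitive_on_def)
  have "continuous_on {a..b} (\<lambda>x. u a + integral {a..x} v)"
    by (intro continuous_intros indefinite_integral_continuous_1 set_integral_eq_HK 1)
  moreover have "u x = u a + integral {a..x} v" if "x \<in> {a..b}" for x
  proof -
    have "set_integrable lborel {a..x} v" using 1 that by (auto intro: set_integrable_subset)
    from set_integral_eq_HK(2)[OF this] show ?thesis using primitive_on_eq[OF assms that] by simp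
  qed
  ultimately show ?thesis by (metis (no_types, lifting) continuous_on_cong)
qed

lemma set_integrable_mult_continuous:
  fixes u v :: "real \<Rightarrow> real"
  assumes "continuous_on {a..b} u" "set_integrable lborel {a..b} v"
  shows "set_integrable lborel {a..b} (\<lambda>x. u x * v x)"
proof -
  have "bounded (u ` {a..b})" by (intro compact_imp_bounded compact_continuous_image assms compact_Icc)
  then obtain M where "\<forall>x\<in>{a..b}. \<bar>u x\<bar> \<le> M" by (auto simp: bounded_iff)
  then have M: "\<bar>u x\<bar> \<le> M" if "x \<in> {a..b}" for x using that by blast
  have "(\<lambda>x. (indicator {a..b} x *\<^sub>R u x) * (indicator {a..b} x *\<^sub>R v x)) \<in> borel_measurable lborel"
    using borel_measurable_continuous_on_indicator[OF _ assms(1)] assms(2)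
    by (intro borel_measurable_times) (auto simp: set_integrable_def dest: borel_measurable_integrable)
  also have "(\<lambda>x. (indicator {a..b} x *\<^sub>R u x) * (indicator {a..b} x *\<^sub>R v x))
      = (\<lambda>x. indicator {a..b} x *\<^sub>R (u x * v x))" by (auto simp: indicator_def)
  finally have m: "set_borel_measurable lborel {a..b} (\<lambda>x. u x * v x)" by (simp add: set_borel_measurable_def)
  have le: "\<bar>u x * v x\<bar> \<le> \<bar>M * v x\<bar>" if "x \<in> {a..b}" for x
    using M[OF that] by (simp add: abs_mult mult_right_mono)
  show ?thesis
    by (rule set_integrable_bound[OF set_integrable_mult_right[of M, OF assms(2)] m]) (use le in auto)
qed

text \<open>The product rule for absolutely continuous functions. It reduces to the product of the
  two integrals from \<open>a\<close>, which is the sum over the two triangles.\<close>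

lemma primitive_on_mult:
  assumes u: "primitive_on a b u v" and w: "primitive_on a b w z"
  shows "primitive_on a b (\<lambda>x. u x * w x) (\<lambda>x. u x * z x + w x * v x)"
proof -
  have iv: "set_integrable lborel {a..b} v" and iz: "set_integrable lborel {a..b} z"
    using u w by (auto simp: primitive_on_def)
  have i1: "set_integrable lborel {a..b} (\<lambda>x. u x * z x)" "set_integrable lborel {a..b} (\<lambda>x. w x * v x)"
    using u w by (auto intro!: set_integrable_mult_continuous primitive_on_continuous iv iz)
  have "u x * w x = u a * w a + (LINT t:{a..x}|lborel. u t * z t + w t * v t)" if x: "x \<in> {a..b}" for x
  proof -
    define V where "V t = (LINT s:{a..t}|lborel. v s)" for t
    define Z where "Z t = (LINT s:{a..t}|lborel. z s)" for t
    have sub: "set_integrable lborel {a..x} f" if "set_integrable lborel {a..b} f" for f :: "real \<Rightarrow> real"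
      using that x by (auto intro: set_integrable_subset)
    have cut: "(LINT s|lborel. (if s \<le> t then indicator {a..x} s *\<^sub>R f s else 0)) = (LINT s:{a..t}|lborel. f s)"
      if "t \<in> {a..x}" for t and f :: "real \<Rightarrow> real"
      unfolding set_lebesgue_integral_def
      by (rule Bochner_Integration.integral_cong) (use that in \<open>auto simp: indicator_def\<close>)
    have uV: "V t = u t - u a" "Z t = w t - w a" if "t \<in> {a..x}" for t
      unfolding V_def Z_def using that x by (auto simp: primitive_on_eq[OF u, of t] primitive_on_eq[OF w, of t])
    have "V x * Z x = (LINT t|lborel. (indicator {a..x} t *\<^sub>R z t) * (LINT s|lborel. (if s \<le> t then indicator {a..x} s *\<^sub>R v s else 0)))
      + (LINT t|lborel. (indicator {a..x} t *\<^sub>R v t) * (LINT s|lborel. (if s \<le> t then indicator {a..x} s *\<^sub>R z s else 0)))"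
      unfolding V_def Z_def set_lebesgue_integral_def
      by (rule integral_mult_triangles) (use sub[OF iv] sub[OF iz] in \<open>auto simp: set_integrable_def\<close>)
    also have "(LINT t|lborel. (indicator {a..x} t *\<^sub>R z t) * (LINT s|lborel. (if s \<le> t then indicator {a..x} s *\<^sub>R v s else 0)))
      = (LINT t:{a..x}|lborel. z t * V t)"
      unfolding set_lebesgue_integral_def[of _ "{a..x}" "\<lambda>t. z t * V t"]
      by (rule Bochner_Integration.integral_cong) (auto simp: cut V_def indicator_def)
    also have "(LINT t|lborel. (indicator {a..x} t *\<^sub>R v t) * (LINT s|lborel. (if s \<le> t then indicator {a..x} s *\<^sub>R z s else 0)))
      = (LINT t:{a..x}|lborel. v t * Z t)"
      unfolding set_lebesgue_integral_def[of _ "{a..x}" "\<lambda>t. v t * Z t"]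
      by (rule Bochner_Integration.integral_cong) (auto simp: cut Z_def indicator_def)
    finally have VZ: "V x * Z x = (LINT t:{a..x}|lborel. z t * V t) + (LINT t:{a..x}|lborel. v t * Z t)" .
    have eq1: "(LINT t:{a..x}|lborel. u t * z t) = (LINT t:{a..x}|lborel. u a * z t) + (LINT t:{a..x}|lborel. z t * V t)"
    proof -
      have "(LINT t:{a..x}|lborel. z t * V t) = (LINT t:{a..x}|lborel. u t * z t - u a * z t)"
        by (rule set_lebesgue_integral_cong) (auto simp: uV(1) algebra_simps)
      also have "\<dots> = (LINT t:{a..x}|lborel. u t * z t) - (LINT t:{a..x}|lborel. u a * z t)"
        by (intro set_integral_diff sub i1 set_integrable_mult_right iz)
      finally show ?thesis by simp
    qed
    have eq2: "(LINT t:{a..x}|lborel. w t * v t) = (LINT t:{a..x}|lborel. w a * v t) + (LINT t:{a..x}|lborel. v t * Z t)"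
    proof -
      have "(LINT t:{a..x}|lborel. v t * Z t) = (LINT t:{a..x}|lborel. w t * v t - w a * v t)"
        by (rule set_lebesgue_integral_cong) (auto simp: uV(2) algebra_simps)
      also have "\<dots> = (LINT t:{a..x}|lborel. w t * v t) - (LINT t:{a..x}|lborel. w a * v t)"
        by (intro set_integral_diff sub i1 set_integrable_mult_right iv)
      finally show ?thesis by simp
    qed
    have "(LINT t:{a..x}|lborel. u t * z t + w t * v t) = (LINT t:{a..x}|lborel. u t * z t) + (LINT t:{a..x}|lborel. w t * v t)"
      by (intro set_integral_add sub i1)
    also have "\<dots> = u a * Z x + w a * V x + V x * Z x"
      unfolding eq1 eq2 VZ by (simp add: V_def Z_def)
    finally have *: "(LINT t:{a..x}|lborel. u t * z t + w t * v t) = u a * Z x + w a * V x + V x * Z x" .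
    have "u x = u a + V x" "w x = w a + Z x" using uV[of x] x by auto
    then show ?thesis unfolding * by (simp add: algebra_simps)
  qed
  then show ?thesis
    by (intro primitive_onI set_integral_add i1)
qed

lemma primitive_on_power:
  assumes u: "primitive_on a b u v"
  shows "primitive_on a b (\<lambda>x. u x ^ Suc n) (\<lambda>x. real (Suc n) * u x ^ n * v x)"
proof (induction n)
  case 0
  then show ?case using u by simp
next
  case (Suc n)
  have "primitive_on a b (\<lambda>x. u x * u x ^ Suc n) (\<lambda>x. u x * (real (Suc n) * u x ^ n * v x) + u x ^ Suc n * v x)"
    by (rule primitive_on_mult[OF u Suc])
  moreover have "(\<lambda>x. u x * (real (Suc n) * u x ^ n * v x) + u x ^ Suc n * v x)
      = (\<lambda>x. real (Suc (Suc n)) * u x ^ Suc n * v x)" by (auto simp: algebra_simps)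
  moreover have "(\<lambda>x. u x * u x ^ Suc n) = (\<lambda>x. u x ^ Suc (Suc n))" by simp
  ultimately show ?case by (simp only:)
qed

text \<open>The form in which the classical fundamental theorem enters: finitely many exceptional points,
  such as kinks of a trial function, are harmless.\<close>

lemma primitive_on_piecewise:
  fixes u v :: "real \<Rightarrow> real"
  assumes "finite S" "continuous_on {a..b} u" "set_integrable lborel {a..b} v"
    and "\<And>x. x \<in> {a<..<b} - S \<Longrightarrow> (u has_real_derivative v x) (at x)"
  shows "primitive_on a b u v"
proof -
  have "u x = u a + (LINT t:{a..x}|lborel. v t)" if "x \<in> {a..b}" for x
  proof -
    have "set_integrable lborel {a..x} v" using assms(3) that by (auto intro: set_integrable_subset)
    note 1 = set_integral_eq_HK[OF this]
    have "(v has_integral (u x - u a)) {a..x}"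
      using that assms(2,4)
      by (intro fundamental_theorem_of_calculus_interior_strong[OF assms(1)])
         (auto simp: has_real_derivative_iff_has_vector_derivative intro: continuous_on_subset)
    then show ?thesis using 1 by (simp add: integral_unique)
  qed
  then show ?thesis by (intro primitive_onI assms)
qed

lemma primitive_on_C1:
  fixes u v :: "real \<Rightarrow> real"
  assumes "continuous_on {a..b} v" "\<And>x. x \<in> {a..b} \<Longrightarrow> (u has_real_derivative v x) (at x)"
  shows "primitive_on a b u v"
proof (rule primitive_on_piecewise[of "{}"])
  show "continuous_on {a..b} u"
    using assms(2) by (meson DERIV_isCont continuous_at_imp_continuous_on)
qed (use assms in \<open>auto intro: borel_integrable_atLeastAtMost'\<close>)

section \<open>Weak derivatives on an interval\<close>

lemma continuous_has_antiderivative: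
  fixes f :: "real \<Rightarrow> real"
  assumes "continuous_on UNIV f"
  shows "\<exists>F. \<forall>x. (F has_real_derivative f x) (at x)"
proof -
  have "isCont f x" for x
    using assms by (simp add: continuous_on_eq_continuous_at)
  then obtain F where "\<forall>x::real. - \<infinity> < ereal x \<longrightarrow> ereal x < \<infinity> \<longrightarrow> (F has_vector_derivative f x) (at x)"
    using einterval_antiderivative[of "-\<infinity>" "\<infinity>" f] by fastforce
  then show ?thesis
    by (intro exI[of _ F]) (simp add: has_real_derivative_iff_has_vector_derivative)
qed

lemma test_function_primitive:
  assumes "test_function a b \<psi>"
  shows "primitive_on c d \<psi> (deriv \<psi>)" "continuous_on UNIV (deriv \<psi>)"
proof -
  obtain D where D: "\<And>x. (\<psi> has_vector_derivative D x) (at x)" "continuous_on UNIV D"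
    using assms unfolding test_function_def C1_differentiable_on_def by auto
  then have "deriv \<psi> = D"
    by (auto simp: has_real_derivative_iff_has_vector_derivative intro!: DERIV_imp_deriv)
  then show 1: "continuous_on UNIV (deriv \<psi>)" using D by simp
  show "primitive_on c d \<psi> (deriv \<psi>)"
    using D \<open>deriv \<psi> = D\<close>
    by (intro primitive_on_C1 continuous_on_subset[OF 1])
       (auto simp: has_real_derivative_iff_has_vector_derivative)
qed

lemma primitive_on_weak_deriv:
  assumes "primitive_on a b u v" "a < b"
  shows "has_weak_deriv a b u v"
  unfolding has_weak_deriv_def
proof (intro conjI allI impI)
  show "loc_integrable a b u"
    unfolding loc_integrable_def
  proof (intro allI impI)
    fix c d assume "a < c \<and> d < b"
    then have "continuous_on {c..d} u"
      by (intro continuous_on_subset[OF primitive_on_continuous[OF assms(1)]]) auto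
    then show "set_integrable lborel {c..d} u" by (rule borel_integrable_atLeastAtMost')
  qed
  show "loc_integrable a b v"
    unfolding loc_integrable_def using primitive_on_integrable[OF assms(1)]
    by (auto intro: set_integrable_subset)
  fix \<psi> assume \<psi>: "test_function a b \<psi>"
  have p: "primitive_on a b \<psi> (deriv \<psi>)" by (rule test_function_primitive(1)[OF \<psi>])
  have "\<psi> a = 0" "\<psi> b = 0" using \<psi> unfolding test_function_def by force+
  have iu: "set_integrable lborel {a..b} (\<lambda>x. u x * deriv \<psi> x)"
    by (intro set_integrable_mult_continuous primitive_on_continuous[OF assms(1)] primitive_on_integrable[OF p])
  have iv: "set_integrable lborel {a..b} (\<lambda>x. \<psi> x * v x)"
    by (intro set_integrable_mult_continuous primitive_on_continuous[OF p] primitive_on_integrable[OF assms(1)])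
  have "u b * \<psi> b = u a * \<psi> a + (LINT x:{a..b}|lborel. u x * deriv \<psi> x + \<psi> x * v x)"
    using primitive_on_eq[OF primitive_on_mult[OF assms(1) p], of b] assms(2) by simp
  also have "(LINT x:{a..b}|lborel. u x * deriv \<psi> x + \<psi> x * v x)
      = (LINT x:{a..b}|lborel. u x * deriv \<psi> x) + (LINT x:{a..b}|lborel. \<psi> x * v x)"
    by (rule set_integral_add[OF iu iv])
  finally show "(LINT x:{a<..<b}|lborel. u x * deriv \<psi> x) = - (LINT x:{a<..<b}|lborel. v x * \<psi> x)"
    using \<open>\<psi> a = 0\<close> \<open>\<psi> b = 0\<close> by (simp add: set_integral_open_closed(1) mult.commute[of "v _"])
qed

text \<open>Let \<open>k\<close> be the mean of \<open>w\<close> with respect to a bump function \<open>\<beta>\<close>. The antiderivative of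
  \<open>\<beta> * (w - k)\<close> is a test function, and orthogonality makes the integral of \<open>\<beta> * (w - k)\<^sup>2\<close> vanish.\<close>

lemma du_bois_reymond_local:
  fixes w :: "real \<Rightarrow> real"
  assumes w: "continuous_on {c..d} w"
    and orth: "\<And>\<psi>. test_function c d \<psi> \<Longrightarrow> (LINT x:{c..d}|lborel. w x * deriv \<psi> x) = 0"
    and cd: "c < c'" "c' < d'" "d' < d"
  shows "\<exists>k. \<forall>x\<in>{c'<..<d'}. w x = k"
proof -
  define \<beta> where "\<beta> x = max 0 ((x - c') * (d' - x))" for x
  \<comment> \<open>\<open>w\<close> is continuous on \<open>[c, d]\<close> only; composing with the projection onto \<open>[c', d']\<close> extends it\<close>
  define clamp where "clamp x = max c' (min d' x)" for x
  have ct: "continuous_on A \<beta>" for A unfolding \<beta>_def by (intro continuous_intros)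
  have cw: "continuous_on A (\<lambda>x. w (clamp x))" for A
    using cd unfolding clamp_def
    by (intro continuous_on_compose2[OF w] continuous_intros) (auto simp: max_def min_def)
  have \<beta>0: "\<beta> x = 0" if "x \<notin> {c'<..<d'}" for x
  proof -
    have "(x - c') * (d' - x) \<le> 0" using that cd by (cases "x \<le> c'") (auto simp: mult_le_0_iff)
    then show ?thesis by (simp add: \<beta>_def)
  qed
  have \<beta>pos: "\<beta> x > 0" if "x \<in> {c'<..<d'}" for x
    using that by (auto simp: \<beta>_def)
  have \<beta>nn: "\<beta> x \<ge> 0" for x by (simp add: \<beta>_def)
  have mass: "integral {c'..d'} \<beta> > 0"
  proof -
    have "(c'+d')/2 \<in> {c'<..<d'}" using cd by simp
    then have "integral {c'..d'} \<beta> \<noteq> 0"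
      using integral_eq_0_iff[OF ct cd(2) \<beta>nn] \<beta>pos by fastforce
    moreover have "integral {c'..d'} \<beta> \<ge> 0"
      using \<beta>nn by (intro integral_nonneg integrable_continuous_real ct) auto
    ultimately show ?thesis by simp
  qed
  \<comment> \<open>chosen so that the antiderivative of \<open>\<eta>\<close> returns to zero at \<open>d'\<close>\<close>
  define k where "k = integral {c'..d'} (\<lambda>x. \<beta> x * w (clamp x)) / integral {c'..d'} \<beta>"
  define \<eta> where "\<eta> x = \<beta> x * (w (clamp x) - k)" for x
  have c\<eta>: "continuous_on A \<eta>" for A unfolding \<eta>_def by (intro continuous_intros ct cw)
  have int0: "integral {c'..d'} \<eta> = 0"
  proof -
    have "integral {c'..d'} \<eta> = integral {c'..d'} (\<lambda>x. \<beta> x * w (clamp x) - k * \<beta> x)"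
      by (intro arg_cong2[where f=integral] ext) (auto simp: \<eta>_def algebra_simps)
    also have "\<dots> = integral {c'..d'} (\<lambda>x. \<beta> x * w (clamp x)) - integral {c'..d'} (\<lambda>x. k * \<beta> x)"
      by (intro Henstock_Kurzweil_Integration.integral_diff integrable_continuous_real continuous_intros ct cw)
    also have "\<dots> = 0" using mass by (simp add: k_def)
    finally show ?thesis .
  qed
  obtain F where F': "\<And>x. (F has_real_derivative \<eta> x) (at x)"
    using continuous_has_antiderivative[OF c\<eta>] by blast
  have F: "(F has_vector_derivative \<eta> x) (at x)" for x
    using F' by (simp add: has_real_derivative_iff_has_vector_derivative)
  have FTC: "F y - F x = integral {x..y} \<eta>" if "x \<le> y" for x y
  proof -
    have "(\<eta> has_integral (F y - F x)) {x..y}"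
      by (rule fundamental_theorem_of_calculus[OF that has_vector_derivative_at_within[OF F]])
    then show ?thesis by (simp add: integral_unique)
  qed
  have \<eta>0: "\<eta> x = 0" if "x \<notin> {c'<..<d'}" for x using \<beta>0[OF that] by (simp add: \<eta>_def)
  define \<psi> where "\<psi> x = F x - F c'" for x
  have "\<psi> x = 0" if "x \<notin> {c'..d'}" for x
  proof (cases "x < c'")
    case True
    have "integral {x..c'} \<eta> = integral {x..c'} (\<lambda>x. 0)"
      using cd by (intro Henstock_Kurzweil_Integration.integral_cong \<eta>0) auto
    then show ?thesis using FTC[of x c'] True by (simp add: \<psi>_def)
  next
    case False
    then have "x > d'" using that by auto
    have "integral {d'..x} \<eta> = integral {d'..x} (\<lambda>x. 0)"
      using cd by (intro Henstock_Kurzweil_Integration.integral_cong \<eta>0) auto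
    then show ?thesis using FTC[of d' x] FTC[of c' d'] \<open>x > d'\<close> cd int0 by (simp add: \<psi>_def)
  qed
  moreover have D\<psi>: "(\<psi> has_vector_derivative \<eta> x) (at x)" for x
    unfolding \<psi>_def using has_vector_derivative_diff[OF F[of x] has_vector_derivative_const[of "F c'"]] by simp
  ultimately have "test_function c d \<psi>"
    unfolding test_function_def C1_differentiable_on_def using c\<eta> cd by blast
  moreover have "deriv \<psi> = \<eta>"
    using D\<psi> by (auto simp: has_real_derivative_iff_has_vector_derivative intro!: DERIV_imp_deriv)
  ultimately have "(LINT x:{c..d}|lborel. w x * \<eta> x) = 0" using orth[of \<psi>] by simp
  moreover have "set_integrable lborel {c..d} (\<lambda>x. w x * \<eta> x)"
    by (intro borel_integrable_atLeastAtMost' continuous_intros w c\<eta>)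
  ultimately have "integral {c..d} (\<lambda>x. w x * \<eta> x) = 0" by (simp add: set_integral_eq_HK)
  moreover have "integral {c..d} (\<lambda>x. w x * \<eta> x) = integral {c'..d'} (\<lambda>x. w x * \<eta> x)"
    using cd \<eta>0 by (intro integral_spike_set negligible_subset[OF negligible_empty]) force+
  moreover have "integral {c'..d'} (\<lambda>x. w x * \<eta> x) = integral {c'..d'} (\<lambda>x. w (clamp x) * \<eta> x)"
    by (intro Henstock_Kurzweil_Integration.integral_cong) (auto simp: clamp_def)
  ultimately have w\<eta>: "integral {c'..d'} (\<lambda>x. w (clamp x) * \<eta> x) = 0" by simp
  have "integral {c'..d'} (\<lambda>x. \<beta> x * (w (clamp x) - k)\<^sup>2)
      = integral {c'..d'} (\<lambda>x. w (clamp x) * \<eta> x - k * \<eta> x)"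
    by (intro arg_cong2[where f=integral] ext) (auto simp: \<eta>_def algebra_simps power2_eq_square)
  also have "\<dots> = integral {c'..d'} (\<lambda>x. w (clamp x) * \<eta> x) - integral {c'..d'} (\<lambda>x. k * \<eta> x)"
    by (intro Henstock_Kurzweil_Integration.integral_diff integrable_continuous_real continuous_intros cw c\<eta>)
  also have "\<dots> = 0" using w\<eta> int0 by simp
  finally have sq0: "integral {c'..d'} (\<lambda>x. \<beta> x * (w (clamp x) - k)\<^sup>2) = 0" .
  have "continuous_on {c'..d'} (\<lambda>x. \<beta> x * (w (clamp x) - k)\<^sup>2)"
    by (intro continuous_intros ct cw)
  then have "\<forall>x\<in>{c'..d'}. \<beta> x * (w (clamp x) - k)\<^sup>2 = 0"
    using integral_eq_0_iff[of c' d' "\<lambda>x. \<beta> x * (w (clamp x) - k)\<^sup>2"] cd(2) \<beta>nn sq0 by simp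
  have "w x = k" if "x \<in> {c'<..<d'}" for x
  proof -
    have "\<beta> x * (w (clamp x) - k)\<^sup>2 = 0" "clamp x = x"
      using that \<open>\<forall>x\<in>{c'..d'}. \<beta> x * (w (clamp x) - k)\<^sup>2 = 0\<close> by (auto simp: clamp_def)
    then show ?thesis using \<beta>pos[OF that] by simp
  qed
  then show ?thesis by blast
qed

lemma du_bois_reymond:
  fixes w :: "real \<Rightarrow> real"
  assumes w: "continuous_on {c..d} w"
    and orth: "\<And>\<psi>. test_function c d \<psi> \<Longrightarrow> (LINT x:{c..d}|lborel. w x * deriv \<psi> x) = 0"
    and x: "x \<in> {c..d}"
  shows "w x = w c"
proof (cases "c < d")
  case True
  define m where "m = (c + d) / 2"
  have m: "c < m" "m < d" using True by (auto simp: m_def)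
  have inner: "w y = w m" if "y \<in> {c<..<d}" for y
  proof -
    define c' where "c' = (c + min y m) / 2"
    define d' where "d' = (d + max y m) / 2"
    have "c < c'" "c' < d'" "d' < d" "y \<in> {c'<..<d'}" "m \<in> {c'<..<d'}"
      using that m by (auto simp: c'_def d'_def min_def max_def)
    with du_bois_reymond_local[OF w orth, of c' d'] show ?thesis by metis
  qed
  have cl: "closure {c<..<d} = {c..d}" using True by simp
  have "w y = w m" if "y \<in> {c..d}" for y
    using continuous_constant_on_closure[of "{c<..<d}" w "w m" y] inner that w cl by auto
  from this[OF x] this[of c] True show ?thesis by auto
next
  case False
  then have "x = c" using x by auto
  then show ?thesis by simp
qed

lemma set_integral_support:
  fixes f :: "real \<Rightarrow> real"
  assumes "a \<le> c" "d \<le> b" "\<And>x. x \<notin> {c..d} \<Longrightarrow> f x = 0"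
  shows "(LINT x:{a..b}|lborel. f x) = (LINT x:{c..d}|lborel. f x)"
  unfolding set_lebesgue_integral_def
proof (rule Bochner_Integration.integral_cong[OF refl])
  fix x show "indicat_real {a..b} x *\<^sub>R f x = indicat_real {c..d} x *\<^sub>R f x"
    using assms(1,2) assms(3)[of x] by (cases "x \<in> {c..d}") (auto simp: indicator_def)
qed

text \<open>The primitive \<open>V\<close> of \<open>v\<close> has the same weak derivative as \<open>u\<close>, so \<open>u - V\<close> is constant.
  On compact subintervals this holds for weak derivatives that are merely locally integrable.\<close>

lemma weak_deriv_primitive_interior:
  assumes wd: "has_weak_deriv a b u v" and u: "continuous_on {a<..<b} u" and cd: "a < c" "c \<le> d" "d < b"
  shows "primitive_on c d u v"
proof (cases "c = d")
  case True
  have "set_integrable lborel {c..d} v" using wd cd by (auto simp: has_weak_deriv_def loc_integrable_def)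
  moreover have "(LINT t:{c..c}|lborel. v t) = 0"
    using set_integral_open_closed(1)[of c c v] by (simp add: set_lebesgue_integral_def)
  ultimately show ?thesis using True by (intro primitive_onI) auto
next
  case False
  have iv: "set_integrable lborel {c..d} v" using wd cd by (auto simp: has_weak_deriv_def loc_integrable_def)
  define V where "V x = (LINT t:{c..x}|lborel. v t)" for x
  have "V c = 0"
    using set_integral_open_closed(1)[of c c v] by (simp add: set_lebesgue_integral_def V_def)
  then have V: "primitive_on c d V v"
    by (intro primitive_onI iv) (simp add: V_def)
  have uc: "continuous_on {c..d} u" using cd by (intro continuous_on_subset[OF u]) auto
  have cuV: "continuous_on {c..d} (\<lambda>x. u x - V x)"
    by (intro continuous_intros uc primitive_on_continuous[OF V])
  have orth: "(LINT x:{c..d}|lborel. (u x - V x) * deriv \<psi> x) = 0" if \<psi>: "test_function c d \<psi>" for \<psi>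
  proof -
    from \<psi> obtain c' d' where c'd': "c < c'" "d' < d" "\<And>x. x \<notin> {c'..d'} \<Longrightarrow> \<psi> x = 0"
      unfolding test_function_def by auto
    have \<psi>': "test_function a b \<psi>"
      using \<psi> c'd' cd unfolding test_function_def by (meson less_trans order_less_le_trans order_le_less_trans)
    have d0: "deriv \<psi> x = 0" if "x \<notin> {c..d}" for x
    proof -
      have "open (- {c'..d'})" "x \<in> - {c'..d'}" using that c'd' by auto
      then have "(\<psi> has_real_derivative 0) (at x)"
        using c'd'(3) by (intro has_field_derivative_transform_within_open[OF DERIV_const[of 0]]) auto
      then show ?thesis by (rule DERIV_imp_deriv)
    qed
    have p0: "\<psi> x = 0" if "x \<notin> {c..d}" for x using c'd' that by auto
    have "(LINT x:{a<..<b}|lborel. u x * deriv \<psi> x) = - (LINT x:{a<..<b}|lborel. v x * \<psi> x)"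
      using wd \<psi>' by (simp add: has_weak_deriv_def)
    then have e1: "(LINT x:{c..d}|lborel. u x * deriv \<psi> x) = - (LINT x:{c..d}|lborel. v x * \<psi> x)"
      unfolding set_integral_open_closed(1)
      using set_integral_support[of a c d b "\<lambda>x. u x * deriv \<psi> x"] set_integral_support[of a c d b "\<lambda>x. v x * \<psi> x"]
        d0 p0 cd by simp
    have e2: "(LINT x:{c..d}|lborel. V x * deriv \<psi> x) = - (LINT x:{c..d}|lborel. v x * \<psi> x)"
      using primitive_on_weak_deriv[OF V] False cd \<psi>
      by (simp add: has_weak_deriv_def set_integral_open_closed(1))
    have cd\<psi>: "continuous_on {c..d} (deriv \<psi>)"
      using test_function_primitive(2)[OF \<psi>] continuous_on_subset by blast
    have "(LINT x:{c..d}|lborel. (u x - V x) * deriv \<psi> x)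
       = (LINT x:{c..d}|lborel. u x * deriv \<psi> x) - (LINT x:{c..d}|lborel. V x * deriv \<psi> x)"
      unfolding left_diff_distrib
      by (intro set_integral_diff borel_integrable_atLeastAtMost' continuous_intros cd\<psi> uc primitive_on_continuous[OF V])
    then show "(LINT x:{c..d}|lborel. (u x - V x) * deriv \<psi> x) = 0" using e1 e2 by simp
  qed
  have "u x - V x = u c - V c" if "x \<in> {c..d}" for x
    by (rule du_bois_reymond[of c d "\<lambda>x. u x - V x", OF cuV orth that])
  then show ?thesis
    by (intro primitive_onI iv) (metis V_def \<open>V c = 0\<close> add.commute diff_0_right diff_add_cancel)
qed

text \<open>The positive and the negative part of \<open>f\<close>, taken as densities, define finite measures that agree on all
  half-lines and hence coincide.\<close>

lemma zero_integrals_AE: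
  fixes f :: "real \<Rightarrow> real"
  assumes f: "set_integrable lborel {c..d} f"
    and zero: "\<And>x. x \<in> {c..d} \<Longrightarrow> (LINT t:{c..x}|lborel. f t) = 0"
  shows "AE x in lborel. x \<in> {c..d} \<longrightarrow> f x = 0"
proof -
  define F where "F x = indicator {c..d} x *\<^sub>R f x" for x
  have F: "integrable lborel F" using f by (simp add: set_integrable_def F_def[abs_def])
  have [measurable]: "F \<in> borel_measurable borel" using F by auto
  have tail: "(LINT t:{x<..}|lborel. F t) = 0" for x
  proof -
    consider "x < c" | "x \<in> {c..d}" | "x > d" "x \<ge> c" by fastforce
    then show ?thesis
    proof cases
      case 1
      have "(LINT t:{x<..}|lborel. F t) = (LINT t:{c..d}|lborel. f t)"
        unfolding set_lebesgue_integral_def F_def using 1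
        by (intro Bochner_Integration.integral_cong) (auto simp: indicator_def)
      then show ?thesis
        using zero[of d] by (cases "c \<le> d") (auto simp: set_lebesgue_integral_def)
    next
      case 2
      have "(LINT t:{x<..}|lborel. F t) = (LINT t:{x<..d}|lborel. f t)"
        unfolding set_lebesgue_integral_def F_def using 2
        by (intro Bochner_Integration.integral_cong) (auto simp: indicator_def)
      also have "\<dots> = (LINT t:{x..d}|lborel. f t)"
        by (rule set_integral_discrete_difference[where X="{x}"]) auto
      also have "\<dots> = 0" using set_integral_split[OF f, of x] zero[of x] zero[of d] 2 by auto
      finally show ?thesis .
    next
      case 3
      have "(LINT t:{x<..}|lborel. F t) = (LINT t:{x<..}|lborel. 0)"
        unfolding set_lebesgue_integral_def F_def using 3
        by (intro Bochner_Integration.integral_cong) (auto simp: indicator_def)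
      then show ?thesis by simp
    qed
  qed
  have ipos: "integrable lborel (\<lambda>t. indicator {x<..} t * max 0 (F t))"
    and ineg: "integrable lborel (\<lambda>t. indicator {x<..} t * max 0 (- F t))" for x
    by (rule Bochner_Integration.integrable_bound[OF F], measurable, auto simp: indicator_def)+
  have dens: "density lborel (\<lambda>t. ennreal (max 0 (F t))) = density lborel (\<lambda>t. ennreal (max 0 (- F t)))"
  proof (rule measure_eqI_lessThan)
    have e: "emeasure (density lborel (\<lambda>t. ennreal (max 0 (G t)))) {x<..}
        = ennreal (LINT t|lborel. indicator {x<..} t * max 0 (G t))"
      if i: "integrable lborel (\<lambda>t. indicator {x<..} t * max 0 (G t))" and [measurable]: "G \<in> borel_measurable borel"
      for G :: "real \<Rightarrow> real" and x
    proof -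
      have "emeasure (density lborel (\<lambda>t. ennreal (max 0 (G t)))) {x<..}
        = (\<integral>\<^sup>+ t. ennreal (indicator {x<..} t * max 0 (G t)) \<partial>lborel)"
        by (subst emeasure_density) (auto intro!: nn_integral_cong simp: indicator_def)
      then show ?thesis using nn_integral_eq_integral[OF i] by simp
    qed
    fix x
    show "emeasure (density lborel (\<lambda>t. ennreal (max 0 (F t)))) {x<..} < \<infinity>"
      using e[OF ipos] by simp
    have "(LINT t:{x<..}|lborel. F t) = (LINT t|lborel. indicator {x<..} t * max 0 (F t) - indicator {x<..} t * max 0 (- F t))"
      unfolding set_lebesgue_integral_def by (intro Bochner_Integration.integral_cong) (auto simp: indicator_def)
    also have "\<dots> = (LINT t|lborel. indicator {x<..} t * max 0 (F t)) - (LINT t|lborel. indicator {x<..} t * max 0 (- F t))"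
      by (rule Bochner_Integration.integral_diff[OF ipos ineg])
    finally show "emeasure (density lborel (\<lambda>t. ennreal (max 0 (F t)))) {x<..}
        = emeasure (density lborel (\<lambda>t. ennreal (max 0 (- F t)))) {x<..}"
      using tail[of x] e[OF ipos] e[OF ineg] by simp
  qed auto
  have "AE t in lborel. ennreal (max 0 (F t)) = ennreal (max 0 (- F t))"
    by (rule iffD1[OF sigma_finite_measure.density_unique_iff[OF sigma_finite_lborel] dens]) auto
  then show ?thesis
  proof eventually_elim
    case (elim t)
    then have "max 0 (F t) = max 0 (- F t)"
      by (metis ennreal_inj max.cobounded1)
    then have "F t = 0" by linarith
    then show ?case by (auto simp: F_def)
  qed
qed

text \<open>Two weak derivatives have equal integrals over every compact subinterval; countably many
  such intervals exhaust the open interval.\<close>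

lemma weak_deriv_unique:
  assumes v: "has_weak_deriv a b u v" and v': "has_weak_deriv a b u v'" and u: "continuous_on {a<..<b} u"
  shows "AE x in lborel. x \<in> {a<..<b} \<longrightarrow> v x = v' x"
proof -
  have loc: "AE x in lborel. x \<in> {c..d} \<longrightarrow> v x = v' x" if cd: "a < c" "c \<le> d" "d < b" for c d
  proof -
    note p = weak_deriv_primitive_interior[OF v u cd] and p' = weak_deriv_primitive_interior[OF v' u cd]
    have i: "set_integrable lborel {c..x} v" "set_integrable lborel {c..x} v'" if "x \<in> {c..d}" for x
      using primitive_on_integrable[OF p] primitive_on_integrable[OF p'] that by (auto intro: set_integrable_subset)
    have "set_integrable lborel {c..d} (\<lambda>x. v x - v' x)"
      using i[of d] cd by (intro set_integral_diff(1)) auto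
    moreover have "(LINT t:{c..x}|lborel. v t - v' t) = 0" if "x \<in> {c..d}" for x
      using set_integral_diff(2)[OF i[OF that]] primitive_on_eq[OF p that] primitive_on_eq[OF p' that] by simp
    ultimately have "AE x in lborel. x \<in> {c..d} \<longrightarrow> v x - v' x = 0"
      by (rule zero_integrals_AE)
    then show ?thesis by eventually_elim auto
  qed
  show ?thesis
  proof (cases "a < b")
    case True
    define \<delta> where "\<delta> n = (b - a) / (real n + 3)" for n
    have \<delta>: "\<delta> n > 0" "a + \<delta> n \<le> b - \<delta> n" for n
    proof -
      have "(b - a) / (real n + 3) \<le> (b - a) / 2" using True by (intro divide_left_mono) auto
      then show "a + \<delta> n \<le> b - \<delta> n" unfolding \<delta>_def by argo
      show "\<delta> n > 0" using True by (simp add: \<delta>_def)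
    qed
    have "AE x in lborel. \<forall>n. x \<in> {a + \<delta> n..b - \<delta> n} \<longrightarrow> v x = v' x"
      unfolding AE_all_countable using \<delta> by (intro allI loc) (auto simp: less_eq_real_def)
    then show ?thesis
    proof eventually_elim
      case (elim x)
      show ?case
      proof
        assume x: "x \<in> {a<..<b}"
        define e where "e = min (x - a) (b - x)"
        have "e > 0" using x by (auto simp: e_def)
        obtain n :: nat where n: "(b - a) / e < real n" using reals_Archimedean2[of "(b - a) / e"] by auto
        then have "b - a < real n * e" using \<open>e > 0\<close> by (simp only: pos_divide_less_eq)
        also have "real n * e \<le> e * (real n + 3)" using \<open>e > 0\<close> by (simp add: distrib_left)
        finally have "\<delta> n \<le> e" by (simp add: \<delta>_def divide_le_eq)
        then have "x \<in> {a + \<delta> n..b - \<delta> n}" by (auto simp: e_def)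
        with elim show "v x = v' x" by blast
      qed
    qed
  qed auto
qed

section \<open>Sobolev functions and the chain rule for the ansatz\<close>

lemma primitive_on_cong:
  assumes "primitive_on a b u v" "\<And>x. x \<in> {a..b} \<Longrightarrow> u x = u' x" "\<And>x. x \<in> {a..b} \<Longrightarrow> v x = v' x"
  shows "primitive_on a b u' v'"
proof (rule primitive_onI)
  show "set_integrable lborel {a..b} v'"
    by (rule iffD1[OF set_integrable_cong[OF refl refl assms(3)] primitive_on_integrable[OF assms(1)]])
  fix x assume x: "x \<in> {a..b}"
  have "(LINT t:{a..x}|lborel. v t) = (LINT t:{a..x}|lborel. v' t)"
    by (rule set_lebesgue_integral_cong) (use assms(3) x in auto)
  then show "u' x = u' a + (LINT t:{a..x}|lborel. v' t)"
    using primitive_on_eq[OF assms(1) x] assms(2)[of x] assms(2)[of a] x by simp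
qed

text \<open>Both sides of the fundamental theorem are continuous up to the endpoints once \<open>v\<close> is
  integrable on the whole interval.\<close>

lemma primitive_on_closure:
  assumes ab: "a < b" and u: "continuous_on {a..b} u" and v: "set_integrable lborel {a..b} v"
    and inner: "\<And>c d. a < c \<Longrightarrow> c \<le> d \<Longrightarrow> d < b \<Longrightarrow> primitive_on c d u v"
  shows "primitive_on a b u v"
proof -
  define V where "V x = (LINT t:{a..x}|lborel. v t)" for x
  have "V a = 0"
    using set_integral_open_closed(1)[of a a v] by (simp add: set_lebesgue_integral_def V_def)
  then have V: "primitive_on a b V v"
    by (intro primitive_onI v) (simp add: V_def)
  define m where "m = (a + b) / 2"
  have m: "a < m" "m < b" using ab by (auto simp: m_def)
  have const: "u x - V x = u m - V m" if x: "x \<in> {a<..<b}" for x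
  proof -
    have *: "u d - u c = V d - V c" if "a < c" "c \<le> d" "d < b" for c d
      using primitive_on_diff[OF inner[OF that], of c d] primitive_on_diff[OF V, of c d] that by simp
    show ?thesis using *[of x m] *[of m x] m x by (cases "x \<le> m") auto
  qed
  have cl: "closure {a<..<b} = {a..b}" using ab by simp
  have cont: "continuous_on {a..b} (\<lambda>x. u x - V x)"
    by (intro continuous_intros u primitive_on_continuous[OF V])
  have all: "u x - V x = u m - V m" if "x \<in> {a..b}" for x
    using continuous_constant_on_closure[of "{a<..<b}" "\<lambda>x. u x - V x" "u m - V m" x] const that cont cl
    by auto
  show ?thesis
  proof (rule primitive_onI[OF v])
    fix x assume x: "x \<in> {a..b}"
    then have "a \<in> {a..b}" by auto
    from all[OF x] all[OF this] \<open>V a = 0\<close> have "u x = u a + V x" by simp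
    then show "u x = u a + (LINT t:{a..x}|lborel. v t)" by (simp add: V_def)
  qed
qed

lemma in_Lp_integrable:
  assumes "in_Lp p a b v" "p \<ge> 1"
  shows "set_integrable lborel {a..b} v"
proof -
  have "set_integrable lborel {a<..<b} (\<lambda>x. 1::real)"
    unfolding set_integral_open_closed(2) by (rule borel_integrable_atLeastAtMost'[OF continuous_on_const])
  then have "set_integrable lborel {a<..<b} (\<lambda>x. 1 + \<bar>v x\<bar> ^ p)"
    using assms(1) by (intro set_integral_add(1)) (auto simp: in_Lp_def)
  then have "set_integrable lborel {a<..<b} v"
  proof (rule set_integrable_bound)
    show "set_borel_measurable lborel {a<..<b} v" using assms(1) by (simp add: in_Lp_def)
    have "\<bar>v x\<bar> \<le> 1 + \<bar>v x\<bar> ^ p" for x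
    proof (cases "\<bar>v x\<bar> \<le> 1")
      case True
      moreover have "\<bar>v x\<bar> ^ p \<ge> 0" by simp
      ultimately show ?thesis by linarith
    next
      case False
      then have "\<bar>v x\<bar> ^ 1 \<le> \<bar>v x\<bar> ^ p" using assms(2) by (intro power_increasing) auto
      then show ?thesis by simp
    qed
    then show "AE x in lborel. x \<in> {a<..<b} \<longrightarrow> norm (v x) \<le> norm (1 + \<bar>v x\<bar> ^ p)" by simp
  qed
  then show ?thesis by (simp add: set_integral_open_closed(2))
qed

lemma W1_primitive:
  assumes "u \<in> W1 p a b" "p \<ge> 1" "a < b"
  obtains v where "primitive_on a b u v"
proof -
  obtain v where v: "in_Lp p a b v" "has_weak_deriv a b u v" and u: "continuous_on {a..b} u"
    using assms(1) unfolding W1_def by blast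
  have "continuous_on {a<..<b} u" by (rule continuous_on_subset[OF u]) auto
  then have "primitive_on a b u v"
    using primitive_on_closure[OF assms(3) u in_Lp_integrable[OF v(1) assms(2)]]
      weak_deriv_primitive_interior[OF v(2)] by blast
  then show ?thesis by (rule that)
qed

lemma loc_integrable_measurable:
  assumes "loc_integrable a b v"
  shows "(\<lambda>x. indicator {a<..<b} x *\<^sub>R v x) \<in> borel_measurable lborel"
proof (rule borel_measurable_LIMSEQ_real)
  define I where "I n = {a + 1 / real (Suc n) .. b - 1 / real (Suc n)}" for n
  show "(\<lambda>x. indicator (I n) x *\<^sub>R v x) \<in> borel_measurable lborel" for n
  proof -
    have "set_integrable lborel (I n) v"
      using assms unfolding loc_integrable_def I_def by simp
    then show ?thesis by (auto simp: set_integrable_def)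
  qed
  fix x :: real
  have "\<forall>\<^sub>F n in sequentially. indicator (I n) x *\<^sub>R v x = indicator {a<..<b} x *\<^sub>R v x"
  proof (cases "x \<in> {a<..<b}")
    case True
    have "(\<lambda>n. 1 / real (Suc n)) \<longlonglongrightarrow> 0" by (rule LIMSEQ_Suc) (rule lim_1_over_n)
    then have "\<forall>\<^sub>F n in sequentially. 1 / real (Suc n) < min (x - a) (b - x)"
      using True by (intro order_tendstoD(2)) auto
    then show ?thesis by eventually_elim (use True in \<open>auto simp: I_def\<close>)
  next
    case False
    have "x \<notin> I n" for n
    proof -
      have "1 / real (Suc n) > 0" by simp
      then show ?thesis using False unfolding I_def atLeastAtMost_iff greaterThanLessThan_iff by linarith
    qed
    then show ?thesis using False by auto
  qed
  then show "(\<lambda>n. indicator (I n) x *\<^sub>R v x) \<longlonglongrightarrow> indicator {a<..<b} x *\<^sub>R v x"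
    by (rule tendsto_eventually)
qed

text \<open>The choice operator in \<open>wderiv\<close> may return any weak derivative, not only one with the expected
  integrability; by uniqueness it agrees with the density of \<open>u\<close> up to a null set.\<close>

lemma wderiv_AE_eq:
  assumes "primitive_on a b u v" "a < b"
  shows "AE x in lborel. x \<in> {a<..<b} \<longrightarrow> wderiv a b u x = v x"
    and "has_weak_deriv a b u (wderiv a b u)"
proof -
  have wd: "has_weak_deriv a b u v" by (rule primitive_on_weak_deriv[OF assms])
  then show w: "has_weak_deriv a b u (wderiv a b u)" unfolding wderiv_def by (rule someI[where P = "has_weak_deriv a b u"])
  have "continuous_on {a<..<b} u"
    by (rule continuous_on_subset[OF primitive_on_continuous[OF assms(1)]]) auto
  then show "AE x in lborel. x \<in> {a<..<b} \<longrightarrow> wderiv a b u x = v x"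
    by (rule weak_deriv_unique[OF w wd])
qed

lemma primitive_on_wderiv:
  assumes "primitive_on a b u v" "a < b"
  shows "primitive_on a b u (wderiv a b u)"
proof (rule primitive_on_closure[OF assms(2) primitive_on_continuous[OF assms(1)]])
  have wd: "has_weak_deriv a b u (wderiv a b u)" by (rule wderiv_AE_eq(2)[OF assms])
  have iv: "set_integrable lborel {a<..<b} v"
    using primitive_on_integrable[OF assms(1)] by (simp add: set_integral_open_closed(2))
  have m: "(\<lambda>x. indicat_real {a<..<b} x *\<^sub>R wderiv a b u x) \<in> borel_measurable lborel"
    using wd by (intro loc_integrable_measurable) (simp add: has_weak_deriv_def)
  have ae: "AE x in lborel. indicat_real {a<..<b} x *\<^sub>R v x = indicat_real {a<..<b} x *\<^sub>R wderiv a b u x"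
    using wderiv_AE_eq(1)[OF assms] by eventually_elim (auto simp: indicator_def)
  have "set_integrable lborel {a<..<b} (wderiv a b u)"
    unfolding set_integrable_def
    by (rule integrable_cong_AE_imp[OF iv[unfolded set_integrable_def] m ae])
  then show "set_integrable lborel {a..b} (wderiv a b u)" by (simp add: set_integral_open_closed(2))
  have "continuous_on {a<..<b} u"
    by (rule continuous_on_subset[OF primitive_on_continuous[OF assms(1)]]) auto
  then show "primitive_on c d u (wderiv a b u)" if "a < c" "c \<le> d" "d < b" for c d
    by (rule weak_deriv_primitive_interior[OF wd _ that])
qed

lemma total_D_ansatz:
  assumes "(F has_real_derivative F') (at x)"
  shows "total_D (ansatz q F) x y z = F' * y ^ (2*q) + F x * (real (2*q) * y ^ (2*q-1)) * z"
proof -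
  have "((\<lambda>t. F t * y ^ (2*q)) has_real_derivative F' * y ^ (2*q)) (at x)"
    by (rule DERIV_cmult_right[OF assms])
  moreover have "((\<lambda>t. F x * t ^ (2*q)) has_real_derivative F x * (real (2*q) * y ^ (2*q-1))) (at y)"
    by (auto intro!: derivative_eq_intros)
  ultimately show ?thesis
    unfolding total_D_def ansatz_def by (simp only: DERIV_imp_deriv)
qed

lemma ansatz_C1:
  assumes F: "\<And>x. x \<in> {a..b} \<Longrightarrow> (F has_real_derivative F' x) (at x)" and F': "continuous_on {a..b} F'"
  shows "C1_closure a b (ansatz q F)" "C1_interior a b (ansatz q F)"
proof -
  have cF: "continuous_on {a..b} F" using F by (meson DERIV_isCont continuous_at_imp_continuous_on)
  let ?x = "\<lambda>x y. F' x * y ^ (2*q)" and ?y = "\<lambda>x y. F x * (real (2*q) * y ^ (2*q-1))"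
  have d: "((\<lambda>t. ansatz q F t y) has_real_derivative ?x x y) (at x)"
          "((\<lambda>t. ansatz q F x t) has_real_derivative ?y x y) (at y)" if "x \<in> {a<..<b}" for x y
    using that F[of x] unfolding ansatz_def by (auto intro!: derivative_eq_intros)
  have comp: "continuous_on ({a..b} \<times> UNIV) (\<lambda>p. G (fst p))" if "continuous_on {a..b} G" for G :: "real \<Rightarrow> real"
    by (rule continuous_on_compose2[OF that]) (auto intro: continuous_intros)
  have c: "continuous_on ({a..b} \<times> UNIV) (\<lambda>(x, y). ansatz q F x y)"
    "continuous_on ({a..b} \<times> UNIV) (\<lambda>(x, y). ?x x y)" "continuous_on ({a..b} \<times> UNIV) (\<lambda>(x, y). ?y x y)"
    unfolding ansatz_def case_prod_unfold
    by (intro continuous_intros comp[OF cF] comp[OF F'])+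
  show "C1_closure a b (ansatz q F)" 
    unfolding C1_closure_def by (intro conjI c(1) exI[of _ ?x] exI[of _ ?y] ballI allI d c(2,3))
  have sub: "{a<..<b} \<times> UNIV \<subseteq> {a..b} \<times> (UNIV :: real set)" by auto
  show "C1_interior a b (ansatz q F)"
    unfolding C1_interior_def by (intro conjI exI[of _ ?x] exI[of _ ?y] ballI allI d
        continuous_on_subset[OF c(2) sub] continuous_on_subset[OF c(3) sub])
qed

text \<open>Powers and products of absolutely continuous functions are absolutely continuous, and their densities
  follow the product rule; for \<open>F(x) u(x)\<^sup>2\<^sup>q\<close> this density is the total derivative of the ansatz.\<close>

lemma ansatz_chain_rule:
  assumes F: "\<And>x. x \<in> {a..b} \<Longrightarrow> (F has_real_derivative F' x) (at x)" and F': "continuous_on {a..b} F'"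
    and "q \<ge> 1" "a < b" "u \<in> W1 (2*q) a b"
  shows "chain_rule_integral a b (ansatz q F) u (ansatz q F b (u b) - ansatz q F a (u a))"
proof -
  obtain v where "primitive_on a b u v" using W1_primitive[OF assms(5)] assms by auto
  then have u: "primitive_on a b u (wderiv a b u)" by (rule primitive_on_wderiv) fact
  have "primitive_on a b (\<lambda>x. F x * u x ^ Suc (2*q-1))
     (\<lambda>x. F x * (real (Suc (2*q-1)) * u x ^ (2*q-1) * wderiv a b u x) + u x ^ Suc (2*q-1) * F' x)"
    by (intro primitive_on_mult primitive_on_C1[OF F'] F primitive_on_power u)
  then have p: "primitive_on a b (\<lambda>x. ansatz q F x (u x)) (\<lambda>x. total_D (ansatz q F) x (u x) (wderiv a b u x))"
  proof (rule primitive_on_cong)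
    have e: "Suc (2*q-1) = 2*q" using \<open>q \<ge> 1\<close> by simp
    show "F x * u x ^ Suc (2*q-1) = ansatz q F x (u x)" for x unfolding e ansatz_def ..
    show "F x * (real (Suc (2*q-1)) * u x ^ (2*q-1) * wderiv a b u x) + u x ^ Suc (2*q-1) * F' x
        = total_D (ansatz q F) x (u x) (wderiv a b u x)" if "x \<in> {a..b}" for x
      unfolding e total_D_ansatz[OF F[OF that]] by (simp add: algebra_simps)
  qed
  show ?thesis
    unfolding chain_rule_integral_def
    using primitive_on_weak_deriv[OF p \<open>a < b\<close>] primitive_on_integrable[OF p]
      primitive_on_diff[OF p, of a b] \<open>a < b\<close>
    by (simp add: set_integral_open_closed)
qed

lemma boundary_sum:
  fixes h :: "real \<Rightarrow> real"
  assumes "boundary_pieces a b s dO" "a < b"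
  shows "(\<Sum>i<s. \<Sum>x\<in>dO i. h x) = h a + h b"
proof -
  have U: "(\<Union>i<s. dO i) = {a, b}" and disj: "disjoint_family_on dO {..<s}"
    using assms by (auto simp: boundary_pieces_def)
  have "finite (dO i)" if "i < s" for i
    by (rule finite_subset[of _ "{a, b}"]) (use U that in auto)
  then have "(\<Sum>x\<in>(\<Union>i<s. dO i). h x) = (\<Sum>i<s. \<Sum>x\<in>dO i. h x)"
    using disj by (intro sum.UNION_disjoint) (auto simp: disjoint_family_on_def)
  then show ?thesis using U assms by simp
qed

lemma ansatz_Phi:
  assumes F: "\<And>x. x \<in> {a..b} \<Longrightarrow> (F has_real_derivative F' x) (at x)" and F': "continuous_on {a..b} F'"
    and "q \<ge> 1" "a < b"
  shows "boundary_pieces a b s dO \<Longrightarrow> ansatz q F \<in> Phi q a b s dO"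
    and "ansatz q F \<in> Phi_hat q a b"
proof -
  assume bp: "boundary_pieces a b s dO"
  have sum: "(\<Sum>i<s. \<Sum>x\<in>dO i. ansatz q F x (u x) * outward_normal a b x)
      = ansatz q F b (u b) - ansatz q F a (u a)" for u
    using boundary_sum[OF bp \<open>a < b\<close>] \<open>a < b\<close> by (simp add: outward_normal_def)
  show "ansatz q F \<in> Phi q a b s dO"
    unfolding Phi_def mem_Collect_eq sum
    by (intro conjI ballI ansatz_C1(1)[OF F F'] ansatz_chain_rule[OF F F' assms(3,4)])
next
  have "chain_rule_integral a b (ansatz q F) u 0" if u: "u \<in> W1_0 (2*q) a b" for u
  proof -
    have "ansatz q F b (u b) - ansatz q F a (u a) = 0" and "u \<in> W1 (2*q) a b"
      using u \<open>q \<ge> 1\<close> by (auto simp: W1_0_def ansatz_def)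
    with ansatz_chain_rule[OF F F' assms(3,4), of u] show ?thesis by simp
  qed
  then show "ansatz q F \<in> Phi_hat q a b"
    unfolding Phi_hat_def mem_Collect_eq by (intro conjI ballI ansatz_C1(2)[OF F F'])
qed

section \<open>The Riccati equation\<close>

text \<open>The odd root makes sense for negative \<open>s\<close>, so the last factor is \<open>\<bar>s\<bar>\<close> to the power \<open>2q / (2q - 1)\<close>.\<close>

definition riccati_rhs :: "nat \<Rightarrow> real \<Rightarrow> real \<Rightarrow> real" where
  "riccati_rhs q lam s = lam + real (2*q-1) * root (2*q-1) s ^ (2*q)"

text \<open>The time in which a solution of \<open>F' = riccati_rhs q lam F\<close> rises from \<open>- M\<close> to \<open>M\<close>.\<close>

definition riccati_time :: "nat \<Rightarrow> real \<Rightarrow> real \<Rightarrow> real" where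
  "riccati_time q lam M = integral {-M..M} (\<lambda>s. 1 / riccati_rhs q lam s)"

lemma riccati_rhs_ge: "riccati_rhs q lam s \<ge> lam"
  by (simp add: riccati_rhs_def power_mult)

lemma riccati_rhs_pos: "lam > 0 \<Longrightarrow> riccati_rhs q lam s > 0"
  using riccati_rhs_ge[of lam q s] by linarith

lemma continuous_on_riccati_rhs [continuous_intros]:
  "continuous_on A f \<Longrightarrow> continuous_on A (\<lambda>x. riccati_rhs q lam (f x))"
  unfolding riccati_rhs_def by (intro continuous_intros)

lemma continuous_on_inverse_riccati_rhs:
  assumes "lam > 0" shows "continuous_on A (\<lambda>s. 1 / riccati_rhs q lam s)"
  using riccati_rhs_pos[OF assms, of q] by (intro continuous_intros) (auto simp: less_le)

text \<open>Separation of variables: \<open>F\<close> is the inverse function of an antiderivative of \<open>1 / riccati_rhs q lam\<close>.\<close>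

lemma riccati_solution:
  assumes "lam > 0" "M > 0"
  obtains F where "\<And>x. x \<in> {c..c + riccati_time q lam M} \<Longrightarrow>
      (F has_real_derivative riccati_rhs q lam (F x)) (at x)"
    "F c = - M" "F (c + riccati_time q lam M) = M" "riccati_time q lam M > 0"
proof -
  let ?G = "riccati_rhs q lam"
  have Gpos: "?G s > 0" for s by (rule riccati_rhs_pos[OF assms(1)])
  obtain X where X: "\<And>s. (X has_real_derivative 1 / ?G s) (at s)"
    using continuous_has_antiderivative[OF continuous_on_inverse_riccati_rhs[OF assms(1), of UNIV]] by blast
  define Y where "Y s = X s - X (-M) + c" for s
  have Y: "(Y has_real_derivative 1 / ?G s) (at s)" for s
    unfolding Y_def by (auto intro!: derivative_eq_intros X)
  have mono: "Y s < Y t" if "s < t" for s t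
    using that Gpos by (intro DERIV_pos_imp_increasing[OF that]) (metis Y zero_less_divide_1_iff)
  have Ycont: "isCont Y s" for s using Y DERIV_isCont by blast
  have "((\<lambda>s. 1 / ?G s) has_integral (X M - X (-M))) {-M..M}"
    using assms(2) X
    by (intro fundamental_theorem_of_calculus)
       (auto simp flip: has_real_derivative_iff_has_vector_derivative intro: has_field_derivative_at_within)
  then have T: "riccati_time q lam M = X M - X (-M)" unfolding riccati_time_def by (rule integral_unique)
  then have YM: "Y (-M) = c" "Y M = c + riccati_time q lam M" by (auto simp: Y_def)
  have "inj Y" using mono by (metis injI less_irrefl linorder_neqE_linordered_idom)
  define F where "F = inv Y"
  have FY: "F (Y s) = s" for s unfolding F_def by (rule inv_f_f) fact
  have Fcont: "isCont F (Y s)" for s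
    by (rule isCont_inverse_function[of 1]) (auto simp: FY Ycont)
  have surj: "\<exists>s. s \<in> {l..r} \<and> Y s = y" if "y \<in> {Y l..Y r}" "l \<le> r" for y l r
    using IVT[of Y l y r] that Ycont by auto
  have der: "(F has_real_derivative ?G s) (at (Y s))" for s
  proof -
    have "(F has_real_derivative inverse (1 / ?G (F (Y s)))) (at (Y s))"
    proof (rule DERIV_inverse_function[of Y])
      show "(Y has_real_derivative 1 / ?G (F (Y s))) (at (F (Y s)))" by (rule Y)
      show "1 / ?G (F (Y s)) \<noteq> 0" using Gpos by (metis divide_eq_0_iff less_irrefl zero_neq_one)
      show "Y (s - 1) < Y s" "Y s < Y (s + 1)" by (auto intro: mono)
      show "Y (F y) = y" if "Y (s - 1) < y" "y < Y (s + 1)" for y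
        using surj[of y "s - 1" "s + 1"] that FY by auto
    qed (rule Fcont)
    then show ?thesis by (simp add: FY)
  qed
  show ?thesis
  proof (rule that)
    fix x assume "x \<in> {c..c + riccati_time q lam M}"
    then obtain s where "x = Y s" using surj[of x "-M" M] YM assms(2) by auto
    then show "(F has_real_derivative ?G (F x)) (at x)" using der[of s] by (simp add: FY)
  next
    show "F c = - M" "F (c + riccati_time q lam M) = M" using FY[of "-M"] FY[of M] YM by auto
    show "riccati_time q lam M > 0" using YM mono[of "-M" M] assms(2) by simp
  qed
qed

lemma set_integral_three_pieces:
  fixes f f1 f2 f3 :: "real \<Rightarrow> real"
  assumes "a \<le> c" "c \<le> d" "d \<le> b"
    and c: "continuous_on {a..c} f1" "continuous_on {c..d} f2" "continuous_on {d..b} f3"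
    and e: "\<And>x. a < x \<Longrightarrow> x < c \<Longrightarrow> f x = f1 x" "\<And>x. c < x \<Longrightarrow> x < d \<Longrightarrow> f x = f2 x"
      "\<And>x. d < x \<Longrightarrow> x < b \<Longrightarrow> f x = f3 x"
  shows "set_integrable lborel {a..b} f"
    and "(LINT x:{a..b}|lborel. f x) = (LINT x:{a..c}|lborel. f1 x) + (LINT x:{c..d}|lborel. f2 x) + (LINT x:{d..b}|lborel. f3 x)"
proof -
  have piece: "set_integrable lborel {l..r} f \<and> (LINT x:{l..r}|lborel. f x) = (LINT x:{l..r}|lborel. g x)"
    if "continuous_on {l..r} g" "\<And>x. l < x \<Longrightarrow> x < r \<Longrightarrow> f x = g x" for l r g
  proof
    have "set_integrable lborel {l<..<r} g"
      using borel_integrable_atLeastAtMost'[OF that(1)] by (simp add: set_integral_open_closed(2))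
    then have "set_integrable lborel {l<..<r} f"
      using that(2) by (subst set_integrable_cong[OF refl refl, of _ f g]) auto
    then show "set_integrable lborel {l..r} f" by (simp add: set_integral_open_closed(2))
    have "(LINT x:{l<..<r}|lborel. f x) = (LINT x:{l<..<r}|lborel. g x)"
      by (rule set_lebesgue_integral_cong) (use that(2) in auto)
    then show "(LINT x:{l..r}|lborel. f x) = (LINT x:{l..r}|lborel. g x)"
      by (simp only: set_integral_open_closed(1))
  qed
  note p = piece[OF c(1) e(1)] piece[OF c(2) e(2)] piece[OF c(3) e(3)]
  have "set_integrable lborel ({a..c} \<union> {c..d} \<union> {d..b}) f"
    using p by (intro set_integrable_Un) auto
  moreover have "{a..c} \<union> {c..d} \<union> {d..b} = {a..b}" using assms(1-3) by auto
  ultimately show i: "set_integrable lborel {a..b} f" by simp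
  have "set_integrable lborel {c..b} f" using i assms(1) by (auto intro: set_integrable_subset)
  from set_integral_split[OF i, of c] set_integral_split[OF this, of d] p assms(1-3)
  show "(LINT x:{a..b}|lborel. f x) = (LINT x:{a..c}|lborel. f1 x) + (LINT x:{c..d}|lborel. f2 x) + (LINT x:{d..b}|lborel. f3 x)"
    by simp
qed

lemma LINT_const_Icc: "l \<le> r \<Longrightarrow> (LINT x:{l..r}|lborel. k) = (r - l) * (k::real)"
  by (simp add: set_integral_eq_HK borel_integrable_atLeastAtMost')

text \<open>The gain \<open>\<delta>\<close> is already made on \<open>[-1, 1]\<close>, so it is uniform in \<open>M\<close>. It leaves
  room for the two linear pieces of a trial function, whose length tends to zero as \<open>M\<close> grows.\<close>

lemma riccati_time_decrease:
  assumes "0 < lam" "lam < lam'"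
  obtains \<delta> where "\<delta> > 0" "\<And>M. M \<ge> 1 \<Longrightarrow> riccati_time q lam' M + \<delta> \<le> riccati_time q lam M"
proof -
  define g where "g s = 1 / riccati_rhs q lam s - 1 / riccati_rhs q lam' s" for s
  have cg: "continuous_on A g" for A
    unfolding g_def using assms by (intro continuous_intros continuous_on_inverse_riccati_rhs) auto
  have gpos: "g s > 0" for s
    unfolding g_def using assms riccati_rhs_pos[of lam q s]
    by (simp add: divide_strict_left_mono riccati_rhs_def)
  have gnn: "g s \<ge> 0" for s using gpos[of s] by simp
  have "(integral {-1..1} g = 0) = (\<forall>x\<in>{-1..1}. g x = 0)"
    by (rule integral_eq_0_iff[OF cg _ gnn]) auto
  moreover have "\<not> (\<forall>x\<in>{-1..1}. g x = 0)" using gpos[of 0] by force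
  ultimately have "integral {-1..1} g \<noteq> 0" by blast
  moreover have "integral {-1..1} g \<ge> 0"
    using gpos by (intro integral_nonneg integrable_continuous_real cg) (auto simp: less_imp_le)
  ultimately have 1: "integral {-1..1} g > 0" by simp
  have 2: "riccati_time q lam' M + integral {-1..1} g \<le> riccati_time q lam M" if "M \<ge> 1" for M
  proof -
    have "integral {-1..1} g \<le> integral {-M..M} g"
      using that gpos by (intro integral_subset_le integrable_continuous_real cg) (auto simp: less_imp_le)
    also have "\<dots> = riccati_time q lam M - riccati_time q lam' M"
      unfolding g_def riccati_time_def using assms
      by (intro Henstock_Kurzweil_Integration.integral_diff integrable_continuous_real continuous_on_inverse_riccati_rhs) auto
    finally show ?thesis by simp
  qed
  show ?thesis by (rule that[OF 1 2])
qed

text \<open>On the scale \<open>M = r ^ (2q - 1)\<close> and \<open>lam = r ^ (2q)\<close> the right-hand side is at most \<open>2q * lam\<close>,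
  so the time is at least \<open>1 / (q * r)\<close>, which is \<open>L\<close> for the chosen \<open>r\<close>.\<close>

lemma riccati_time_unbounded:
  assumes "q \<ge> 1" "L > 0"
  shows "\<exists>lam>0. \<exists>M>0. L \<le> riccati_time q lam M"
proof -
  define r where "r = 1 / (real q * L)"
  define M where "M = r ^ (2*q-1)"
  define lam where "lam = r ^ (2*q)"
  have r: "r > 0" using assms by (simp add: r_def)
  have pos: "lam > 0" "M > 0" using r by (auto simp: lam_def M_def)
  have rtM: "root (2*q-1) M = r" using r assms by (simp add: M_def real_root_power_cancel)
  have le: "1 / riccati_rhs q lam s \<ge> 1 / (real (2*q) * lam)" if "s \<in> {-M..M}" for s
  proof -
    have "\<bar>root (2*q-1) s\<bar> = root (2*q-1) \<bar>s\<bar>" using assms by (simp add: real_root_abs)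
    also have "\<dots> \<le> root (2*q-1) M" using that assms by (intro real_root_le_mono) auto
    finally have "\<bar>root (2*q-1) s\<bar> ^ (2*q) \<le> r ^ (2*q)" unfolding rtM by (intro power_mono) auto
    then have "root (2*q-1) s ^ (2*q) \<le> lam" by (simp add: lam_def power_even_abs)
    then have "riccati_rhs q lam s \<le> lam + real (2*q-1) * lam"
      unfolding riccati_rhs_def by (intro add_left_mono mult_left_mono) auto
    also have "\<dots> = real (2*q) * lam" using assms by (simp add: of_nat_diff algebra_simps)
    finally show ?thesis using riccati_rhs_pos[OF pos(1), of q s] pos assms
      by (intro divide_left_mono) auto
  qed
  have "L = 2 * M * (1 / (real (2*q) * lam))"
  proof -
    have "lam = r * M" unfolding lam_def M_def using assms by (simp flip: power_Suc)
    then have "2 * M * (1 / (real (2*q) * lam)) = 1 / (real q * r)" using pos by simp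
    also have "\<dots> = L" using assms by (simp add: r_def)
    finally show ?thesis by simp
  qed
  also have "\<dots> = integral {-M..M} (\<lambda>s. 1 / (real (2*q) * lam))" using pos by simp
  also have "\<dots> \<le> riccati_time q lam M"
    unfolding riccati_time_def using le pos
    by (intro integral_le integrable_continuous_real continuous_on_inverse_riccati_rhs continuous_on_const) auto
  finally show ?thesis using pos by blast
qed

section \<open>Trial functions of negative energy\<close>

text \<open>With \<open>t\<close> the odd root of \<open>F x\<close>, the integrand is Young's form in \<open>z\<close> and \<open>- t y\<close>. The Riccati equation
  is the condition that its minimum over \<open>z\<close> is zero.\<close>

lemma ansatz_integrand_nonneg:
  assumes "q \<ge> 1" "(F has_real_derivative riccati_rhs q lam (F x)) (at x)"
  shows "f_int q x y z lam + total_D (ansatz q F) x y z \<ge> 0"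
proof -
  define t where "t = root (2*q-1) (F x)"
  have t: "t ^ (2*q-1) = F x" unfolding t_def using assms by (intro odd_real_root_pow) auto
  have "f_int q x y z lam + total_D (ansatz q F) x y z
     = z ^ (2*q) + real (2*q-1) * (- (t * y)) ^ (2*q) - real (2*q) * (- (t * y)) ^ (2*q-1) * z"
    unfolding f_int_def total_D_ansatz[OF assms(2)] riccati_rhs_def t_def[symmetric]
    using assms(1) by (simp add: power_mult_distrib flip: t) (simp add: algebra_simps)
  then show ?thesis using amgm_even_nonneg[OF assms(1), of z "- (t * y)"] by simp
qed

lemma W1_0_I:
  assumes "primitive_on a b u v" "a < b" "u a = 0" "u b = 0"
    and "set_integrable lborel {a..b} (\<lambda>x. \<bar>v x\<bar> ^ p)"
  shows "u \<in> W1_0 p a b"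
proof -
  have cu: "continuous_on {a..b} u" by (rule primitive_on_continuous[OF assms(1)])
  have "set_integrable lborel {a<..<b} u" "set_integrable lborel {a<..<b} v"
    unfolding set_integral_open_closed(2)
    by (rule borel_integrable_atLeastAtMost'[OF cu], rule primitive_on_integrable[OF assms(1)])
  moreover have "set_integrable lborel {a<..<b} (\<lambda>x. \<bar>u x\<bar> ^ p)"
    unfolding set_integral_open_closed(2)
    by (intro borel_integrable_atLeastAtMost' continuous_intros cu)
  moreover have "set_integrable lborel {a<..<b} (\<lambda>x. \<bar>v x\<bar> ^ p)"
    unfolding set_integral_open_closed(2) by (rule assms(5))
  ultimately have "in_Lp p a b u" "in_Lp p a b v"
    by (auto simp: in_Lp_def set_integrable_def set_borel_measurable_def)
  then show ?thesis
    using cu primitive_on_weak_deriv[OF assms(1,2)] assms(3,4) unfolding W1_0_def W1_def by blast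
qed

text \<open>The energy does not see the choice of the weak derivative.\<close>

lemma energy_wderiv:
  assumes u: "primitive_on a b u v" and "a < b"
  shows "(LINT x:{a<..<b}|lborel. \<bar>wderiv a b u x\<bar> ^ (2*q) - lam * u x ^ (2*q))
       = (LINT x:{a..b}|lborel. v x ^ (2*q) - lam * u x ^ (2*q))"
proof -
  have eq: "indicat_real {a..b} x *\<^sub>R (g x ^ (2*q) - lam * u x ^ (2*q))
      = indicat_real {a..b} x * ((indicat_real {a..b} x *\<^sub>R g x) ^ (2*q) - lam * (indicat_real {a..b} x *\<^sub>R u x) ^ (2*q))"
    for g :: "real \<Rightarrow> real" and x by (simp add: indicator_def)
  have m: "(\<lambda>x. indicat_real {a..b} x *\<^sub>R (g x ^ (2*q) - lam * u x ^ (2*q))) \<in> borel_measurable lborel"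
    if "set_integrable lborel {a..b} g" for g :: "real \<Rightarrow> real"
  proof -
    have "set_integrable lborel {a..b} u"
      by (rule borel_integrable_atLeastAtMost'[OF primitive_on_continuous[OF u]])
    then have [measurable]: "(\<lambda>x. indicat_real {a..b} x *\<^sub>R u x) \<in> borel_measurable lborel"
      "(\<lambda>x. indicat_real {a..b} x *\<^sub>R g x) \<in> borel_measurable lborel"
      using that by (auto simp: set_integrable_def)
    show ?thesis unfolding eq by measurable
  qed
  have "(LINT x:{a..b}|lborel. wderiv a b u x ^ (2*q) - lam * u x ^ (2*q))
       = (LINT x:{a..b}|lborel. v x ^ (2*q) - lam * u x ^ (2*q))"
    unfolding set_lebesgue_integral_def
  proof (rule integral_cong_AE)
    show "AE x in lborel. indicat_real {a..b} x *\<^sub>R (wderiv a b u x ^ (2*q) - lam * u x ^ (2*q))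
        = indicat_real {a..b} x *\<^sub>R (v x ^ (2*q) - lam * u x ^ (2*q))"
      using wderiv_AE_eq(1)[OF assms] AE_lborel_singleton[of a] AE_lborel_singleton[of b]
      by eventually_elim (auto simp: indicator_def)
  qed (intro m primitive_on_integrable[OF u] primitive_on_integrable[OF primitive_on_wderiv[OF assms]])+
  then show ?thesis by (simp add: set_integral_open_closed(1) power_even_abs)
qed

text \<open>Picone's substitution \<open>u' / u = - t\<close>, with \<open>t\<close> the odd root of a Riccati solution \<open>F\<close>, makes the
  integrand the derivative of \<open>- F u\<^sup>2\<^sup>q\<close>, so on \<open>[c, d]\<close> the energy is
  \<open>- M (u(c)\<^sup>2\<^sup>q + u(d)\<^sup>2\<^sup>q)\<close>. The slope at \<open>c\<close> and \<open>d\<close> is \<open>\<plusminus> r\<close> times the value, and a linear piece of length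
  \<open>1 / r\<close> that leads from there to zero costs at most the same amount. The right piece is longer than
  \<open>1 / r\<close>, which makes the total negative.\<close>

lemma negative_trial_function:
  assumes q: "q \<ge> 1" and "lam > 0" "r > 0" and room: "riccati_time q lam (r ^ (2*q-1)) + 2 / r < b - a"
  shows "\<exists>u\<in>W1_0 (2*q) a b. (LINT x:{a<..<b}|lborel. \<bar>wderiv a b u x\<bar> ^ (2*q) - lam * u x ^ (2*q)) < 0"
proof -
  define k where "k = 2*q-1"
  define M where "M = r ^ k"
  have k: "2*q = Suc k" "odd k" "k > 0" using q by (auto simp: k_def)
  have rtM: "root k M = r" "root k (-M) = - r"
    using k \<open>r > 0\<close> by (auto simp: M_def real_root_minus real_root_power_cancel)
  have "M > 0" using \<open>r > 0\<close> by (simp add: M_def)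
  define c where "c = a + 1 / r"
  obtain F where F: "\<And>x. x \<in> {c..c + riccati_time q lam M} \<Longrightarrow>
      (F has_real_derivative riccati_rhs q lam (F x)) (at x)"
    and Fc: "F c = - M" "F (c + riccati_time q lam M) = M" and "riccati_time q lam M > 0"
    using riccati_solution[OF \<open>lam > 0\<close> \<open>M > 0\<close>, of c q] by blast
  define d where "d = c + riccati_time q lam M"
  define l where "l = b - d"
  have Fd: "(F has_real_derivative riccati_rhs q lam (F x)) (at x)" if "x \<in> {c..d}" for x
    using F that by (simp add: d_def)
  have ord: "a < c" "c < d" "d < b" and l: "1 / r < l"
    using \<open>r > 0\<close> \<open>riccati_time q lam M > 0\<close> room by (auto simp: c_def d_def l_def M_def k_def field_simps)
  have "a < b" using ord by simp
  have "l > 0" using ord by (simp add: l_def)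
  \<comment> \<open>\<open>F\<close> is controlled on \<open>[c, d]\<close> only, hence the projection onto that interval\<close>
  define t where "t x = root k (F (max c (min d x)))" for x
  have tc: "continuous_on UNIV t"
  proof -
    have cF: "continuous_on {c..d} F" using Fd by (meson DERIV_isCont continuous_at_imp_continuous_on)
    have "continuous_on UNIV (\<lambda>x. max c (min d x))" by (intro continuous_intros)
    then have "continuous_on UNIV (\<lambda>x. F (max c (min d x)))"
      by (rule continuous_on_compose2[OF cF]) (use ord in auto)
    then show ?thesis unfolding t_def by (rule continuous_on_real_root)
  qed
  obtain P where P: "\<And>x. (P has_real_derivative t x) (at x)"
    using continuous_has_antiderivative[OF tc] by blast
  define U where "U x = exp (- P x)" for x
  have U: "(U has_real_derivative - (t x * U x)) (at x)" for x
    unfolding U_def by (auto intro!: derivative_eq_intros P)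
  have Uc: "continuous_on A U" for A using U by (meson DERIV_isCont continuous_at_imp_continuous_on)
  have Upos: "U x > 0" for x by (simp add: U_def)
  define u where "u x = (if x < c then U c * r * (x - a) else if x \<le> d then U x else U d / l * (b - x))" for x
  define v where "v x = (if x < c then U c * r else if x \<le> d then - (t x * U x) else - (U d / l))" for x
  have u1: "u x = U c * r * (x - a)" if "x \<in> {a..c}" for x
  proof (cases "x = c")
    case True
    have "r * (c - a) = 1" using \<open>r > 0\<close> by (simp add: c_def)
    then show ?thesis using True ord by (simp add: u_def mult.assoc)
  qed (use that in \<open>simp add: u_def\<close>)
  have u2: "u x = U x" if "x \<in> {c..d}" for x using that by (simp add: u_def)
  have u3: "u x = U d / l * (b - x)" if "x \<in> {d..b}" for x
    using that \<open>l > 0\<close> ord by (cases "x = d") (auto simp: u_def l_def)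
  have cu: "continuous_on {a..b} u"
  proof -
    have "continuous_on {a..c} (\<lambda>x. U c * r * (x - a))" by (intro continuous_intros)
    then have c1: "continuous_on {a..c} u" by (rule continuous_on_eq) (rule u1[symmetric])
    have c2: "continuous_on {c..d} u" by (rule continuous_on_eq[OF Uc]) (rule u2[symmetric])
    have "continuous_on {d..b} (\<lambda>x. U d / l * (b - x))" by (intro continuous_intros)
    then have c3: "continuous_on {d..b} u" by (rule continuous_on_eq) (rule u3[symmetric])
    from c1 c2 c3 have "continuous_on ({a..c} \<union> {c..d} \<union> {d..b}) u"
      by (intro continuous_on_closed_Un) auto
    moreover have "{a..c} \<union> {c..d} \<union> {d..b} = {a..b}" using ord by auto
    ultimately show ?thesis by simp
  qed
  have du: "(u has_real_derivative v x) (at x)" if x: "x \<in> {a<..<b} - {c, d}" for x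
  proof -
    consider "x < c" | "c < x" "x < d" | "d < x" using x by fastforce
    then show ?thesis
    proof cases
      case 1
      have "((\<lambda>x. U c * r * (x - a)) has_real_derivative v x) (at x)"
        using 1 by (auto intro!: derivative_eq_intros simp: v_def)
      then show ?thesis
        by (rule has_field_derivative_transform_within_open[where S="{..<c}"]) (use 1 in \<open>auto simp: u_def\<close>)
    next
      case 2
      have "(U has_real_derivative v x) (at x)" using U[of x] 2 by (simp add: v_def)
      then show ?thesis
        by (rule has_field_derivative_transform_within_open[where S="{c<..<d}"]) (use 2 in \<open>auto simp: u_def\<close>)
    next
      case 3
      have "((\<lambda>x. U d / l * (b - x)) has_real_derivative v x) (at x)"
        using 3 ord \<open>l > 0\<close> by (auto intro!: derivative_eq_intros simp: v_def)
      then show ?thesis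
        by (rule has_field_derivative_transform_within_open[where S="{d<..}"]) (use 3 ord in \<open>auto simp: u_def\<close>)
    qed
  qed
  have ctU: "continuous_on A (\<lambda>x. - (t x * U x))" for A
    by (intro continuous_intros continuous_on_subset[OF tc] Uc) auto
  note ord' = less_imp_le[OF ord(1)] less_imp_le[OF ord(2)] less_imp_le[OF ord(3)]
  have iv: "set_integrable lborel {a..b} v"
    by (rule set_integral_three_pieces(1)[OF ord' continuous_on_const ctU continuous_on_const])
       (use ord in \<open>auto simp: v_def\<close>)
  have prim: "primitive_on a b u v"
    by (rule primitive_on_piecewise[where S = "{c, d}", OF _ cu iv du]) auto
  have ivn: "set_integrable lborel {a..b} (\<lambda>x. \<bar>v x\<bar> ^ (2*q))"
    by (rule set_integral_three_pieces(1)[OF ord', of "\<lambda>x. \<bar>U c * r\<bar> ^ (2*q)" "\<lambda>x. \<bar>- (t x * U x)\<bar> ^ (2*q)" "\<lambda>x. \<bar>- (U d / l)\<bar> ^ (2*q)"])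
       (use ord in \<open>auto simp: v_def intro!: continuous_intros continuous_on_subset[OF tc] Uc\<close>)
  have mem: "u \<in> W1_0 (2*q) a b"
    by (rule W1_0_I[OF prim \<open>a < b\<close> _ _ ivn]) (use ord in \<open>auto simp: u_def\<close>)
  let ?E1 = "\<lambda>x. (U c * r) ^ (2*q) - lam * (U c * r * (x - a)) ^ (2*q)"
  let ?E2 = "\<lambda>x. (- (t x * U x)) ^ (2*q) - lam * U x ^ (2*q)"
  let ?E3 = "\<lambda>x. (- (U d / l)) ^ (2*q) - lam * (U d / l * (b - x)) ^ (2*q)"
  have tcd: "continuous_on {c..d} t" by (rule continuous_on_subset[OF tc]) simp
  have "continuous_on {a..c} ?E1" by (intro continuous_intros)
  moreover have "continuous_on {c..d} ?E2" by (intro continuous_intros tcd Uc)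
  moreover have "continuous_on {d..b} ?E3" by (intro continuous_intros) (use \<open>l > 0\<close> in auto)
  ultimately have cE: "continuous_on {a..c} ?E1" "continuous_on {c..d} ?E2" "continuous_on {d..b} ?E3"
    by blast+
  have E: "(LINT x:{a..b}|lborel. v x ^ (2*q) - lam * u x ^ (2*q))
     = (LINT x:{a..c}|lborel. ?E1 x) + (LINT x:{c..d}|lborel. ?E2 x) + (LINT x:{d..b}|lborel. ?E3 x)"
    by (rule set_integral_three_pieces(2)[OF ord' cE]) (use ord in \<open>auto simp: u_def v_def\<close>)
  have even_nonneg: "lam * y ^ (2*q) \<ge> 0" for y :: real
    using \<open>lam > 0\<close> by (simp add: power_mult)
  have I1: "(LINT x:{a..c}|lborel. ?E1 x) \<le> M * U c ^ (2*q)"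
  proof -
    have "(LINT x:{a..c}|lborel. ?E1 x) \<le> (LINT x:{a..c}|lborel. (U c * r) ^ (2*q))"
      by (intro set_integral_mono borel_integrable_atLeastAtMost' cE continuous_on_const)
         (use even_nonneg in auto)
    also have "\<dots> = (1 / r) * (U c * r) ^ (2*q)"
      using ord by (subst LINT_const_Icc) (auto simp: c_def)
    also have "\<dots> = M * U c ^ (2*q)"
      using \<open>r > 0\<close> by (simp add: k M_def power_mult_distrib)
    finally show ?thesis .
  qed
  have I3: "(LINT x:{d..b}|lborel. ?E3 x) < M * U d ^ (2*q)"
  proof -
    have "(LINT x:{d..b}|lborel. ?E3 x) \<le> (LINT x:{d..b}|lborel. (- (U d / l)) ^ (2*q))"
      by (intro set_integral_mono borel_integrable_atLeastAtMost' cE continuous_on_const)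
         (use even_nonneg in auto)
    also have "\<dots> = l * (- (U d / l)) ^ (2*q)"
      using ord by (subst LINT_const_Icc) (auto simp: l_def)
    also have "\<dots> = U d ^ (2*q) / l ^ k"
    proof -
      have "(- (U d / l)) ^ (2*q) = (U d / l) ^ (2*q)" by simp
      then show ?thesis using \<open>l > 0\<close> by (simp add: k power_divide)
    qed
    also have "\<dots> < M * U d ^ (2*q)"
    proof -
      have "1 < r * l" using l \<open>r > 0\<close> by (simp add: field_simps)
      then have "1 < (r * l) ^ k" using k by (intro one_less_power) auto
      then have "1 < M * l ^ k" by (simp add: M_def power_mult_distrib)
      then have "1 * U d ^ (2*q) < (M * l ^ k) * U d ^ (2*q)" using Upos[of d] by (intro mult_strict_right_mono) auto
      then show ?thesis using \<open>l > 0\<close> by (simp add: pos_divide_less_eq algebra_simps)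
    qed
    finally show ?thesis .
  qed
  have I2: "(LINT x:{c..d}|lborel. ?E2 x) = - (M * U d ^ (2*q)) - M * U c ^ (2*q)"
  proof -
    have der: "((\<lambda>x. - (F x * U x ^ (2*q))) has_real_derivative ?E2 x) (at x)" if x: "x \<in> {c..d}" for x
    proof -
      have tF: "t x = root k (F x)" "t x ^ k = F x"
        using x k by (auto simp: t_def max_def min_def intro!: odd_real_root_pow)
      have "((\<lambda>x. - (F x * U x ^ Suc k)) has_real_derivative
          - (riccati_rhs q lam (F x) * U x ^ Suc k + real (Suc k) * U x ^ k * (- (t x * U x)) * F x)) (at x)"
        by (rule derivative_eq_intros Fd[OF x] U refl)+ (simp add: algebra_simps)
      moreover have "- (riccati_rhs q lam (F x) * U x ^ Suc k + real (Suc k) * U x ^ k * (- (t x * U x)) * F x) = ?E2 x"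
      proof -
        have "riccati_rhs q lam (F x) = lam + real k * (t x * F x)"
        proof -
          have "riccati_rhs q lam (F x) = lam + real k * t x ^ Suc k"
            unfolding riccati_rhs_def tF(1) k_def[symmetric] k(1) by simp
          then show ?thesis by (simp add: tF(2))
        qed
        moreover have "(- (t x * U x)) ^ (2*q) = (t x * F x) * U x ^ Suc k"
        proof -
          have "(- (t x * U x)) ^ (2*q) = (t x * U x) ^ (2*q)" by simp
          then show ?thesis unfolding k(1) by (simp add: power_mult_distrib tF(2))
        qed
        ultimately show ?thesis unfolding k(1) by (simp add: algebra_simps)
      qed
      ultimately show ?thesis unfolding k(1) by simp
    qed
    have "primitive_on c d (\<lambda>x. - (F x * U x ^ (2*q))) ?E2"
      by (rule primitive_on_C1[OF cE(2) der])
    from primitive_on_diff[OF this, of c d] ord show ?thesis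
      using Fc by (simp add: d_def[symmetric])
  qed
  have "(LINT x:{a..b}|lborel. v x ^ (2*q) - lam * u x ^ (2*q)) < 0"
    unfolding E using I1 I2 I3 by linarith
  then have "(LINT x:{a<..<b}|lborel. \<bar>wderiv a b u x\<bar> ^ (2*q) - lam * u x ^ (2*q)) < 0"
    by (simp only: energy_wderiv[OF prim \<open>a < b\<close>])
  then show ?thesis using mem by (rule bexI)
qed

definition rayleigh_nonneg :: "nat \<Rightarrow> real \<Rightarrow> real \<Rightarrow> real \<Rightarrow> bool" where
  "rayleigh_nonneg q a b lam \<longleftrightarrow> (\<forall>u\<in>W1_0 (2*q) a b.
     (LINT x:{a<..<b}|lborel. \<bar>wderiv a b u x\<bar> ^ (2*q) - lam * u x ^ (2*q)) \<ge> 0)"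

lemma lambda_star_eq: "lambda_star q a b = Sup {ereal lam | lam. rayleigh_nonneg q a b lam}"
  unfolding lambda_star_def rayleigh_nonneg_def
  by (simp add: le_INF_iff flip: zero_ereal_def)

text \<open>The solution from \<open>- M\<close> to \<open>M\<close> exists for at least the length of the interval. The set of
  these \<open>lam\<close> has supremum \<open>lambda_star q a b\<close>.\<close>

definition riccati_solvable :: "nat \<Rightarrow> real \<Rightarrow> real \<Rightarrow> real \<Rightarrow> bool" where
  "riccati_solvable q a b lam \<longleftrightarrow> lam > 0 \<and> (\<exists>M>0. b - a \<le> riccati_time q lam M)"

lemma riccati_solvableD:
  assumes "riccati_solvable q a b lam"
  obtains F where "\<And>x. x \<in> {a..b} \<Longrightarrow> (F has_real_derivative riccati_rhs q lam (F x)) (at x)"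
    "continuous_on {a..b} F" "continuous_on {a..b} (\<lambda>x. riccati_rhs q lam (F x))"
proof -
  obtain M where M: "lam > 0" "M > 0" "b - a \<le> riccati_time q lam M"
    using assms unfolding riccati_solvable_def by blast
  obtain F where "\<And>x. x \<in> {a..a + riccati_time q lam M} \<Longrightarrow>
      (F has_real_derivative riccati_rhs q lam (F x)) (at x)"
    using riccati_solution[OF M(1,2), of a q] by blast
  then have F: "(F has_real_derivative riccati_rhs q lam (F x)) (at x)" if "x \<in> {a..b}" for x
    using that M(3) by auto
  then have "continuous_on {a..b} F" by (meson DERIV_isCont continuous_at_imp_continuous_on)
  with F show ?thesis by (intro that) (auto intro: continuous_intros)
qed

text \<open>If the Riccati time for \<open>lam\<close> stayed below \<open>b - a\<close>, the uniform gain in time for the larger \<open>lam'\<close>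
  would make room for a trial function of negative energy.\<close>

lemma riccati_solvable_below:
  assumes "q \<ge> 1" and nn: "rayleigh_nonneg q a b lam'" and "0 < lam" "lam < lam'"
  shows "riccati_solvable q a b lam"
proof (rule ccontr)
  assume "\<not> riccati_solvable q a b lam"
  then have no: "riccati_time q lam M < b - a" if "M > 0" for M
    using that \<open>0 < lam\<close> unfolding riccati_solvable_def by (metis not_le)
  obtain \<delta> where \<delta>: "\<delta> > 0" "\<And>M. M \<ge> 1 \<Longrightarrow> riccati_time q lam' M + \<delta> \<le> riccati_time q lam M"
    using riccati_time_decrease[OF assms(3,4), of q] by blast
  \<comment> \<open>then the two linear pieces, of length \<open>1 / r\<close> each, fit into the gain \<open>\<delta>\<close>\<close>
  define r where "r = max 1 (2 / \<delta>)"
  have r: "r \<ge> 1" "2 / r \<le> \<delta>" using \<delta>(1) by (auto simp: r_def field_simps max_def)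
  have "r ^ (2*q-1) \<ge> 1" using r by (intro one_le_power)
  then have room: "riccati_time q lam' (r ^ (2*q-1)) + 2 / r < b - a"
    using \<delta>(2)[of "r ^ (2*q-1)"] no[of "r ^ (2*q-1)"] r by linarith
  have "lam' > 0" "r > 0" using assms(3,4) r(1) by auto
  from negative_trial_function[OF assms(1) this room]
  obtain u where "u \<in> W1_0 (2*q) a b"
    "(LINT x:{a<..<b}|lborel. \<bar>wderiv a b u x\<bar> ^ (2*q) - lam' * u x ^ (2*q)) < 0"
    by (rule bexE)
  then show False using nn unfolding rayleigh_nonneg_def by fastforce
qed

section \<open>Weak duality and exactness\<close>

text \<open>Integrating the pointwise inequality along \<open>x \<mapsto> (x, u(x), u'(x))\<close>. If the energy density is
  not integrable, its integral is zero by convention and the bound is trivial.\<close>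

lemma duality_bound:
  assumes u: "u \<in> W1_0 (2*q) a b" and chain: "chain_rule_integral a b \<phi> u c"
    and h: "continuous_on {a..b} h"
    and pt: "\<And>x y z. x \<in> {a<..<b} \<Longrightarrow> f_int q x y z lam + total_D \<phi> x y z - h x \<ge> 0"
    and c: "c \<le> (LINT x:{a<..<b}|lborel. h x)"
  shows "(LINT x:{a<..<b}|lborel. \<bar>wderiv a b u x\<bar> ^ (2*q) - lam * u x ^ (2*q)) \<ge> 0"
proof (cases "set_integrable lborel {a<..<b} (\<lambda>x. \<bar>wderiv a b u x\<bar> ^ (2*q) - lam * u x ^ (2*q))")
  case True
  let ?f = "\<lambda>x. \<bar>wderiv a b u x\<bar> ^ (2*q) - lam * u x ^ (2*q)"
  let ?D = "\<lambda>x. total_D \<phi> x (u x) (wderiv a b u x)"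
  have iD: "set_integrable lborel {a<..<b} ?D" and D: "(LINT x:{a<..<b}|lborel. ?D x) = c"
    using chain by (auto simp: chain_rule_integral_def)
  have ih: "set_integrable lborel {a<..<b} h"
    unfolding set_integral_open_closed(2) by (rule borel_integrable_atLeastAtMost'[OF h])
  have "(LINT x:{a<..<b}|lborel. h x - ?D x) \<le> (LINT x:{a<..<b}|lborel. ?f x)"
  proof (rule set_integral_mono[OF set_integral_diff(1)[OF ih iD] True])
    fix x assume "x \<in> {a<..<b}"
    from pt[OF this, of "u x" "wderiv a b u x"] show "h x - ?D x \<le> ?f x"
      by (simp add: f_int_def power_even_abs)
  qed
  then show ?thesis using set_integral_diff(2)[OF ih iD] D c by simp
next
  case False
  then have "(LINT x:{a<..<b}|lborel. \<bar>wderiv a b u x\<bar> ^ (2*q) - lam * u x ^ (2*q)) = 0"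
    unfolding set_integrable_def set_lebesgue_integral_def by (rule not_integrable_integral_eq)
  then show ?thesis by simp
qed

lemma pdr_hat_weak_duality:
  assumes "pdr_hat_feasible q a b lam \<phi> h"
  shows "rayleigh_nonneg q a b lam"
  unfolding rayleigh_nonneg_def
proof
  fix u assume u: "u \<in> W1_0 (2*q) a b"
  have \<phi>: "\<phi> \<in> Phi_hat q a b" and h: "continuous_on {a..b} h"
    and pt: "\<And>x y z. x \<in> {a<..<b} \<Longrightarrow> f_int q x y z lam + total_D \<phi> x y z - h x \<ge> 0"
    and c: "0 \<le> (LINT x:{a<..<b}|lborel. h x)"
    using assms unfolding pdr_hat_feasible_def by blast+
  have "chain_rule_integral a b \<phi> u 0" using \<phi> u unfolding Phi_hat_def by blast
  then show "0 \<le> (LINT x:{a<..<b}|lborel. \<bar>wderiv a b u x\<bar> ^ (2*q) - lam * u x ^ (2*q))"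
    by (rule duality_bound[OF u _ h pt c])
qed

lemma pdr_weak_duality:
  assumes "pdr_feasible q a b s dO lam \<phi> h l" "boundary_pieces a b s dO"
  shows "rayleigh_nonneg q a b lam"
  unfolding rayleigh_nonneg_def
proof
  fix u assume u: "u \<in> W1_0 (2*q) a b"
  have \<phi>: "\<phi> \<in> Phi q a b s dO" and h: "continuous_on {a..b} h"
    and pt: "\<And>x y z. x \<in> {a<..<b} \<Longrightarrow> f_int q x y z lam + total_D \<phi> x y z - h x \<ge> 0"
    and l: "\<And>i x. i < s \<Longrightarrow> x \<in> dO i \<Longrightarrow> - \<phi> x 0 * outward_normal a b x - l i x \<ge> 0"
    and c: "0 \<le> (LINT x:{a<..<b}|lborel. h x) + (\<Sum>i<s. \<Sum>x\<in>dO i. l i x)"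
    using assms(1) unfolding pdr_feasible_def by blast+
  have "u \<in> W1 (2*q) a b" and u0: "u a = 0" "u b = 0" using u by (auto simp: W1_0_def)
  then have chain: "chain_rule_integral a b \<phi> u (\<Sum>i<s. \<Sum>x\<in>dO i. \<phi> x (u x) * outward_normal a b x)"
    using \<phi> unfolding Phi_def by blast
  have "\<phi> x (u x) * outward_normal a b x \<le> - l i x" if "i < s" "x \<in> dO i" for i x
  proof -
    have "x \<in> {a, b}" using assms(2) that unfolding boundary_pieces_def by blast
    then have "u x = 0" using u0 by auto
    then show ?thesis using l[OF that] by simp
  qed
  then have "(\<Sum>i<s. \<Sum>x\<in>dO i. \<phi> x (u x) * outward_normal a b x) \<le> (\<Sum>i<s. \<Sum>x\<in>dO i. - l i x)"
    by (intro sum_mono) auto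
  also have "\<dots> \<le> (LINT x:{a<..<b}|lborel. h x)" using c by (simp add: sum_negf)
  finally show "0 \<le> (LINT x:{a<..<b}|lborel. \<bar>wderiv a b u x\<bar> ^ (2*q) - lam * u x ^ (2*q))"
    by (intro duality_bound[OF u chain h]) (rule pt)
qed

lemma riccati_solvable_feasible:
  assumes "riccati_solvable q a b lam" "q \<ge> 1" "a < b"
  shows "\<exists>F. continuous_on {a..b} F \<and> pdr_hat_feasible q a b lam (ansatz q F) (\<lambda>x. 0) \<and>
    (\<forall>s dO. boundary_pieces a b s dO \<longrightarrow>
       pdr_feasible q a b s dO lam (ansatz q F) (\<lambda>x. 0) (\<lambda>i x. 0))"
proof -
  obtain F where F: "\<And>x. x \<in> {a..b} \<Longrightarrow> (F has_real_derivative riccati_rhs q lam (F x)) (at x)"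
    "continuous_on {a..b} F" "continuous_on {a..b} (\<lambda>x. riccati_rhs q lam (F x))"
    using riccati_solvableD[OF assms(1)] by blast
  have Phi: "ansatz q F \<in> Phi q a b s dO" if "boundary_pieces a b s dO" for s dO
    by (rule ansatz_Phi(1)[OF _ F(3) assms(2,3) that]) (rule F(1))
  have Phi_hat: "ansatz q F \<in> Phi_hat q a b"
    by (rule ansatz_Phi(2)[OF _ F(3) assms(2,3)]) (rule F(1))
  have pt: "f_int q x y z lam + total_D (ansatz q F) x y z - 0 \<ge> 0" if "x \<in> {a<..<b}" for x y z
    using ansatz_integrand_nonneg[OF assms(2) F(1), of x y z] that by simp
  have zero: "ansatz q F x 0 = 0" for x using assms(2) by (simp add: ansatz_def)
  show ?thesis
  proof (intro exI[of _ F] conjI allI impI F(2))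
    show "pdr_hat_feasible q a b lam (ansatz q F) (\<lambda>x. 0)"
      unfolding pdr_hat_feasible_def using Phi_hat pt by simp
    show "pdr_feasible q a b s dO lam (ansatz q F) (\<lambda>x. 0) (\<lambda>i x. 0)" if "boundary_pieces a b s dO" for s dO
      unfolding pdr_feasible_def using Phi[OF that] pt by (simp add: zero)
  qed
qed

text \<open>Every \<open>lam'\<close> with nonnegative energy is approached from below by solvable values. Nonpositive \<open>y\<close> are
  covered because solvable values are positive and exist.\<close>

lemma below_lambda_star:
  assumes "q \<ge> 1" "a < b" "y < lambda_star q a b"
  obtains lam where "riccati_solvable q a b lam" "y < ereal lam"
proof -
  obtain lam' where lam': "rayleigh_nonneg q a b lam'" "y < ereal lam'"
    using assms(3) unfolding lambda_star_eq less_Sup_iff by blast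
  obtain \<mu> where \<mu>: "y < ereal \<mu>" "\<mu> < lam'" using ereal_dense2[OF lam'(2)] by auto
  show ?thesis
  proof (cases "\<mu> > 0")
    case True
    then show ?thesis using riccati_solvable_below[OF assms(1) lam'(1) True \<mu>(2)] \<mu>(1) that by blast
  next
    case False
    obtain lam where lam: "riccati_solvable q a b lam"
      using riccati_time_unbounded[OF assms(1), of "b - a"] assms(2) unfolding riccati_solvable_def by auto
    then have "\<mu> < lam" using False by (simp add: riccati_solvable_def)
    then have "ereal \<mu> < ereal lam" by simp
    with \<mu>(1) lam that show ?thesis by (meson less_trans)
  qed
qed

lemma lambda_star_riccati:
  assumes "q \<ge> 1" "a < b"
  shows "lambda_star q a b = Sup {ereal lam | lam. riccati_solvable q a b lam}"
proof (rule antisym)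
  show "lambda_star q a b \<le> Sup {ereal lam | lam. riccati_solvable q a b lam}"
  proof (rule dense_le)
    fix y assume "y < lambda_star q a b"
    then obtain lam where "riccati_solvable q a b lam" "y < ereal lam"
      using below_lambda_star[OF assms] by blast
    then show "y \<le> Sup {ereal lam | lam. riccati_solvable q a b lam}"
      by (intro Sup_upper2[of "ereal lam"]) auto
  qed
  show "Sup {ereal lam | lam. riccati_solvable q a b lam} \<le> lambda_star q a b"
    unfolding lambda_star_eq
  proof (rule Sup_subset_mono, safe)
    fix lam assume sol: "riccati_solvable q a b lam"
    obtain F where "pdr_hat_feasible q a b lam (ansatz q F) (\<lambda>x. 0)"
      using riccati_solvable_feasible[OF sol assms] by blast
    then show "\<exists>lam'. ereal lam = ereal lam' \<and> rayleigh_nonneg q a b lam'"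
      using pdr_hat_weak_duality by blast
  qed
qed

lemma relaxations_exact:
  assumes q: "q \<ge> 1" and "a < b" and bp: "boundary_pieces a b s dO"
  shows "B_pdr_hat q a b = lambda_star q a b" and "B_pdr q a b s dO = lambda_star q a b"
proof -
  have riccati: "\<exists>F. pdr_hat_feasible q a b lam (ansatz q F) (\<lambda>x. 0) \<and>
      pdr_feasible q a b s dO lam (ansatz q F) (\<lambda>x. 0) (\<lambda>i x. 0)" if "riccati_solvable q a b lam" for lam
    using riccati_solvable_feasible[OF that q \<open>a < b\<close>] bp by blast
  show "B_pdr_hat q a b = lambda_star q a b"
  proof (rule antisym)
    show "B_pdr_hat q a b \<le> lambda_star q a b"
      unfolding B_pdr_hat_def lambda_star_eq by (rule Sup_subset_mono) (use pdr_hat_weak_duality in blast)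
    show "lambda_star q a b \<le> B_pdr_hat q a b"
      unfolding B_pdr_hat_def lambda_star_riccati[OF q \<open>a < b\<close>] by (rule Sup_subset_mono) (use riccati in blast)
  qed
  show "B_pdr q a b s dO = lambda_star q a b"
  proof (rule antisym)
    show "B_pdr q a b s dO \<le> lambda_star q a b"
      unfolding B_pdr_def lambda_star_eq by (rule Sup_subset_mono) (use pdr_weak_duality[OF _ bp] in blast)
    show "lambda_star q a b \<le> B_pdr q a b s dO"
      unfolding B_pdr_def lambda_star_riccati[OF q \<open>a < b\<close>] by (rule Sup_subset_mono) (use riccati in blast)
  qed
qed

lemma maximizing_sequence:
  assumes q: "q \<ge> 1" and "a < b"
  obtains lam :: "nat \<Rightarrow> real" where "\<And>k. riccati_solvable q a b (lam k)"
    "(\<lambda>k. ereal (lam k)) \<longlonglongrightarrow> lambda_star q a b"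
proof -
  let ?A = "{ereal lam | lam. riccati_solvable q a b lam}"
  have "?A \<noteq> {}"
    using riccati_time_unbounded[OF q, of "b - a"] \<open>a < b\<close> unfolding riccati_solvable_def by auto
  then obtain f :: "nat \<Rightarrow> ereal" where f: "incseq f" "range f \<subseteq> ?A" "Sup ?A = (SUP i. f i)"
    using Sup_countable_SUP[of ?A] by blast
  then have "\<forall>k. \<exists>lam. f k = ereal lam \<and> riccati_solvable q a b lam" by blast
  then obtain lam where lam: "\<And>k. f k = ereal (lam k)" "\<And>k. riccati_solvable q a b (lam k)" by metis
  have "f \<longlonglongrightarrow> lambda_star q a b"
    unfolding lambda_star_riccati[OF assms] f(3) by (rule LIMSEQ_SUP[OF f(1)])
  moreover have "f = (\<lambda>k. ereal (lam k))" using lam(1) by auto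
  ultimately show ?thesis using lam(2) by (intro that) auto
qed

section \<open>Polynomial multipliers and certificates\<close>

lemma poly_antiderivative:
  fixes p :: "real poly"
  shows "\<exists>P. pderiv P = p"
proof (intro exI poly_eqI)
  fix n
  have "coeff (\<Sum>i\<le>degree p. monom (coeff p i / real (Suc i)) (Suc i)) (Suc n) = coeff p n / real (Suc n)"
    by (cases "n \<le> degree p") (auto simp: coeff_sum coeff_eq_0 simp del: of_nat_Suc)
  then show "coeff (pderiv (\<Sum>i\<le>degree p. monom (coeff p i / real (Suc i)) (Suc i))) n = coeff p n"
    by (simp add: coeff_pderiv del: of_nat_Suc)
qed

lemma weierstrass_poly:
  fixes f :: "real \<Rightarrow> real"
  assumes "continuous_on {a..b} f" "e > 0"
  obtains p where "\<And>x. x \<in> {a..b} \<Longrightarrow> \<bar>f x - poly p x\<bar> < e"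
proof -
  obtain g where g: "real_polynomial_function g" "\<And>x. x \<in> {a..b} \<Longrightarrow> \<bar>f x - g x\<bar> < e"
    using Stone_Weierstrass_real_polynomial_function[OF compact_Icc assms] by blast
  then obtain c n where "g = (\<lambda>x. \<Sum>i\<le>n. c i * x ^ i)" unfolding real_polynomial_function_iff_sum by blast
  then have "g x = poly (\<Sum>i\<le>n. monom (c i) i) x" for x by (simp add: poly_sum poly_monom)
  with g(2) show ?thesis by (intro that) auto
qed

text \<open>Approximating the derivative and integrating controls \<open>F\<close> and \<open>F'\<close> simultaneously.\<close>

lemma weierstrass_poly_C1:
  fixes F f :: "real \<Rightarrow> real"
  assumes "a < b" and F: "\<And>x. x \<in> {a..b} \<Longrightarrow> (F has_real_derivative f x) (at x)"
    and f: "continuous_on {a..b} f" and "e > 0"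
  shows "\<exists>P. \<forall>x\<in>{a..b}. \<bar>F x - poly P x\<bar> \<le> e * (b - a) \<and> \<bar>f x - poly (pderiv P) x\<bar> < e"
proof -
  obtain p where p: "\<And>x. x \<in> {a..b} \<Longrightarrow> \<bar>f x - poly p x\<bar> < e"
    using weierstrass_poly[OF f \<open>e > 0\<close>] by blast
  obtain P0 where P0: "pderiv P0 = p" using poly_antiderivative by blast
  define P where "P = P0 + [:F a - poly P0 a:]"
  have dP: "pderiv P = p" by (simp add: P_def pderiv_add P0 pderiv_pCons)
  have Pa: "poly P a = F a" by (simp add: P_def)
  have bound: "\<bar>F x - poly P x\<bar> \<le> e * (b - a)" if x: "x \<in> {a..b}" for x
  proof (cases "x = a")
    case True
    then show ?thesis using Pa assms by simp
  next
    case False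
    then have "a < x" using x by simp
    have d: "((\<lambda>x. F x - poly P x) has_real_derivative f y - poly p y) (at y)" if "y \<in> {a..b}" for y
      using F[OF that] poly_DERIV[of P y] by (auto intro!: derivative_eq_intros simp: dP)
    have "\<exists>y. a < y \<and> y < x \<and> (F x - poly P x) - (F a - poly P a) = (x - a) * (f y - poly p y)"
      using x \<open>a < x\<close> by (intro MVT2 d) auto
    then obtain y where y: "a < y" "y < x" "F x - poly P x = (x - a) * (f y - poly p y)"
      using Pa by auto
    have "\<bar>F x - poly P x\<bar> = (x - a) * \<bar>f y - poly p y\<bar>" using y \<open>a < x\<close> by (simp add: abs_mult)
    also have "\<dots> \<le> (b - a) * e" using x y p[of y] by (intro mult_mono) auto
    finally show ?thesis by (simp add: mult.commute)
  qed
  show ?thesis using bound p unfolding dP[symmetric] by blast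
qed

text \<open>The coefficient of \<open>y\<^sup>2\<^sup>q\<close> that is left of the integrand after the three sums of squares in
  \<open>certificate_identity\<close> have been split off. The arguments are the values of \<open>F'\<close>, of \<open>F\<close> and of an
  approximate odd root \<open>t\<close> of \<open>F\<close>, which in general is not a polynomial when \<open>F\<close> is one.\<close>

definition cert_remainder :: "nat \<Rightarrow> real \<Rightarrow> real \<Rightarrow> real \<times> real \<times> real \<Rightarrow> real" where
  "cert_remainder q lam \<epsilon> = (\<lambda>(f, F, t). f - lam - (1 - \<epsilon>) * real (2*q-1) * t ^ (2*q)
     - \<epsilon> * (real q - 1) - real q * (F - (1 - \<epsilon>) * t ^ (2*q-1))\<^sup>2 / \<epsilon>)"

text \<open>For the exact Riccati solution with parameter \<open>\<mu>\<close> and its exact root, the defect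
  \<open>F - (1 - \<epsilon>) t\<^sup>2\<^sup>q\<^sup>-\<^sup>1\<close> equals \<open>\<epsilon> F\<close>; its square divided by \<open>\<epsilon>\<close> is of order \<open>\<epsilon>\<close>, and the
  remainder is \<open>\<mu> - lam\<close> up to terms of order \<open>\<epsilon>\<close> that could lower it. Uniform continuity
  transfers positivity to polynomial approximations.\<close>

lemma cert_remainder_positive:
  assumes q: "q \<ge> 1" and "a < b" and sol: "riccati_solvable q a b \<mu>" and "lam < \<mu>"
  shows "\<exists>F T \<epsilon>. 0 < \<epsilon> \<and> \<epsilon> < 1 \<and>
    (\<forall>x\<in>{a..b}. cert_remainder q lam \<epsilon> (poly (pderiv F) x, poly F x, poly T x) > 0)"
proof -
  obtain F0 where F0: "\<And>x. x \<in> {a..b} \<Longrightarrow> (F0 has_real_derivative riccati_rhs q \<mu> (F0 x)) (at x)"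
    "continuous_on {a..b} F0" "continuous_on {a..b} (\<lambda>x. riccati_rhs q \<mu> (F0 x))"
    using riccati_solvableD[OF sol] by blast
  define t0 where "t0 x = root (2*q-1) (F0 x)" for x
  have t0: "continuous_on {a..b} t0" unfolding t0_def by (intro continuous_intros F0)
  have t0F: "t0 x ^ (2*q-1) = F0 x" for x unfolding t0_def using q by (intro odd_real_root_pow) auto
  \<comment> \<open>the compact curve along which positivity is known\<close>
  define curve where "curve x = (riccati_rhs q \<mu> (F0 x), F0 x, t0 x)" for x
  have "continuous_on {a..b} curve" unfolding curve_def by (intro continuous_intros F0 t0)
  then have "bounded (curve ` {a..b})" by (intro compact_imp_bounded compact_continuous_image compact_Icc)
  then obtain B where "\<forall>p\<in>curve ` {a..b}. norm p \<le> B" unfolding bounded_iff by blast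
  then have B: "norm (curve x) \<le> B" if "x \<in> {a..b}" for x using that by blast
  have "B \<ge> 0" using order_trans[OF norm_ge_zero B[of a]] \<open>a < b\<close> by simp
  have F0B: "(F0 x)\<^sup>2 \<le> B\<^sup>2" if "x \<in> {a..b}" for x
  proof -
    have "\<bar>F0 x\<bar> \<le> norm (F0 x, t0 x)" using norm_fst_le[of "F0 x" "t0 x"] by simp
    also have "\<dots> \<le> norm (curve x)" unfolding curve_def by (rule norm_snd_le)
    also have "\<dots> \<le> B" by (rule B[OF that])
    finally show ?thesis using \<open>B \<ge> 0\<close> by (metis abs_le_square_iff abs_of_nonneg)
  qed
  define C where "C = real q * (1 + B\<^sup>2)"
  have "C > 0" unfolding C_def using q by (intro mult_pos_pos) (auto simp: add_pos_nonneg)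
  \<comment> \<open>the terms that lower the remainder are at most \<open>\<epsilon> * C\<close>, which is at most half of the slack \<open>\<mu> - lam\<close>\<close>
  define \<epsilon> where "\<epsilon> = min (1/2) ((\<mu> - lam) / (2 * C))"
  have \<epsilon>: "\<epsilon> > 0" "\<epsilon> < 1" using \<open>C > 0\<close> \<open>lam < \<mu>\<close> by (auto simp: \<epsilon>_def)
  have "\<epsilon> \<le> (\<mu> - lam) / (2 * C)" by (simp add: \<epsilon>_def)
  then have \<epsilon>C: "\<epsilon> * C \<le> (\<mu> - lam) / 2" using \<open>C > 0\<close> by (simp add: field_simps)
  have exact: "cert_remainder q lam \<epsilon> (curve x) \<ge> (\<mu> - lam) / 2" if x: "x \<in> {a..b}" for x
  proof -
    have "F0 x - (1 - \<epsilon>) * t0 x ^ (2*q-1) = \<epsilon> * F0 x" unfolding t0F by (simp add: algebra_simps)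
    then have E: "real q * (F0 x - (1 - \<epsilon>) * t0 x ^ (2*q-1))\<^sup>2 / \<epsilon> = \<epsilon> * (real q * (F0 x)\<^sup>2)"
      using \<epsilon>(1) by (simp add: power2_eq_square)
    have "cert_remainder q lam \<epsilon> (curve x)
       = \<mu> - lam + \<epsilon> * (real (2*q-1) * t0 x ^ (2*q)) - \<epsilon> * (real q - 1) - \<epsilon> * (real q * (F0 x)\<^sup>2)"
      unfolding cert_remainder_def curve_def prod.case E riccati_rhs_def t0_def[symmetric]
      by (simp add: algebra_simps)
    moreover have "\<epsilon> * (real (2*q-1) * t0 x ^ (2*q)) \<ge> 0" using \<epsilon>(1) by (simp add: power_mult)
    moreover have "\<epsilon> * (real q * (F0 x)\<^sup>2) \<le> \<epsilon> * (real q * B\<^sup>2)"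
      using \<epsilon>(1) F0B[OF x] by (intro mult_left_mono) auto
    moreover have "\<epsilon> * C = \<epsilon> * (real q - 1) + \<epsilon> * (real q * B\<^sup>2) + \<epsilon>" by (simp add: C_def algebra_simps)
    moreover have "d / 2 \<le> k" if "k = d + A - X - Y" "A \<ge> 0" "Y \<le> Z" "W = X + Z + \<epsilon>" "W \<le> d / 2"
      for k d A X Y Z W :: real
      using that \<epsilon>(1) by linarith
    ultimately show ?thesis using \<epsilon>C by blast
  qed
  have "continuous_on (cball 0 (B + 1)) (cert_remainder q lam \<epsilon>)"
    unfolding cert_remainder_def case_prod_unfold using \<epsilon>(1) by (intro continuous_intros) auto
  then have "uniformly_continuous_on (cball 0 (B + 1)) (cert_remainder q lam \<epsilon>)"
    by (intro compact_uniformly_continuous compact_cball)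
  moreover have half: "(\<mu> - lam) / 2 > 0" using \<open>lam < \<mu>\<close> by simp
  ultimately obtain \<delta> where \<delta>: "\<delta> > 0" "\<And>p p'. p \<in> cball 0 (B + 1) \<Longrightarrow> p' \<in> cball 0 (B + 1) \<Longrightarrow> dist p' p < \<delta>
      \<Longrightarrow> dist (cert_remainder q lam \<epsilon> p') (cert_remainder q lam \<epsilon> p) < (\<mu> - lam) / 2"
    using half unfolding uniformly_continuous_on_def by blast
  \<comment> \<open>an error \<open>e\<close> in \<open>F'\<close> and in the root and \<open>e * (b - a)\<close> in \<open>F\<close> move the curve by less than \<open>min 1 \<delta>\<close>\<close>
  define e where "e = min 1 \<delta> / (2 * (3 + (b - a)))"
  have e: "e > 0" using \<delta>(1) \<open>a < b\<close> by (auto simp: e_def)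
  have esum: "e + (e * (b - a) + e) < min 1 \<delta>"
  proof -
    have "e * (2 * (3 + (b - a))) = min 1 \<delta>" using \<open>a < b\<close> by (simp add: e_def)
    moreover have "e * (2 * (3 + (b - a))) = 6 * e + 2 * (e * (b - a))" by (simp add: algebra_simps)
    moreover have "e * (b - a) > 0" using e \<open>a < b\<close> by simp
    ultimately show ?thesis using e by linarith
  qed
  have "\<exists>F. \<forall>x\<in>{a..b}. \<bar>F0 x - poly F x\<bar> \<le> e * (b - a)
      \<and> \<bar>riccati_rhs q \<mu> (F0 x) - poly (pderiv F) x\<bar> < e"
    by (rule weierstrass_poly_C1[OF \<open>a < b\<close> _ F0(3) e]) (rule F0(1))
  then obtain F where F: "\<And>x. x \<in> {a..b} \<Longrightarrow> \<bar>F0 x - poly F x\<bar> \<le> e * (b - a)"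
    "\<And>x. x \<in> {a..b} \<Longrightarrow> \<bar>riccati_rhs q \<mu> (F0 x) - poly (pderiv F) x\<bar> < e"
    by blast
  obtain T where T: "\<And>x. x \<in> {a..b} \<Longrightarrow> \<bar>t0 x - poly T x\<bar> < e"
    using weierstrass_poly[OF t0 e] by blast
  show ?thesis
  proof (rule exI[of _ F], rule exI[of _ T], rule exI[of _ \<epsilon>], intro conjI ballI \<epsilon>)
    fix x assume x: "x \<in> {a..b}"
    let ?p = "(poly (pderiv F) x, poly F x, poly T x)"
    have "dist ?p (curve x) \<le> \<bar>poly (pderiv F) x - riccati_rhs q \<mu> (F0 x)\<bar> + (\<bar>poly F x - F0 x\<bar> + \<bar>poly T x - t0 x\<bar>)"
      unfolding curve_def dist_norm diff_Pair
      by (intro order_trans[OF norm_Pair_le] add_mono) simp_all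
    also have "\<dots> < min 1 \<delta>"
      using F(1)[OF x] F(2)[OF x] T[OF x] esum by (simp add: abs_minus_commute)
    finally have d: "dist ?p (curve x) < min 1 \<delta>" .
    have "curve x \<in> cball 0 (B + 1)" using B[OF x] by simp
    moreover have "norm ?p \<le> B + 1"
      using B[OF x] d norm_triangle_sub[of ?p "curve x"] unfolding dist_norm min_less_iff_conj by linarith
    then have "?p \<in> cball 0 (B + 1)" by (simp only: mem_cball_0)
    ultimately have "dist (cert_remainder q lam \<epsilon> ?p) (cert_remainder q lam \<epsilon> (curve x)) < (\<mu> - lam) / 2"
      using \<delta>(2) d by simp
    then show "cert_remainder q lam \<epsilon> ?p > 0" using exact[OF x] unfolding dist_real_def by linarith
  qed
qed

lemma polys3_deg_add:
  assumes "p \<in> polys3_deg \<nu>" "p' \<in> polys3_deg \<nu>"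
  shows "(\<lambda>v. p v + p' v) \<in> polys3_deg \<nu>"
proof -
  obtain c c' where
    "p = (\<lambda>(x, y, z). \<Sum>(i, j, k) \<in> {(i, j, k). i + j + k \<le> \<nu>}. c i j k * x ^ i * y ^ j * z ^ k)"
    "p' = (\<lambda>(x, y, z). \<Sum>(i, j, k) \<in> {(i, j, k). i + j + k \<le> \<nu>}. c' i j k * x ^ i * y ^ j * z ^ k)"
    using assms unfolding polys3_deg_def by blast
  then show ?thesis
    unfolding polys3_deg_def
    by (intro CollectI exI[of _ "\<lambda>i j k. c i j k + c' i j k"])
       (auto simp: sum.distrib[symmetric] distrib_right intro!: sum.cong)
qed

lemma poly_monomial3:
  fixes p :: "real poly"
  assumes "degree p + j + k \<le> \<nu>"
  shows "(\<lambda>(x, y, z). poly p x * y ^ j * z ^ k) \<in> polys3_deg \<nu>"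
proof -
  let ?S = "{(i, j, k). i + j + k \<le> \<nu>} :: (nat \<times> nat \<times> nat) set"
  have fin: "finite ?S" by (rule finite_subset[of _ "{..\<nu>} \<times> {..\<nu>} \<times> {..\<nu>}"]) auto
  have "poly p x * y ^ j * z ^ k
      = (\<Sum>(i', j', k') \<in> ?S. (if j' = j \<and> k' = k then coeff p i' else 0) * x ^ i' * y ^ j' * z ^ k')" for x y z :: real
  proof -
    have "(\<Sum>(i', j', k') \<in> ?S. (if j' = j \<and> k' = k then coeff p i' else 0) * x ^ i' * y ^ j' * z ^ k')
      = (\<Sum>(i', j', k') \<in> {..degree p} \<times> {j} \<times> {k}. coeff p i' * x ^ i' * y ^ j' * z ^ k')"
      by (rule sum.mono_neutral_cong_right[OF fin]) (use assms in \<open>auto simp: coeff_eq_0 split: if_splits intro: le_degree\<close>)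
    also have "\<dots> = (\<Sum>i'\<le>degree p. coeff p i' * x ^ i' * y ^ j * z ^ k)"
      by (rule sum.reindex_bij_witness[where i = "\<lambda>i'. (i', j, k)" and j = fst]) auto
    also have "\<dots> = poly p x * y ^ j * z ^ k" by (simp add: poly_altdef sum_distrib_right)
    finally show ?thesis by simp
  qed
  then show ?thesis
    unfolding polys3_deg_def
    by (intro CollectI exI[of _ "\<lambda>i' j' k'. if j' = j \<and> k' = k then coeff p i' else 0"]) auto
qed

lemma poly_monomial2:
  fixes p :: "real poly"
  assumes "degree p + j \<le> \<nu>"
  shows "(\<lambda>(x, y). poly p x * y ^ j) \<in> polys2_deg \<nu>"
proof -
  let ?S = "{(i, j). i + j \<le> \<nu>} :: (nat \<times> nat) set"
  have fin: "finite ?S" by (rule finite_subset[of _ "{..\<nu>} \<times> {..\<nu>}"]) auto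
  have "poly p x * y ^ j = (\<Sum>(i', j') \<in> ?S. (if j' = j then coeff p i' else 0) * x ^ i' * y ^ j')" for x y :: real
  proof -
    have "(\<Sum>(i', j') \<in> ?S. (if j' = j then coeff p i' else 0) * x ^ i' * y ^ j')
      = (\<Sum>(i', j') \<in> {..degree p} \<times> {j}. coeff p i' * x ^ i' * y ^ j')"
      by (rule sum.mono_neutral_cong_right[OF fin]) (use assms in \<open>auto simp: coeff_eq_0 split: if_splits intro: le_degree\<close>)
    also have "\<dots> = (\<Sum>i'\<le>degree p. coeff p i' * x ^ i' * y ^ j)"
      by (rule sum.reindex_bij_witness[where i = "\<lambda>i'. (i', j)" and j = fst]) auto
    also have "\<dots> = poly p x * y ^ j" by (simp add: poly_altdef sum_distrib_right)
    finally show ?thesis by simp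
  qed
  then show ?thesis
    unfolding polys2_deg_def by (intro CollectI exI[of _ "\<lambda>i' j'. if j' = j then coeff p i' else 0"]) auto
qed

lemma real_polynomial_function_poly_of:
  assumes "real_polynomial_function f"
  shows "real_polynomial_function (\<lambda>v. poly p (f v))"
  using real_polynomial_function_compose[OF _ real_polynomial_function_poly, of f p] assms
  by (simp add: comp_def real_polynomial_function_eq)

lemma integrand_ansatz_poly:
  "(\<lambda>(x, y, z). f_int q x y z lam + total_D (ansatz q (poly F)) x y z)
   = (\<lambda>(x, y, z). z ^ (2*q) + poly (pderiv F - [:lam:]) x * y ^ (2*q) + real (2*q) * poly F x * y ^ (2*q-1) * z)"
  by (auto simp: f_int_def total_D_ansatz[OF poly_DERIV] algebra_simps)

lemma integrand_in_polys3:
  assumes "q \<ge> 1" "degree F + 2*q \<le> \<nu>"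
  shows "(\<lambda>(x, y, z). f_int q x y z lam + total_D (ansatz q (poly F)) x y z) \<in> polys3_deg \<nu>"
proof -
  have "degree (pderiv F - [:lam:]) \<le> degree F"
    by (rule degree_diff_le) (auto simp: degree_pderiv)
  then have "(\<lambda>(x, y, z). poly [:1:] x * y ^ 0 * z ^ (2*q)) \<in> polys3_deg \<nu>"
    "(\<lambda>(x, y, z). poly (pderiv F - [:lam:]) x * y ^ (2*q) * z ^ 0) \<in> polys3_deg \<nu>"
    "(\<lambda>(x, y, z). poly (smult (real (2*q)) F) x * y ^ (2*q-1) * z ^ 1) \<in> polys3_deg \<nu>"
    using assms by (intro poly_monomial3; simp)+
  note polys3_deg_add[OF polys3_deg_add[OF this(1,2)] this(3)]
  then show ?thesis unfolding integrand_ansatz_poly by (simp add: case_prod_unfold)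
qed

text \<open>A fraction \<open>1 - \<epsilon>\<close> of \<open>z\<^sup>2\<^sup>q\<close> goes into Young's form with the approximate root \<open>t\<close>. The rest, through
  \<open>amgm (q-1)\<close>, supplies a term \<open>z\<^sup>2 y\<^sup>2\<^sup>q\<^sup>-\<^sup>2\<close> that absorbs the error in the mixed term by completing a
  square.\<close>

lemma certificate_identity:
  fixes y z f F t :: real
  assumes "q \<ge> 1" "\<epsilon> > 0"
  shows "z ^ (2*q) + (f - lam) * y ^ (2*q) + real (2*q) * F * y ^ (2*q-1) * z
    = (1 - \<epsilon>) * (z ^ (2*q) + real (2*q-1) * (- (t * y)) ^ (2*q) - real (2*q) * (- (t * y)) ^ (2*q-1) * z)
    + \<epsilon> * amgm (q-1) (y\<^sup>2) (z\<^sup>2)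
    + (real q / \<epsilon>) * ((y ^ (q-1))\<^sup>2 * (\<epsilon> * z + (F - (1 - \<epsilon>) * t ^ (2*q-1)) * y)\<^sup>2)
    + cert_remainder q lam \<epsilon> (f, F, t) * y ^ (2*q)"
proof -
  obtain m where q: "q = Suc m" using assms(1) by (cases q) auto
  define Y where "Y = y ^ (2*m)"
  define Z where "Z = z ^ (2*m)"
  define T where "T = t ^ (2*m)"
  define n where "n = real m"
  have e: "2*m+2-1 = 2*m+1" "2*q = 2*m+2" "2*q-1 = 2*m+1" "q - 1 = m" by (auto simp: q)
  have r: "real (2*m+2) = 2*n+2" "real (2*m+1) = 2*n+1" "real q = n+1" "real (Suc m) = n+1" "real m = n" by (auto simp: n_def q)
  have p: "y ^ (2*m+i) = Y * y ^ i" "z ^ (2*m+i) = Z * z ^ i" "t ^ (2*m+i) = T * t ^ i" for i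
    by (auto simp: Y_def Z_def T_def power_add)
  have w: "(- (t * y)) ^ (2*m+1) = - (T * t * Y * y)" "(- (t * y)) ^ (2*m+2) = T * t\<^sup>2 * Y * y\<^sup>2"
    by (auto simp: power_mult_distrib Y_def T_def power2_eq_square)
  have a: "amgm m (y\<^sup>2) (z\<^sup>2) = n * (Y * y\<^sup>2) + Z * z\<^sup>2 - (n+1) * z\<^sup>2 * Y"
    by (simp add: amgm_def Y_def Z_def n_def power_mult[symmetric] power_add[symmetric] power2_eq_square) (simp add: power_mult power2_eq_square algebra_simps)
  have s: "(y ^ m)\<^sup>2 = Y" by (simp add: Y_def power_mult mult.commute flip: power_mult)
  let ?E = "F - (1 - \<epsilon>) * (T * t ^ 1)"
  have R: "\<epsilon> * cert_remainder q lam \<epsilon> (f, F, t) = \<epsilon> * (f - lam - (1 - \<epsilon>) * (2*n+1) * (T * t\<^sup>2) - \<epsilon> * n) - (n+1) * ?E\<^sup>2"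
  proof -
    have "\<epsilon> * cert_remainder q lam \<epsilon> (f, F, t)
      = \<epsilon> * (f - lam - (1 - \<epsilon>) * (2*n+1) * (T * t\<^sup>2) - \<epsilon> * (n + 1 - 1) - (n+1) * ?E\<^sup>2 / \<epsilon>)"
      by (simp only: cert_remainder_def prod.case e p r)
    also have "\<dots> = \<epsilon> * (f - lam - (1 - \<epsilon>) * (2*n+1) * (T * t\<^sup>2) - \<epsilon> * n) - \<epsilon> * ((n+1) * ?E\<^sup>2 / \<epsilon>)"
      by (simp add: right_diff_distrib)
    finally show ?thesis using assms(2) by simp
  qed
  have "\<epsilon> * (Z * z ^ 2 + (f - lam) * (Y * y ^ 2) + (2*n+2) * F * (Y * y ^ 1) * z)
    = \<epsilon> * ((1 - \<epsilon>) * (Z * z ^ 2 + (2*n+1) * (T * t\<^sup>2 * Y * y\<^sup>2) - (2*n+2) * (- (T * t * Y * y)) * z))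
    + \<epsilon> * (\<epsilon> * (n * (Y * y\<^sup>2) + Z * z\<^sup>2 - (n+1) * z\<^sup>2 * Y))
    + (n+1) * (Y * (\<epsilon> * z + ?E * y)\<^sup>2)
    + (\<epsilon> * (f - lam - (1 - \<epsilon>) * (2*n+1) * (T * t\<^sup>2) - \<epsilon> * n) - (n+1) * ?E\<^sup>2) * (Y * y ^ 2)"
    by algebra
  then have "\<epsilon> * (Z * z ^ 2 + (f - lam) * (Y * y ^ 2) + (2*n+2) * F * (Y * y ^ 1) * z)
    = \<epsilon> * ((1 - \<epsilon>) * (Z * z ^ 2 + (2*n+1) * (T * t\<^sup>2 * Y * y\<^sup>2) - (2*n+2) * (- (T * t * Y * y)) * z)
    + \<epsilon> * (n * (Y * y\<^sup>2) + Z * z\<^sup>2 - (n+1) * z\<^sup>2 * Y)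
    + ((n+1) / \<epsilon>) * (Y * (\<epsilon> * z + ?E * y)\<^sup>2)
    + cert_remainder q lam \<epsilon> (f, F, t) * (Y * y ^ 2))"
    unfolding R[symmetric] using assms(2) by (simp add: distrib_left mult.assoc)
  then have "Z * z ^ 2 + (f - lam) * (Y * y ^ 2) + (2*n+2) * F * (Y * y ^ 1) * z
    = (1 - \<epsilon>) * (Z * z ^ 2 + (2*n+1) * (T * t\<^sup>2 * Y * y\<^sup>2) - (2*n+2) * (- (T * t * Y * y)) * z)
    + \<epsilon> * (n * (Y * y\<^sup>2) + Z * z\<^sup>2 - (n+1) * z\<^sup>2 * Y)
    + ((n+1) / \<epsilon>) * (Y * (\<epsilon> * z + ?E * y)\<^sup>2)
    + cert_remainder q lam \<epsilon> (f, F, t) * (Y * y ^ 2)"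
    using assms(2) by simp
  then show ?thesis by (simp only: e w p r a s)
qed

text \<open>Sums of squares in \<open>(x, y, z)\<close> plus \<open>R(x) y\<^sup>2\<^sup>q\<close>, where Putinar's theorem in the single variable \<open>x\<close>
  applies to the remainder \<open>R\<close>.\<close>

lemma integrand_in_Q_Gamma:
  assumes q: "q \<ge> 1" and "a < b" and sol: "riccati_solvable q a b \<mu>" and "lam < \<mu>"
    and K: "{a..b} = {x. \<forall>i<s. poly (g i) x \<ge> 0}" and arch: "(\<lambda>x. r\<^sup>2 - x\<^sup>2) \<in> Q_Omega s g"
  shows "\<exists>F. \<forall>\<nu>\<ge>degree F + 2*q.
    (\<lambda>(x, y, z). f_int q x y z lam + total_D (ansatz q (poly F)) x y z) \<in> Q_Gamma s g \<nu>"
proof -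
  obtain F T :: "real poly" and \<epsilon> where \<epsilon>: "0 < \<epsilon>" "\<epsilon> < 1" and
    pos: "\<And>x. x \<in> {a..b} \<Longrightarrow> cert_remainder q lam \<epsilon> (poly (pderiv F) x, poly F x, poly T x) > 0"
    using cert_remainder_positive[OF q \<open>a < b\<close> sol \<open>lam < \<mu>\<close>] by blast
  define R where "R = pderiv F - [:lam:] - smult ((1 - \<epsilon>) * real (2*q-1)) (T ^ (2*q)) - [:\<epsilon> * (real q - 1):]
     - smult (real q / \<epsilon>) ((F - smult (1 - \<epsilon>) (T ^ (2*q-1)))\<^sup>2)"
  have R: "poly R x = cert_remainder q lam \<epsilon> (poly (pderiv F) x, poly F x, poly T x)" for x
    by (simp add: R_def cert_remainder_def)
  have RQ: "poly R \<in> Q_Omega s g"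
    by (rule putinar_interval[OF K \<open>a < b\<close> arch]) (simp add: R pos)
  define px :: "real \<times> real \<times> real \<Rightarrow> real" where "px = fst"
  define py :: "real \<times> real \<times> real \<Rightarrow> real" where "py = (\<lambda>v. fst (snd v))"
  define pz :: "real \<times> real \<times> real \<Rightarrow> real" where "pz = (\<lambda>v. snd (snd v))"
  have lin: "real_polynomial_function px" "real_polynomial_function py" "real_polynomial_function pz"
    unfolding px_def py_def pz_def
    by (intro real_polynomial_function.intros(1) bounded_linear_intros)+
  note pp = real_polynomial_function_poly_of[OF lin(1)]
  let ?t = "\<lambda>v. - (poly T (px v) * py v)"
  let ?E = "\<lambda>v. \<epsilon> * pz v + (poly F (px v) - (1 - \<epsilon>) * poly T (px v) ^ (2*q-1)) * py v"
  let ?G = "\<lambda>i (x, y, z). poly (g i) x"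
  have tpoly: "real_polynomial_function ?t"
    by (intro real_polynomial_function_minus real_polynomial_function.intros(4) pp lin)
  have Epoly: "real_polynomial_function ?E"
    by (intro real_polynomial_function_diff real_polynomial_function.intros(2-4) real_polynomial_function_power pp lin)
  have sos1: "(\<lambda>v. (1 - \<epsilon>) * (pz v ^ (2*q) + real (2*q-1) * ?t v ^ (2*q) - real (2*q) * ?t v ^ (2*q-1) * pz v)) \<in> SOS"
    using \<epsilon> by (intro SOS_mult[OF SOS_const SOS_amgm_even[OF lin(3) tpoly q]]) simp
  have sos2: "(\<lambda>v. \<epsilon> * amgm (q-1) ((py v)\<^sup>2) ((pz v)\<^sup>2)) \<in> SOS"
    using \<epsilon> by (intro SOS_mult[OF SOS_const SOS_amgm_squares[OF lin(2,3)]]) simp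
  have sos3: "(\<lambda>v. (real q / \<epsilon>) * ((py v ^ (q-1))\<^sup>2 * (?E v)\<^sup>2)) \<in> SOS"
    using \<epsilon> by (intro SOS_mult[OF SOS_const SOS_mult_square[OF SOS_square[OF Epoly] real_polynomial_function_power[OF lin(2)]]]) simp
  have "polynomial_function px" using lin(1) by (simp add: real_polynomial_function_eq)
  from quad_module_compose[OF RQ[unfolded Q_Omega_def] this]
  have "(\<lambda>v. poly R (px v)) \<in> quad_module {..<s} ?G" by (simp add: px_def case_prod_unfold)
  from quad_module_mult[OF this SOS_even_power[OF lin(2), of q]]
  have qm4: "(\<lambda>v. poly R (px v) * py v ^ (2*q)) \<in> quad_module {..<s} ?G" .
  note total = quad_module_add[OF quad_module_SOS[OF SOS_add[OF SOS_add[OF sos1 sos2] sos3] finite_lessThan] qm4]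
  have "(\<lambda>(x, y, z). f_int q x y z lam + total_D (ansatz q (poly F)) x y z) \<in> quad_module {..<s} ?G"
  proof -
    have "(\<lambda>(x, y, z). f_int q x y z lam + total_D (ansatz q (poly F)) x y z)
      = (\<lambda>v. pz v ^ (2*q) + (poly (pderiv F) (px v) - lam) * py v ^ (2*q) + real (2*q) * poly F (px v) * py v ^ (2*q-1) * pz v)"
      unfolding integrand_ansatz_poly by (auto simp: px_def py_def pz_def)
    also have "\<dots> = (\<lambda>v. (1 - \<epsilon>) * (pz v ^ (2*q) + real (2*q-1) * ?t v ^ (2*q) - real (2*q) * ?t v ^ (2*q-1) * pz v)
       + \<epsilon> * amgm (q-1) ((py v)\<^sup>2) ((pz v)\<^sup>2) + (real q / \<epsilon>) * ((py v ^ (q-1))\<^sup>2 * (?E v)\<^sup>2)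
       + poly R (px v) * py v ^ (2*q))"
      unfolding R by (intro ext certificate_identity[OF q \<epsilon>(1)])
    finally show ?thesis using total by simp
  qed
  then show ?thesis
    using integrand_in_polys3[OF q] unfolding Q_Gamma_def by (intro exI[of _ F]) simp
qed

text \<open>The boundary constraints hold with zero multipliers since the ansatz is divisible by \<open>y\<close>.
  A certificate valid for one degree bound remains valid for all larger ones.\<close>

lemma sos_feasible_eventually:
  assumes q: "q \<ge> 1" and "a < b" and "riccati_solvable q a b \<mu>" "lam < \<mu>"
    and "{a..b} = {x. \<forall>i<s. poly (g i) x \<ge> 0}" "(\<lambda>x. r\<^sup>2 - x\<^sup>2) \<in> Q_Omega s g"
  shows "\<exists>N. \<forall>\<nu>\<ge>N. \<exists>F. sos_feasible q s g \<nu> lam F (\<lambda>i. 0)"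
proof -
  obtain F where F: "\<And>\<nu>. degree F + 2*q \<le> \<nu> \<Longrightarrow>
    (\<lambda>(x, y, z). f_int q x y z lam + total_D (ansatz q (poly F)) x y z) \<in> Q_Gamma s g \<nu>"
    using integrand_in_Q_Gamma[OF assms] by blast
  \<comment> \<open>bounds the degree of the integrand and of all boundary polynomials \<open>F * g\<^sub>i' * y ^ (2*q)\<close>\<close>
  define N where "N = degree F + 2*q + (\<Sum>i<s. degree (pderiv (g i)))"
  have "sos_feasible q s g \<nu> lam F (\<lambda>i. 0)" if "\<nu> \<ge> N" for \<nu>
    unfolding sos_feasible_def
  proof (intro conjI allI impI)
    show "degree F \<le> \<nu>" using that by (simp add: N_def)
    show "(\<lambda>(x, y, z). f_int q x y z lam + total_D (ansatz q (poly F)) x y z) \<in> Q_Gamma s g \<nu>"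
      using that by (intro F) (simp add: N_def)
    fix i assume i: "i < s"
    have "degree (pderiv (g i)) \<le> (\<Sum>i<s. degree (pderiv (g i)))" using i by (intro member_le_sum) auto
    then have deg: "degree (F * pderiv (g i)) + 2*q \<le> \<nu>"
      using that degree_mult_le[of F "pderiv (g i)"] by (simp add: N_def)
    let ?\<rho> = "\<lambda>v :: real \<times> real. poly (F * pderiv (g i)) (fst v) * snd v ^ (2*q-1)"
    have \<rho>: "real_polynomial_function ?\<rho>"
      by (intro real_polynomial_function.intros(4)[OF real_polynomial_function_poly_of real_polynomial_function_power]
           real_polynomial_function.intros(1)[OF bounded_linear_fst] real_polynomial_function.intros(1)[OF bounded_linear_snd])
    have zero: "(\<lambda>v :: real \<times> real. 0) \<in> quad_module ({..<s} - {i}) (\<lambda>j (x, y). poly (g j) x)"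
      by (intro quad_module_SOS SOS_const) auto
    have eq: "(\<lambda>(x, y). ansatz q (poly F) x y * poly (pderiv (g i)) x - poly 0 x * \<bar>poly (pderiv (g i)) x\<bar>\<^sup>2)
       = (\<lambda>(x, y). poly (F * pderiv (g i)) x * y ^ (2*q))" by (auto simp: ansatz_def)
    have "y ^ (2*q) = y ^ (2*q-1) * y" for y :: real using q by (cases q) auto
    then have split: "(\<lambda>(x, y). poly (F * pderiv (g i)) x * y ^ (2*q))
       = (\<lambda>(x, y). ?\<rho> (x, y) * y + (\<lambda>v. 0) (x, y) * poly (g i) x + (\<lambda>v. 0) (x, y))"
      by (auto simp: mult.assoc)
    have "\<exists>\<rho>1 \<rho>2 m. real_polynomial_function \<rho>1 \<and> real_polynomial_function \<rho>2 \<and>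
        m \<in> quad_module ({..<s} - {i}) (\<lambda>j (x, y). poly (g j) x) \<and>
        (\<lambda>(x, y). poly (F * pderiv (g i)) x * y ^ (2*q))
          = (\<lambda>(x, y). \<rho>1 (x, y) * y + \<rho>2 (x, y) * poly (g i) x + m (x, y))"
      by (rule exI[of _ ?\<rho>], rule exI[of _ "\<lambda>v. 0"], rule exI[of _ "\<lambda>v. 0"])
         (intro conjI \<rho> real_polynomial_function.intros(2) zero split)
    then show "(\<lambda>(x, y). ansatz q (poly F) x y * poly (pderiv (g i)) x
        - poly 0 x * \<bar>poly (pderiv (g i)) x\<bar>\<^sup>2) \<in> Q_Lambda s g i \<nu>"
      unfolding eq Q_Lambda_def using poly_monomial2[OF deg] by blast
  qed auto
  then show ?thesis by blast
qed

lemma sos_hat_weak_duality: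
  assumes "sos_hat_feasible q s g \<nu> lam F" "q \<ge> 1" "a < b"
    and K: "{a..b} = {x. \<forall>i<s. poly (g i) x \<ge> 0}"
  shows "rayleigh_nonneg q a b lam"
proof (rule pdr_hat_weak_duality)
  have Q: "(\<lambda>(x, y, z). f_int q x y z lam + total_D (ansatz q (poly F)) x y z)
      \<in> quad_module {..<s} (\<lambda>i (x, y, z). poly (g i) x)"
    using assms(1) unfolding sos_hat_feasible_def Q_Gamma_def by blast
  have "f_int q x y z lam + total_D (ansatz q (poly F)) x y z \<ge> 0" if "x \<in> {a<..<b}" for x y z
  proof -
    have "x \<in> {a..b}" using that by auto
    then show ?thesis using quad_module_nonneg[OF Q, of "(x, y, z)"] K by auto
  qed
  moreover have "ansatz q (poly F) \<in> Phi_hat q a b"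
    by (rule ansatz_Phi(2)[of a b _ "poly (pderiv F)"]) (use assms(2,3) in \<open>auto intro: poly_DERIV continuous_intros\<close>)
  ultimately show "pdr_hat_feasible q a b lam (ansatz q (poly F)) (\<lambda>x. 0)"
    unfolding pdr_hat_feasible_def by simp
qed

text \<open>Both values are at most \<open>lambda_star\<close> by weak duality, and the smaller one eventually exceeds every
  number below it.\<close>

lemma B_sos_converges:
  assumes q: "q \<ge> 1" and "a < b" and desc: "semialgebraic_description a b s g"
    and arch: "(\<lambda>x. r\<^sup>2 - x\<^sup>2) \<in> Q_Omega s g"
  shows "(\<lambda>\<nu>. B_sos q s g \<nu>) \<longlonglongrightarrow> lambda_star q a b"
    and "(\<lambda>\<nu>. B_sos_hat q s g \<nu>) \<longlonglongrightarrow> lambda_star q a b"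
proof -
  have K: "{a..b} = {x. \<forall>i<s. poly (g i) x \<ge> 0}" using desc by (simp add: semialgebraic_description_def)
  have "sos_hat_feasible q s g \<nu> lam F" if "sos_feasible q s g \<nu> lam F Q" for \<nu> lam F Q
    using that unfolding sos_feasible_def sos_hat_feasible_def by blast
  then have le: "B_sos q s g \<nu> \<le> B_sos_hat q s g \<nu>" for \<nu>
    unfolding B_sos_def B_sos_hat_def by (intro Sup_subset_mono) blast
  have upper: "B_sos_hat q s g \<nu> \<le> lambda_star q a b" for \<nu>
    unfolding B_sos_hat_def lambda_star_eq
    by (rule Sup_subset_mono) (use sos_hat_weak_duality[OF _ q \<open>a < b\<close> K] in blast)
  have lower: "\<forall>\<^sub>F \<nu> in sequentially. y < B_sos q s g \<nu>" if y: "y < lambda_star q a b" for y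
  proof -
    obtain \<mu> where \<mu>: "riccati_solvable q a b \<mu>" "y < ereal \<mu>"
      using below_lambda_star[OF q \<open>a < b\<close> y] by blast
    obtain lam where lam: "y < ereal lam" "lam < \<mu>" using ereal_dense2[OF \<mu>(2)] by auto
    obtain N where N: "\<And>\<nu>. \<nu> \<ge> N \<Longrightarrow> \<exists>F. sos_feasible q s g \<nu> lam F (\<lambda>i. 0)"
      using sos_feasible_eventually[OF q \<open>a < b\<close> \<mu>(1) lam(2) K arch] by blast
    have "ereal lam \<le> B_sos q s g \<nu>" if "\<nu> \<ge> N" for \<nu>
      unfolding B_sos_def using N[OF that] by (intro Sup_upper) blast
    then show ?thesis using lam(1) by (auto simp: eventually_sequentially intro!: exI[of _ N] elim: order_less_le_trans)
  qed
  show "(\<lambda>\<nu>. B_sos q s g \<nu>) \<longlonglongrightarrow> lambda_star q a b"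
    using le upper by (intro order_tendstoI lower) (auto intro!: always_eventually intro: order_le_less_trans order_trans)
  show "(\<lambda>\<nu>. B_sos_hat q s g \<nu>) \<longlonglongrightarrow> lambda_star q a b"
  proof (rule order_tendstoI)
    fix y assume "y < lambda_star q a b"
    from lower[OF this] show "\<forall>\<^sub>F \<nu> in sequentially. y < B_sos_hat q s g \<nu>"
      by (rule eventually_mono) (rule order_less_le_trans[OF _ le])
  next
    fix y assume "lambda_star q a b < y"
    then show "\<forall>\<^sub>F \<nu> in sequentially. B_sos_hat q s g \<nu> < y"
      by (intro always_eventually allI order_le_less_trans[OF upper])
  qed
qed

theorem theorem4p4:
  fixes q :: nat and a b :: real
  assumes "q \<ge> 1" and "a < b"
  shows "(\<forall>s dO. boundary_pieces a b s dO \<longrightarrow>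
            B_pdr_hat q a b = B_pdr q a b s dO \<and>
            B_pdr q a b s dO = lambda_star q a b \<and>
            (\<exists>(F :: nat \<Rightarrow> real \<Rightarrow> real) (lam :: nat \<Rightarrow> real).
               (\<forall>k. continuous_on {a..b} (F k)) \<and>
               (\<forall>k. pdr_hat_feasible q a b (lam k) (ansatz q (F k)) (\<lambda>x. 0)) \<and>
               (\<lambda>k. ereal (lam k)) \<longlonglongrightarrow> B_pdr_hat q a b \<and>
               (\<forall>k. pdr_feasible q a b s dO (lam k) (ansatz q (F k)) (\<lambda>x. 0) (\<lambda>i x. 0)) \<and>
               (\<lambda>k. ereal (lam k)) \<longlonglongrightarrow> B_pdr q a b s dO)) \<and>
         (\<forall>s g. semialgebraic_description a b s g \<and>
            (\<exists>r. (\<lambda>x. r\<^sup>2 - x\<^sup>2) \<in> Q_Omega s g) \<longrightarrow>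
            (\<lambda>\<nu>. B_sos q s g \<nu>) \<longlonglongrightarrow> lambda_star q a b \<and>
            (\<lambda>\<nu>. B_sos_hat q s g \<nu>) \<longlonglongrightarrow> lambda_star q a b)"
proof (intro conjI allI impI)
  fix s dO assume bp: "boundary_pieces a b s dO"
  note exact = relaxations_exact[OF assms bp]
  show "B_pdr_hat q a b = B_pdr q a b s dO" using exact by simp
  show "B_pdr q a b s dO = lambda_star q a b" by (rule exact(2))
  obtain lam :: "nat \<Rightarrow> real" where lam: "\<And>k. riccati_solvable q a b (lam k)"
    "(\<lambda>k. ereal (lam k)) \<longlonglongrightarrow> lambda_star q a b"
    using maximizing_sequence[OF assms] by blast
  have "\<forall>k. \<exists>F. continuous_on {a..b} F \<and> pdr_hat_feasible q a b (lam k) (ansatz q F) (\<lambda>x. 0) \<and>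
      pdr_feasible q a b s dO (lam k) (ansatz q F) (\<lambda>x. 0) (\<lambda>i x. 0)"
    using riccati_solvable_feasible[OF lam(1) assms] bp by blast
  then obtain F where "\<forall>k. continuous_on {a..b} (F k) \<and> pdr_hat_feasible q a b (lam k) (ansatz q (F k)) (\<lambda>x. 0) \<and>
      pdr_feasible q a b s dO (lam k) (ansatz q (F k)) (\<lambda>x. 0) (\<lambda>i x. 0)" by (rule choice[THEN exE])
  then show "\<exists>(F :: nat \<Rightarrow> real \<Rightarrow> real) (lam :: nat \<Rightarrow> real).
               (\<forall>k. continuous_on {a..b} (F k)) \<and>
               (\<forall>k. pdr_hat_feasible q a b (lam k) (ansatz q (F k)) (\<lambda>x. 0)) \<and>
               (\<lambda>k. ereal (lam k)) \<longlonglongrightarrow> B_pdr_hat q a b \<and>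
               (\<forall>k. pdr_feasible q a b s dO (lam k) (ansatz q (F k)) (\<lambda>x. 0) (\<lambda>i x. 0)) \<and>
               (\<lambda>k. ereal (lam k)) \<longlonglongrightarrow> B_pdr q a b s dO"
    using lam(2) unfolding exact by blast
next
  fix s g assume "semialgebraic_description a b s g \<and> (\<exists>r. (\<lambda>x. r\<^sup>2 - x\<^sup>2) \<in> Q_Omega s g)"
  then obtain r where r: "semialgebraic_description a b s g" "(\<lambda>x. r\<^sup>2 - x\<^sup>2) \<in> Q_Omega s g"
    by blast
  show "(\<lambda>\<nu>. B_sos q s g \<nu>) \<longlonglongrightarrow> lambda_star q a b" by (rule B_sos_converges(1)[OF assms r])
  show "(\<lambda>\<nu>. B_sos_hat q s g \<nu>) \<longlonglongrightarrow> lambda_star q a b" by (rule B_sos_converges(2)[OF assms r])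
qed

end
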